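(* Let $q\in\mathbf{C}$, $|q|>1$, and let $(\Lambda_1,\dots,\Lambda_m)$ be an ordered partition of a divisor $\Lambda$, i.e. $\Lambda=\Lambda_1+\cdots+\Lambda_m$ with each $\Lambda_i$ a divisor of degree $\ge1$. To each $f\in\mathbb{O}^\Lambda_{(\Lambda_1,\dots,\Lambda_m)}$ there corresponds a unique power series $\hat f=\sum_{n\ge0}a_nz^n\in\mathbf{C}[[z]]_{q;1/|\Lambda_1|}$ satisfying the following property: for all $R>0$ near enough to $0$, there are constants $C,A>0$ such that, for all $\epsilon>0$, all $z\in S(\Lambda,\epsilon;R)$ and all integers $n\ge0$, $$\Bigl|f(z)-\sum_{\ell=0}^{n-1}a_\ell z^\ell\Bigr|<\frac C\epsilon A^n|q|^{n^2/(2|\Lambda_1|)}|z|^n.$$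
   Context: Functions are considered as germs at $0$. For $\lambda\in\mathbf{C}^*$, $[\lambda]=\lambda q^{\mathbf{Z}}$. A divisor is a finite formal sum $\Lambda=\sum_i\nu_i[\lambda_i]$ ($\nu_i\in\mathbf{N}$, distinct $[\lambda_i]$), $|\Lambda|=\sum\nu_i$. $d_q(z,[\lambda])=\inf_{\xi\in[\lambda]}|1-z/\xi|$, $d_q(z,\Lambda)=\prod_id_q(z,[\lambda_i])^{\nu_i}$, $S(\Lambda,\epsilon;R)=\{z\in\mathbf{C}^*:d_q(z,\Lambda)>\epsilon,|z|<R\}$. $\mathbf{C}[[z]]_{q;s}$ is the space of series with $a_n=O(A^n|q|^{sn^2/2})$ for some $A>0$. $\theta(z)=\sum_{n\in\mathbf{Z}}q^{-n(n-1)/2}z^n$, $\theta_\Lambda(z)=\prod_i\theta(-z/\lambda_i)^{\nu_i}$, $e(z)=\sum_{n\in\mathbf{Z}}|q|^{-n(n-1)/2}|z|^n$. A function $F$ analytic in a punctured neighborhood of $0$ has $q$-Gevrey order $k$ at $0$ if $|F(z)|\le C\,e(\mu z)^k$ near $0$ for some $C,\mu>0$. If $\Lambda'=\sum\nu'_i[\lambda_i]$, $\Lambda=\sum\nu_i[\lambda_i]$ with $0\le\nu'_i\le\nu_i$, $F$ has $q$-Gevrey order $k$ over $\Lambda/\Lambda'$ at $0$ if for all $i$ and $\nu_i'\le j<\nu_i$ there are $C,A>0$ with $|F^{(j)}(\lambda_iq^{-n})|\le CA^n|q|^{kn^2/2}$ for all large $n$. $\mathbb{B}^\Lambda$: functions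 $f$ analytic on some $S(\Lambda,0;R)$ with $\sup_{S(\Lambda,\epsilon;r)}|f|<\infty$ for all $\epsilon>0$, $0<r<R$. With $\Lambda_{\ge i}=\sum_{j\ge i}\Lambda_j$ ($\Lambda_{\ge m+1}$ null), $\mathbb{E}^\Lambda_{(\Lambda_1,\dots,\Lambda_m)}$ is the set of functions analytic in a punctured neighborhood of $0$, of $q$-Gevrey order $|\Lambda|$ at $0$ and, for $i=1,\dots,m$, of $q$-Gevrey order $|\Lambda_{\ge i+1}|$ over $\Lambda_{\ge i}/\Lambda_{\ge i+1}$ at $0$. $\mathbb{O}^\Lambda_{(\Lambda_1,\dots,\Lambda_m)}:=\bigl(\frac1{\theta_\Lambda}\mathbb{E}^\Lambda_{(\Lambda_1,\dots,\Lambda_m)}\bigr)\cap\mathbb{B}^\Lambda$ (multisummable functions). *)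

theory Defs
  imports
    "HOL-Complex_Analysis.Complex_Analysis"
    "HOL-Library.Multiset"
    "HOL-Library.Landau_Symbols"
begin

definition qspiral :: "complex \<Rightarrow> complex \<Rightarrow> complex set" where
  "qspiral q l = range (\<lambda>k::int. l * q powi k)"

text \<open>A divisor is a finite multiset of \<open>q\<close>-spirals: \<open>\<nu>\<^sub>i\<close> is the multiplicity of
  \<open>[\<lambda>\<^sub>i]\<close>, the sum is the multiset sum and the degree is \<^const>\<open>size\<close>.\<close>

type_synonym divisor = "complex set multiset"

definition is_divisor :: "complex \<Rightarrow> divisor \<Rightarrow> bool" where
  "is_divisor q \<Lambda> \<longleftrightarrow> (\<forall>\<sigma> \<in># \<Lambda>. \<exists>l. l \<noteq> 0 \<and> \<sigma> = qspiral q l)"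

definition dq_spiral :: "complex \<Rightarrow> complex set \<Rightarrow> real" where
  "dq_spiral z \<sigma> = (INF \<xi>\<in>\<sigma>. norm (1 - z / \<xi>))"

definition dq :: "complex \<Rightarrow> divisor \<Rightarrow> real" where
  "dq z \<Lambda> = (\<Prod>\<sigma>\<in>set_mset \<Lambda>. dq_spiral z \<sigma> ^ count \<Lambda> \<sigma>)"

definition qsector :: "divisor \<Rightarrow> real \<Rightarrow> real \<Rightarrow> complex set" where
  "qsector \<Lambda> \<epsilon> R = {z. z \<noteq> 0 \<and> dq z \<Lambda> > \<epsilon> \<and> norm z < R}"

definition qgevrey_fps :: "complex \<Rightarrow> real \<Rightarrow> complex fps set" where
  "qgevrey_fps q s =
     {a. \<exists>A>0. (\<lambda>n. norm (fps_nth a n)) \<in> O(\<lambda>n. A ^ n * norm q powr (s * real n ^ 2 / 2))}"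

definition theta :: "complex \<Rightarrow> complex \<Rightarrow> complex" where
  "theta q z = (\<Sum>\<^sub>\<infinity>n::int. q powi (- (n * (n - 1) div 2)) * z powi n)"

definition efun :: "complex \<Rightarrow> complex \<Rightarrow> real" where
  "efun q z = (\<Sum>\<^sub>\<infinity>n::int. norm q powi (- (n * (n - 1) div 2)) * norm z powi n)"

text \<open>The function \<open>\<theta>\<^sub>\<Lambda>\<close> and the values \<open>F\<^sup>(\<^sup>j\<^sup>)(\<lambda>\<^sub>i q\<^sup>-\<^sup>n)\<close> below depend on the numbers
  \<open>\<lambda>\<^sub>i\<close> and not only on their classes. The parameter \<open>\<rho>\<close> is this choice of representatives:
  \<open>\<rho> \<sigma>\<close> is a point of the spiral \<open>\<sigma>\<close>.\<close>

definition theta_div :: "complex \<Rightarrow> (complex set \<Rightarrow> complex) \<Rightarrow> divisor \<Rightarrow> complex \<Rightarrow> complex" where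
  "theta_div q \<rho> \<Lambda> z = (\<Prod>\<sigma>\<in>set_mset \<Lambda>. theta q (- z / \<rho> \<sigma>) ^ count \<Lambda> \<sigma>)"

definition analytic_punctured :: "(complex \<Rightarrow> complex) \<Rightarrow> bool" where
  "analytic_punctured F \<longleftrightarrow> (\<exists>r>0. F analytic_on (ball 0 r - {0}))"

definition qgevrey_at_0 :: "complex \<Rightarrow> nat \<Rightarrow> (complex \<Rightarrow> complex) \<Rightarrow> bool" where
  "qgevrey_at_0 q k F \<longleftrightarrow>
     (\<exists>C>0. \<exists>\<mu>>0. \<forall>\<^sub>F z in at 0. norm (F z) \<le> C * efun q (of_real \<mu> * z) ^ k)"

definition qgevrey_over ::
  "complex \<Rightarrow> (complex set \<Rightarrow> complex) \<Rightarrow> nat \<Rightarrow> divisor \<Rightarrow> divisor \<Rightarrow> (complex \<Rightarrow> complex) \<Rightarrow> bool"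
where
  "qgevrey_over q \<rho> k \<Lambda> \<Lambda>' F \<longleftrightarrow>
     (\<forall>\<sigma> \<in># \<Lambda>. \<forall>j. count \<Lambda>' \<sigma> \<le> j \<and> j < count \<Lambda> \<sigma> \<longrightarrow>
        (\<exists>C>0. \<exists>A>0. \<forall>\<^sub>F n in sequentially.
           norm ((deriv ^^ j) F (\<rho> \<sigma> * q powi (- int n)))
             \<le> C * A ^ n * norm q powr (real k * real n ^ 2 / 2)))"

text \<open>Germs at \<open>0\<close> are represented by total functions, of which only the values near \<open>0\<close>
  (and off the spirals, for \<open>\<bbbB>\<close> and \<open>\<bbbO>\<close>) matter.\<close>

definition qB :: "divisor \<Rightarrow> (complex \<Rightarrow> complex) set" where
  "qB \<Lambda> = {f. \<exists>R>0. f analytic_on qsector \<Lambda> 0 R \<and>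
                (\<forall>\<epsilon>>0. \<forall>r. 0 < r \<and> r < R \<longrightarrow> bounded (f ` qsector \<Lambda> \<epsilon> r))}"

definition ordered_partition :: "complex \<Rightarrow> divisor \<Rightarrow> nat \<Rightarrow> (nat \<Rightarrow> divisor) \<Rightarrow> bool" where
  "ordered_partition q \<Lambda> m P \<longleftrightarrow>
     1 \<le> m \<and> (\<forall>i\<in>{1..m}. is_divisor q (P i) \<and> 1 \<le> size (P i)) \<and> \<Lambda> = (\<Sum>i=1..m. P i)"

definition part_from :: "nat \<Rightarrow> (nat \<Rightarrow> divisor) \<Rightarrow> nat \<Rightarrow> divisor" where
  "part_from m P i = (\<Sum>j=i..m. P j)"

definition qE ::
  "complex \<Rightarrow> (complex set \<Rightarrow> complex) \<Rightarrow> divisor \<Rightarrow> nat \<Rightarrow> (nat \<Rightarrow> divisor) \<Rightarrow> (complex \<Rightarrow> complex) set"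
where
  "qE q \<rho> \<Lambda> m P =
     {F. analytic_punctured F \<and> qgevrey_at_0 q (size \<Lambda>) F \<and>
         (\<forall>i\<in>{1..m}. qgevrey_over q \<rho> (size (part_from m P (i + 1)))
                        (part_from m P i) (part_from m P (i + 1)) F)}"

definition qO ::
  "complex \<Rightarrow> (complex set \<Rightarrow> complex) \<Rightarrow> divisor \<Rightarrow> nat \<Rightarrow> (nat \<Rightarrow> divisor) \<Rightarrow> (complex \<Rightarrow> complex) set"
where
  "qO q \<rho> \<Lambda> m P =
     {f. \<exists>F \<in> qE q \<rho> \<Lambda> m P. \<exists>R>0. \<forall>z \<in> qsector \<Lambda> 0 R. f z = F z / theta_div q \<rho> \<Lambda> z} \<inter> qB \<Lambda>"

end

theory Submission
  imports Defs
begin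

text \<open>
  By the triple product, \<open>\<theta>\<close> has simple zeros exactly on \<open>- q\<^sup>\<int>\<close>, so \<open>f = F / \<theta>\<^sub>\<Lambda>\<close> has at
  \<open>\<zeta>\<^sub>k = \<lambda> q\<^sup>-\<^sup>k\<close>, \<open>[\<lambda>]\<close> of multiplicity \<open>\<nu>\<close> in \<open>\<Lambda>\<close>, a pole of order at most \<open>\<nu>\<close>. Its polar coefficients
  involve only the \<open>F\<^sup>(\<^sup>j\<^sup>)(\<zeta>\<^sub>k)\<close> with \<open>j < \<nu>\<close>, and each such \<open>j\<close> belongs to some level of the partition:
  these derivatives are \<open>O(A\<^sup>k |q| powr ((|\<Lambda>| - |\<Lambda>\<^sub>1|) k\<^sup>2 / 2))\<close>. Since \<open>\<theta>\<^sub>\<Lambda>\<close> has size \<open>|q| powr (|\<Lambda>| k\<^sup>2 / 2)\<close>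
  around \<open>\<zeta>\<^sub>k\<close>, up to a geometric factor, the coefficients are \<open>O(A\<^sup>k |q| powr (- |\<Lambda>\<^sub>1| k\<^sup>2 / 2))\<close>, and the series of all principal parts
  converges. After subtracting it, \<open>f\<close> becomes holomorphic off \<open>0\<close> and bounded on circles avoiding the
  spirals, hence holomorphic at \<open>0\<close>. The \<open>n\<close>-th Taylor remainder of
  \<open>1 / (z / \<zeta>\<^sub>k - 1)\<^sup>j\<close> is at most a constant times \<open>2\<^sup>n |z / \<zeta>\<^sub>k|\<^sup>n / \<epsilon>\<close>, and summing over \<open>k\<close> the products
  \<open>|q| powr (k n - |\<Lambda>\<^sub>1| k\<^sup>2 / 2)\<close> gives \<open>|q| powr (n\<^sup>2 / (2 |\<Lambda>\<^sub>1|))\<close>, up to a geometric factor.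
\<close>

subsection \<open>The theta function\<close>

text \<open>The obstacle is uniformity along a spiral, whose poles accumulate at 0. The substitution
  z = \<zeta> u with \<zeta> = \<lambda> / q^k moves every pole to u = 1. There the functional
  equation of theta gives F / theta_\<Lambda> as F(\<zeta> u) / (u - 1)^\<nu>, times a power of q
  and the quotient of the k-th power of a fixed function by another fixed function. One Cauchy
  estimate on one fixed disc then serves all k, at a geometric cost. That 1 / \<epsilon> appears to
  the first power for multiple poles too is due to \<open>dq\<close>, which counts multiplicities:
  with d the distance to the spiral, \<epsilon> < \<open>dq z \<Lambda>\<close> \<le> d^\<nu> \<le>
  d^j for j \<le> \<nu>. Boundedness of f is known only on sectors with a fixed \<epsilon>.
  Distances to spirals are invariant under division by q, so the circles of radius t / |q|^n can be
  placed in one sector. The same scaling yields points that tend to 0 inside one sector, and these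
  determine the coefficients. The triple product is useful only with a nonzero constant; Liouville's
  theorem provides this.\<close>

lemma triangular_Suc: "Suc n * n div 2 = n * (n - 1) div 2 + n"
  by (cases n) auto

text \<open>The terms of non-negative index. The exponent n (n - 1) / 2 is invariant under n -> 1 -
  n, so the terms of negative index belong to the same series in 1 / z, and one entire function
  carries all of theta.\<close>

definition half_theta :: "complex \<Rightarrow> complex \<Rightarrow> complex" where
  "half_theta q z = (\<Sum>n. inverse q ^ (n * (n - 1) div 2) * z ^ n)"

fun euler_coeff :: "complex \<Rightarrow> nat \<Rightarrow> complex" where
  "euler_coeff q 0 = 1"
| "euler_coeff q (Suc n) = euler_coeff q n * q / (q ^ Suc n - 1)"

text \<open>The entire function \<open>A(z) = \<Prod>\<^sub>n\<^sub>\<ge>\<^sub>0 (1 + z q\<^sup>-\<^sup>n)\<close>, through its power series: the recursion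
  for the coefficients expresses \<open>A(q z) = (1 + q z) A(z)\<close>.\<close>

definition euler_fun :: "complex \<Rightarrow> complex \<Rightarrow> complex" where
  "euler_fun q z = (\<Sum>n. euler_coeff q n * z ^ n)"

text \<open>A null ratio of consecutive coefficients means an infinite radius of convergence;
  \<open>half_theta\<close> and \<open>euler_fun\<close> both qualify because |q| > 1.\<close>

lemma summable_of_ratio_null:
  fixes a :: "nat \<Rightarrow> complex"
  assumes "\<And>n. a (Suc n) = a n * b n" and "b \<longlonglongrightarrow> 0"
  shows "summable (\<lambda>n. norm (a n * z ^ n))"
proof -
  have "(\<lambda>n. b n * z) \<longlonglongrightarrow> 0"
    using tendsto_mult[OF assms(2) tendsto_const[of z]] by simp
  then have "eventually (\<lambda>n. norm (b n * z) < 1/2) sequentially"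
    using order_tendstoD(2)[OF tendsto_norm_zero, of _ _ "1/2"] by simp
  then obtain N where N: "\<And>n. n \<ge> N \<Longrightarrow> norm (b n * z) < 1/2"
    by (auto simp: eventually_at_top_linorder)
  show ?thesis
  proof (rule summable_ratio_test[of "1/2" N])
    fix n assume "N \<le> n"
    have "norm (a (Suc n) * z ^ Suc n) = norm (b n * z) * norm (a n * z ^ n)"
      by (simp add: assms(1) norm_mult norm_power mult_ac)
    also have "\<dots> \<le> 1/2 * norm (a n * z ^ n)"
      using N[OF \<open>N \<le> n\<close>] by (intro mult_right_mono) auto
    finally show "norm (norm (a (Suc n) * z ^ Suc n)) \<le> 1/2 * norm (norm (a n * z ^ n))"
      by simp
  qed simp
qed

lemma entire_power_series:
  fixes a :: "nat \<Rightarrow> complex"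
  assumes "\<And>z. summable (\<lambda>n. a n * z ^ n)"
  shows "(\<lambda>z. \<Sum>n. a n * z ^ n) holomorphic_on UNIV"
proof -
  let ?f = "\<lambda>z. \<Sum>n. a n * z ^ n"
  have "?f holomorphic_on ball 0 r" for r
    by (rule power_series_holomorphic[of _ _ a]) (use assms in \<open>auto simp: summable_sums\<close>)
  then have "?f field_differentiable (at z)" for z
    by (rule holomorphic_on_imp_differentiable_at[OF _ open_ball, of _ _ "norm z + 1"]) simp
  then show ?thesis
    by (auto simp: holomorphic_on_def field_differentiable_at_within)
qed

lemma inverse_power_null:
  assumes "norm (q::complex) > 1"
  shows "(\<lambda>n. inverse q ^ n) \<longlonglongrightarrow> 0"
proof -
  have "norm (inverse q) < 1"
    using assms unfolding norm_inverse by (simp add: inverse_less_1_iff)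
  then show ?thesis by (rule LIMSEQ_power_zero)
qed

lemma power_Suc_neq_1:
  assumes "norm (q::complex) > 1"
  shows "q ^ Suc n \<noteq> 1"
proof
  assume "q ^ Suc n = 1"
  then have "norm q ^ Suc n = 1" by (metis norm_one norm_power)
  then show False using one_less_power[OF assms, of "Suc n"] by simp
qed

lemma power_quotient_null:
  assumes "norm (q::complex) > 1"
  shows "(\<lambda>n. q / (q ^ Suc n - 1)) \<longlonglongrightarrow> 0"
proof -
  have q0: "q \<noteq> 0" using assms by auto
  from inverse_power_null[OF assms] have "(\<lambda>n. inverse q ^ n / (1 - inverse q ^ n * inverse q)) \<longlonglongrightarrow> 0 / (1 - 0 * inverse q)"
    by (intro tendsto_divide tendsto_diff tendsto_mult tendsto_const) auto
  moreover have "inverse q ^ n / (1 - inverse q ^ n * inverse q) = q / (q ^ Suc n - 1)" for n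
  proof -
    have "q ^ Suc n \<noteq> 1" by (rule power_Suc_neq_1[OF assms])
    then show ?thesis using q0 by (simp add: field_simps power_inverse)
  qed
  ultimately show ?thesis by simp
qed

context
  fixes q :: complex
  assumes q: "norm q > 1"
begin

lemma q_nonzero: "q \<noteq> 0" using q by auto

lemma inverse_norm_q: "1 / norm q < 1"
  using q by (auto simp: divide_less_eq_1)

lemma half_theta_summable: "summable (\<lambda>n. norm (inverse q ^ (n * (n - 1) div 2) * z ^ n))"
proof (rule summable_of_ratio_null)
  show "(\<lambda>n. inverse q ^ n) \<longlonglongrightarrow> 0"
    by (rule inverse_power_null[OF q])
  show "inverse q ^ (Suc n * (Suc n - 1) div 2) =
      inverse q ^ (n * (n - 1) div 2) * inverse q ^ n" for n
    unfolding power_add[symmetric] using triangular_Suc[of n] by simp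
qed

lemma half_theta_holomorphic: "half_theta q holomorphic_on UNIV"
  unfolding half_theta_def[abs_def]
  by (rule entire_power_series) (rule summable_norm_cancel[OF half_theta_summable])

lemma half_theta_0: "half_theta q 0 = 1"
  unfolding half_theta_def by (subst suminf_finite[of "{0}"]) auto

text \<open>Index shift: after z -> q z, term n + 1 is q z times term n of the original series, and
  term 0 is left over as the summand 1.\<close>

lemma half_theta_q: "half_theta q (q * z) = 1 + q * z * half_theta q z"
proof -
  let ?t = "\<lambda>n. inverse q ^ (n * (n - 1) div 2)"
  have eq: "?t (Suc n) * (q * z) ^ Suc n = q * z * (?t n * z ^ n)" for n
  proof -
    have "?t (Suc n) = ?t n * inverse q ^ n"
      unfolding power_add[symmetric] using triangular_Suc[of n] by simp
    moreover have "inverse q ^ n * q ^ n = 1"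
      using q_nonzero by (simp flip: power_mult_distrib)
    ultimately show ?thesis by (simp add: power_mult_distrib mult_ac)
  qed
  have "(\<Sum>n. ?t (Suc n) * (q * z) ^ Suc n) = q * z * half_theta q z"
    unfolding eq half_theta_def
    by (rule suminf_mult[OF summable_norm_cancel[OF half_theta_summable]])
  moreover have "(\<Sum>n. ?t (Suc n) * (q * z) ^ Suc n) = half_theta q (q * z) - 1"
    unfolding half_theta_def
    by (subst suminf_split_head[OF summable_norm_cancel[OF half_theta_summable]]) simp
  ultimately show ?thesis by simp
qed

text \<open>The reflection n -> 1 - n collects the indices at most 1 in
  \<open>z * half_theta q (1 / z)\<close>. Indices 0 and 1 are then counted twice, hence the
  correction - z - 1.\<close>

lemma theta_eq_half_theta:
  assumes "z \<noteq> 0"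
  shows "theta q z = half_theta q z + z * half_theta q (1 / z) - z - 1"
proof -
  let ?g = "\<lambda>n::int. q powi (- (n * (n - 1) div 2)) * z powi n"
  let ?t = "\<lambda>n. inverse q ^ (n * (n - 1) div 2)"
  have tri: "int n * (int n - 1) div 2 = int (n * (n - 1) div 2)" for n
  proof -
    have "int n * (int n - 1) = int (n * (n - 1))" by (cases n) (simp_all add: algebra_simps)
    then show ?thesis by (simp only: zdiv_int of_nat_numeral)
  qed
  have pm: "q powi (- int k) = inverse q ^ k" for k
    by (simp add: power_int_minus power_inverse)
  have pos: "?g (int n) = ?t n * z ^ n" for n
    unfolding tri pm by simp
  have neg: "?g (- int (Suc n)) = z * (?t (n + 2) * (1 / z) ^ (n + 2))" for n
  proof -
    have "- int (Suc n) * (- int (Suc n) - 1) = int (n + 2) * (int (n + 2) - 1)"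
      by (simp add: algebra_simps)
    then have "q powi (- (- int (Suc n) * (- int (Suc n) - 1) div 2)) = ?t (n + 2)"
      unfolding tri pm by (simp only: tri pm)
    moreover have "z powi (- int (Suc n)) = z * (1 / z) ^ (n + 2)"
      using assms unfolding power_int_minus power_int_of_nat by (simp add: field_simps)
    ultimately show ?thesis by (simp only: mult_ac)
  qed
  have "((\<lambda>n. ?t n * z ^ n) has_sum half_theta q z) UNIV"
    unfolding half_theta_def
    by (intro norm_summable_imp_has_sum half_theta_summable summable_sums
          summable_norm_cancel[OF half_theta_summable])
  then have "((?g \<circ> int) has_sum half_theta q z) UNIV"
    by (simp only: o_def pos)
  then have 1: "(?g has_sum half_theta q z) (range int)"
    by (subst has_sum_reindex) auto
  let ?S = "half_theta q (1 / z) - (1 + 1 / z)"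
  have "(\<lambda>n. ?t (n + 2) * (1 / z) ^ (n + 2)) sums ?S"
  proof -
    have "(\<lambda>n. ?t n * (1 / z) ^ n) sums half_theta q (1 / z)"
      unfolding half_theta_def by (intro summable_sums summable_norm_cancel[OF half_theta_summable])
    from sums_split_initial_segment[OF this, of 2] show ?thesis
      by (simp add: numeral_2_eq_2)
  qed
  then have "(\<lambda>n. ?g (- int (Suc n))) sums (z * ?S)"
    unfolding neg by (rule sums_mult)
  moreover have "summable (\<lambda>n. norm (?g (- int (Suc n))))"
    unfolding neg norm_mult[of z]
    by (intro summable_mult)
       (use summable_ignore_initial_segment[OF half_theta_summable[of "1/z"], of 2] in simp)
  ultimately have "((\<lambda>n. ?g (- int (Suc n))) has_sum (z * ?S)) UNIV"
    by (intro norm_summable_imp_has_sum)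
  then have "((?g \<circ> (\<lambda>n. - int (Suc n))) has_sum (z * ?S)) UNIV"
    by (simp only: o_def)
  then have 2: "(?g has_sum (z * ?S)) (range (\<lambda>n. - int (Suc n)))"
    by (subst has_sum_reindex) (auto simp: inj_on_def)
  have un: "range int \<union> range (\<lambda>n. - int (Suc n)) = UNIV"
  proof -
    have "x \<in> range int \<union> range (\<lambda>n. - int (Suc n))" for x
      by (cases x rule: int_cases) auto
    then show ?thesis by auto
  qed
  have "(?g has_sum (half_theta q z + z * ?S)) (range int \<union> range (\<lambda>n. - int (Suc n)))"
    by (rule has_sum_Un_disjoint[OF 1 2]) auto
  then have "theta q z = half_theta q z + z * ?S"
    unfolding theta_def un by (rule infsumI)
  moreover have "z * ?S = z * half_theta q (1 / z) - z - 1"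
    using assms by (simp add: right_diff_distrib distrib_left)
  ultimately show ?thesis by simp
qed

text \<open>\<open>half_theta_q\<close> at z and at 1 / (q z) leaves inhomogeneous terms; they
  cancel in the combination of \<open>theta_eq_half_theta\<close>.\<close>

lemma theta_q: "z \<noteq> 0 \<Longrightarrow> theta q (q * z) = q * z * theta q z"
proof -
  assume z: "z \<noteq> 0"
  have "half_theta q (1 / z) = 1 + 1 / z * half_theta q (1 / (q * z))"
    using half_theta_q[of "1 / (q * z)"] q_nonzero by simp
  then have "half_theta q (1 / (q * z)) = z * (half_theta q (1 / z) - 1)"
    using z by (simp add: field_simps)
  then have "theta q (q * z) = 1 + q * z * half_theta q z
      + q * z * (z * (half_theta q (1 / z) - 1)) - q * z - 1"
    using theta_eq_half_theta[of "q * z"] z q_nonzero half_theta_q[of z] by simp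
  then show ?thesis
    unfolding theta_eq_half_theta[OF z] by (simp add: algebra_simps)
qed

text \<open>At the fixed point -1 of z -> 1 / z the two halves of \<open>theta_eq_half_theta\<close>
  cancel.\<close>

lemma theta_minus_one: "theta q (- 1) = 0"
  by (simp add: theta_eq_half_theta)

lemma theta_holomorphic: "theta q holomorphic_on - {0}"
proof -
  have "(\<lambda>z. half_theta q z + z * half_theta q (1 / z) - z - 1) holomorphic_on - {0}"
    by (intro holomorphic_intros holomorphic_on_compose_gen[OF _ half_theta_holomorphic, unfolded o_def]
          holomorphic_on_subset[OF half_theta_holomorphic]) auto
  then show ?thesis
    by (rule holomorphic_transform) (auto simp: theta_eq_half_theta)
qed

section \<open>Euler's function, the triple product and the zeros of theta\<close>

lemma euler_fun_summable: "summable (\<lambda>n. norm (euler_coeff q n * z ^ n))"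
  by (rule summable_of_ratio_null[OF _ power_quotient_null[OF q]]) simp

lemma euler_fun_holomorphic: "euler_fun q holomorphic_on UNIV"
  unfolding euler_fun_def[abs_def]
  by (rule entire_power_series) (rule summable_norm_cancel[OF euler_fun_summable])

lemma euler_fun_0: "euler_fun q 0 = 1"
  unfolding euler_fun_def by (subst suminf_finite[of "{0}"]) auto

lemma euler_fun_q: "euler_fun q (q * z) = (1 + q * z) * euler_fun q z"
proof -
  let ?a = "euler_coeff q"
  have eq: "?a (Suc n) * (q * z) ^ Suc n = ?a (Suc n) * z ^ Suc n + q * z * (?a n * z ^ n)" for n
  proof -
    have "?a (Suc n) * q ^ Suc n = ?a (Suc n) + q * ?a n"
      using power_Suc_neq_1[OF q, of n] by (simp add: divide_simps) (simp add: algebra_simps)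
    then have "?a (Suc n) * q ^ Suc n * z ^ Suc n = (?a (Suc n) + q * ?a n) * z ^ Suc n"
      by simp
    then show ?thesis by (simp only: power_mult_distrib ring_distribs mult.assoc power_Suc mult_ac)
  qed
  have s: "summable (\<lambda>n. ?a n * w ^ n)" for w
    by (rule summable_norm_cancel[OF euler_fun_summable])
  have head: "(\<Sum>n. ?a (Suc n) * w ^ Suc n) = euler_fun q w - 1" for w
    unfolding euler_fun_def by (subst suminf_split_head[OF s]) simp
  have "euler_fun q (q * z) - 1 = (\<Sum>n. ?a (Suc n) * z ^ Suc n + q * z * (?a n * z ^ n))"
    unfolding head[symmetric] eq ..
  also have "\<dots> = (\<Sum>n. ?a (Suc n) * z ^ Suc n) + (\<Sum>n. q * z * (?a n * z ^ n))"
    by (intro suminf_add[symmetric] summable_mult s) (use s in \<open>simp only: summable_Suc_iff[of "\<lambda>n. ?a n * z ^ n"]\<close>)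
  also have "\<dots> = euler_fun q z - 1 + q * z * euler_fun q z"
    unfolding head euler_fun_def by (subst suminf_mult[OF s]) simp
  finally show ?thesis by (simp add: algebra_simps)
qed

text \<open>By \<open>euler_fun_q\<close> a zero z in the unit disc propagates to all z / q^n,
  because 1 + z / q^n cannot vanish there. In the limit this contradicts the value 1 at 0.\<close>

lemma euler_fun_nonzero:
  assumes "norm z < 1"
  shows "euler_fun q z \<noteq> 0"
proof
  assume 0: "euler_fun q z = 0"
  have ev: "euler_fun q (z / q ^ n) = 0" for n
  proof (induction n)
    case (Suc n)
    have "norm (z / q ^ n) < 1"
    proof -
      have "1 \<le> norm q ^ n" using q by simp
      then have "norm z / norm q ^ n \<le> norm z / 1"
        by (intro divide_left_mono) auto
      then show ?thesis using assms by (simp add: norm_divide norm_power)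
    qed
    then have "1 + z / q ^ n \<noteq> 0"
      by (metis add_eq_0_iff norm_minus_cancel norm_one less_irrefl add.commute)
    moreover have "euler_fun q (z / q ^ n) = (1 + z / q ^ n) * euler_fun q (z / q ^ Suc n)"
      using euler_fun_q[of "z / q ^ Suc n"] q_nonzero by simp
    ultimately show ?case using Suc by simp
  qed (use 0 in simp)
  from inverse_power_null[OF q] have "(\<lambda>n. z * inverse q ^ n) \<longlonglongrightarrow> z * 0"
    by (intro tendsto_mult tendsto_const)
  then have lim: "(\<lambda>n. z / q ^ n) \<longlonglongrightarrow> 0"
    by (simp add: divide_inverse power_inverse)
  have "continuous (at 0) (euler_fun q)"
    using euler_fun_holomorphic holomorphic_on_imp_continuous_on
    by (metis UNIV_I continuous_on_eq_continuous_at open_UNIV)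
  then have "(\<lambda>n. euler_fun q (z / q ^ n)) \<longlonglongrightarrow> euler_fun q 0"
    using isCont_tendsto_compose lim by blast
  then show False
    unfolding ev euler_fun_0 by (simp add: LIMSEQ_const_iff)
qed

text \<open>Up to a constant, Jacobi's triple product is \<open>1 + z\<close> times the following function.\<close>

definition "triple_factor z = euler_fun q (z / q) * euler_fun q (1 / (q * z))"

text \<open>For nonzero z, the annulus is the set where z / q and 1 / (q z) both lie in the unit
  disc, so \<open>euler_fun_nonzero\<close> applies to both factors.\<close>

lemma triple_factor_nonzero:
  assumes "1 / norm q < norm z" "norm z < norm q"
  shows "triple_factor z \<noteq> 0"
proof -
  have "z \<noteq> 0" using assms(1) by auto
  then have "1 < norm q * norm z"
    using assms(1) q pos_divide_less_eq[of "norm q" 1 "norm z"] q_nonzero by (simp add: mult.commute)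
  then have "norm (1 / (q * z)) < 1"
    using divide_less_eq_1_pos[of "norm q * norm z" 1] by (simp add: norm_divide norm_mult)
  moreover have "norm (z / q) < 1"
    using assms(2) q by (auto simp: norm_divide divide_less_eq_1)
  ultimately show ?thesis
    unfolding triple_factor_def by (auto dest: euler_fun_nonzero)
qed

lemma triple_factor_holomorphic: "triple_factor holomorphic_on - {0}"
  unfolding triple_factor_def[abs_def]
  by (intro holomorphic_intros holomorphic_on_compose_gen[OF _ euler_fun_holomorphic, unfolded o_def])
     (use q_nonzero in auto)

text \<open>The counterpart of \<open>theta_q\<close> for the other side of the triple product. It
  rests on \<open>euler_fun_q\<close> at z / q and at w = 1 / (q^2 z), where q z (1 + q w) = 1 + q
  z.\<close>

lemma triple_factor_q:
  assumes "z \<noteq> 0"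
  shows "(1 + q * z) * triple_factor (q * z) = q * z * ((1 + z) * triple_factor z)"
proof -
  define w where "w = 1 / (q * (q * z))"
  have A: "euler_fun q z = (1 + z) * euler_fun q (z / q)"
    using euler_fun_q[of "z / q"] q_nonzero by simp
  have qw: "1 / (q * z) = q * w" using q_nonzero by (simp add: w_def)
  have "q * z * (q * w) = 1" unfolding qw[symmetric] using assms q_nonzero by simp
  then have one: "q * z * (1 + q * w) = 1 + q * z" by (simp only: distrib_left mult_1_right add.commute)
  have "triple_factor (q * z) = euler_fun q z * euler_fun q w"
    unfolding triple_factor_def w_def using q_nonzero by simp
  then have "(1 + q * z) * triple_factor (q * z) =
      euler_fun q z * (q * z * ((1 + q * w) * euler_fun q w))"
    unfolding one[symmetric] by (simp only: mult_ac)
  also have "\<dots> = q * z * ((1 + z) * (euler_fun q (z / q) * euler_fun q (q * w)))"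
    unfolding A euler_fun_q[of w] by (simp only: mult_ac)
  finally show ?thesis unfolding triple_factor_def qw .
qed

text \<open>If theta vanished, \<open>theta_eq_half_theta\<close> would express
  \<open>half_theta\<close> near infinity through its difference quotient at 0. It would have a
  finite limit there, hence be constant by Liouville, equal to 1; but \<open>half_theta_q\<close> at
  1 would then read 1 = 1 + q.\<close>

lemma theta_not_trivial:
  assumes "\<And>z. z \<noteq> 0 \<Longrightarrow> theta q z = 0"
  shows False
proof -
  have eq: "half_theta q z = z + 1 - z * half_theta q (1 / z)" if "z \<noteq> 0" for z
    using assms[OF that] theta_eq_half_theta[OF that] by (simp add: algebra_simps)
  have "half_theta q field_differentiable (at 0)"
    using half_theta_holomorphic by (simp add: holomorphic_on_imp_differentiable_at)
  then obtain D where D: "(half_theta q has_field_derivative D) (at 0)"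
    by (auto simp: field_differentiable_def)
  have "((\<lambda>y. (half_theta q y - half_theta q 0) / (y - 0)) \<longlongrightarrow> D) (at 0)"
    using D by (simp add: has_field_derivative_iff)
  then have "((\<lambda>y. (half_theta q y - 1) / y) \<longlongrightarrow> D) (at 0)"
    by (simp add: half_theta_0)
  then have "((\<lambda>z. (half_theta q (inverse z) - 1) / inverse z) \<longlongrightarrow> D) at_infinity"
    by (rule filterlim_compose) (use filterlim_inverse_at_iff[of "\<lambda>z. z" at_infinity] in \<open>simp add: filterlim_ident\<close>)
  then have "((\<lambda>z. 1 - (half_theta q (inverse z) - 1) / inverse z) \<longlongrightarrow> 1 - D) at_infinity"
    by (intro tendsto_diff tendsto_const)
  moreover have "eventually (\<lambda>z. 1 - (half_theta q (inverse z) - 1) / inverse z = half_theta q z) at_infinity"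
    using eventually_not_equal_at_infinity[of "0::complex"]
  proof eventually_elim
    case (elim z)
    then show ?case
      unfolding eq[OF elim] by (simp add: inverse_eq_divide algebra_simps)
  qed
  ultimately have "(half_theta q \<longlongrightarrow> 1 - D) at_infinity"
    by (rule Lim_transform_eventually)
  then have const: "half_theta q z = 1 - D" for z
    by (rule Liouville_weak[OF half_theta_holomorphic])
  then have "half_theta q z = 1" for z
    using half_theta_0 by metis
  then have "half_theta q (q * 1) = 1" "half_theta q 1 = 1" by auto
  then show False using half_theta_q[of 1] q_nonzero by simp
qed

text \<open>A fundamental domain of multiplication by q, inside the open annulus on which the triple
  product is available; questions about zeros of theta are reduced to it.\<close>

lemma scale_to_annulus:
  assumes "z \<noteq> 0"
  obtains k :: int where "1 \<le> norm (z * q powi k)" "norm (z * q powi k) < norm q"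
proof
  define n where "n = \<lfloor>log (norm q) (norm z)\<rfloor>"
  have p: "norm q > 0" using q_nonzero by simp
  have "norm z = norm q powr (log (norm q) (norm z))"
    using assms q q_nonzero by simp
  moreover have "real_of_int n \<le> log (norm q) (norm z)" "log (norm q) (norm z) < real_of_int n + 1"
    unfolding n_def by linarith+
  ultimately have lo: "norm q powr (real_of_int n) \<le> norm z"
    and hi: "norm z < norm q powr (real_of_int n + 1)"
    using q by (metis powr_le_cancel_iff, metis powr_less_cancel_iff)
  have e: "norm (z * q powi (- n)) = norm z / norm q powr (real_of_int n)"
    using p by (simp add: norm_mult norm_divide norm_power_int powr_real_of_int' power_int_minus field_simps)
  show "1 \<le> norm (z * q powi (- n))"
    unfolding e using lo p by simp
  show "norm (z * q powi (- n)) < norm q"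
    unfolding e using hi p by (simp add: powr_add divide_less_eq mult.commute)
qed

lemma theta_powi_eq_0_iff: "z \<noteq> 0 \<Longrightarrow> theta q (z * q powi k) = 0 \<longleftrightarrow> theta q z = 0"
proof (induction k rule: int_induct[of _ 0])
  case (step1 i)
  have "theta q (z * q powi (i + 1)) = theta q (q * (z * q powi i))"
    using q_nonzero by (simp add: power_int_add mult_ac)
  also have "\<dots> = q * (z * q powi i) * theta q (z * q powi i)"
    by (rule theta_q) (use step1 q_nonzero in simp)
  finally show ?case using step1 q_nonzero by simp
next
  case (step2 i)
  have "theta q (z * q powi i) = theta q (q * (z * q powi (i - 1)))"
    using q_nonzero by (simp add: power_int_diff mult_ac)
  also have "\<dots> = q * (z * q powi (i - 1)) * theta q (z * q powi (i - 1))"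
    by (rule theta_q) (use step2 q_nonzero in simp)
  finally show ?case using step2 q_nonzero by simp
qed simp

text \<open>The quotient of the two sides is invariant under \<open>z \<mapsto> q z\<close> and has no poles, so it is
  constant by the maximum modulus principle.\<close>

lemma theta_triple_product:
  obtains c where "c \<noteq> 0"
    "\<And>z. 1 / norm q < norm z \<Longrightarrow> norm z < norm q \<Longrightarrow> theta q z = c * ((z - - 1) * triple_factor z)"
proof -
  define U where "U = {z::complex. 1 / norm q < norm (z - 0) \<and> norm (z - 0) < norm q}"
  \<comment> \<open>Since h^2 = |q|, multiplication by q takes the circle of radius 1 / h to that of
    radius h. The compact annulus \<open>K\<close> between them therefore meets every orbit.\<close>
  define h where "h = sqrt (norm q)"
  define K where "K = {z::complex. 1 / h \<le> norm z \<and> norm z \<le> h}"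
  have h: "h > 1" "h * h = norm q" using q by (auto simp: h_def)
  have U: "open U"
    unfolding U_def by (intro open_Collect_conj open_Collect_less continuous_intros)
  have "connected U" unfolding U_def by (rule connected_annulus) simp
  have U0: "U \<subseteq> - {0}" unfolding U_def using q by (auto simp: divide_less_0_iff)
  have m1U: "- 1 \<in> U" unfolding U_def using q inverse_norm_q by simp
  \<comment> \<open>The zero at -1 is divided out; the derivative is the value that makes the
    quotient holomorphic there.\<close>
  define g1 where "g1 z = (if z = - 1 then deriv (theta q) (- 1) else theta q z / (z - - 1))" for z
  define g where "g z = g1 z / triple_factor z" for z
  have "g1 holomorphic_on U"
    by (rule pole_theorem_0[of "theta q" U "- 1"])
       (use holomorphic_on_subset[OF theta_holomorphic U0] m1U interior_open[OF U] theta_minus_one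
         in \<open>auto simp: g1_def add_eq_0_iff2\<close>)
  then have g_hol: "g holomorphic_on U"
    unfolding g_def[abs_def]
    by (intro holomorphic_on_divide holomorphic_on_subset[OF triple_factor_holomorphic U0])
       (auto simp: U_def triple_factor_nonzero)
  have inv: "g (q * z) = g z" if "z \<noteq> 0" "z \<noteq> - 1" "q * z \<noteq> - 1" for z
  proof -
    have 1: "z - - 1 \<noteq> 0" "q * z - - 1 \<noteq> 0" using that by (auto simp: add_eq_0_iff2)
    have "g (q * z) = theta q (q * z) / ((1 + q * z) * triple_factor (q * z))"
      using that by (simp add: g_def g1_def add.commute)
    also have "\<dots> = theta q z / ((1 + z) * triple_factor z)"
      unfolding theta_q[OF that(1)] triple_factor_q[OF that(1)] using that q_nonzero by simp
    also have "\<dots> = g z" using that by (simp add: g_def g1_def add.commute)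
    finally show ?thesis .
  qed
  have hq: "1 / norm q < 1 / h" "h < norm q" "h / norm q = 1 / h"
    using h unfolding h(2)[symmetric] by (auto simp: field_simps)
  have KU: "K \<subseteq> U" unfolding K_def U_def using hq by auto
  have "closed K" unfolding K_def
    by (intro closed_Collect_conj closed_Collect_le continuous_intros)
  moreover have "bounded K" unfolding K_def by (rule boundedI[of _ h]) auto
  ultimately have "compact K" by (simp add: compact_eq_bounded_closed)
  moreover have "K \<noteq> {}" using h by (auto simp: K_def intro!: exI[of _ 1])
  moreover have "continuous_on K (\<lambda>z. norm (g z))"
    by (intro continuous_intros holomorphic_on_imp_continuous_on holomorphic_on_subset[OF g_hol KU])
  ultimately obtain x where x: "x \<in> K" "\<And>z. z \<in> K \<Longrightarrow> norm (g z) \<le> norm (g x)"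
    using continuous_attains_sup by metis
  have "norm (g z) \<le> norm (g x)" if "z \<in> U" for z
  proof -
    have z: "1 / norm q < norm z" "norm z < norm q" "z \<noteq> 0" using that U0 by (auto simp: U_def)
    \<comment> \<open>A point of \<open>U\<close> outside \<open>K\<close> enters \<open>K\<close>
      after one multiplication or division by q. Neither it nor its image has modulus 1, so the
      point -1 excluded in \<open>inv\<close> does not interfere. The maximum of |g| over
      \<open>U\<close> is thus attained at an interior point.\<close>
    consider "z \<in> K" | "h < norm z" | "norm z < 1 / h" by (fastforce simp: K_def)
    then show ?thesis
    proof cases
      case 2
      define y where "y = z / q"
      have zy: "z = q * y" using q_nonzero by (simp add: y_def)
      have "norm y = norm z / norm q" by (simp add: y_def norm_divide)
      moreover have "h / norm q < norm z / norm q"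
        using 2 q by (intro divide_strict_right_mono) auto
      moreover have "norm z / norm q < 1" using z q by (auto simp: divide_less_eq_1)
      ultimately have y: "1 / h < norm y" "norm y < 1" using hq by auto
      then have "y \<noteq> - 1" "z \<noteq> - 1" "y \<noteq> 0" using 2 h z zy by auto
      then have "g z = g y" using inv[of y] zy by simp
      then show ?thesis using x(2)[of y] y h by (auto simp: K_def)
    next
      case 3
      have "norm (q * z) = norm q * norm z" by (simp add: norm_mult)
      moreover have "norm q * norm z < norm q * (1 / h)"
        using 3 q by (intro mult_strict_left_mono) auto
      moreover have "norm q * (1 / h) = h" using h unfolding h(2)[symmetric] by simp
      moreover have "1 < norm q * norm z" using z q pos_divide_less_eq[of "norm q" 1 "norm z"] q_nonzero
        by (simp add: mult.commute)
      ultimately have y: "1 < norm (q * z)" "norm (q * z) < h" by auto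
      moreover have "1 / h < 1" using h by simp
      ultimately have "q * z \<noteq> - 1" "z \<noteq> - 1" using 3 by auto
      then have "g (q * z) = g z" using inv z by simp
      then show ?thesis using x(2)[of "q * z"] y \<open>1 / h < 1\<close> by (auto simp: K_def)
    qed (use x in auto)
  qed
  then have "g constant_on U"
    using maximum_modulus_principle[OF g_hol U \<open>connected U\<close> U order_refl, of x] x(1) KU by auto
  then obtain c where c: "\<And>z. z \<in> U \<Longrightarrow> g z = c" by (auto simp: constant_on_def)
  have eq: "theta q z = c * ((z - - 1) * triple_factor z)"
    if "1 / norm q < norm z" "norm z < norm q" for z
  proof (cases "z = - 1")
    case False
    have "z - - 1 \<noteq> 0" using False by (simp add: add_eq_0_iff2)
    moreover have "triple_factor z \<noteq> 0" using that by (rule triple_factor_nonzero)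
    moreover have "theta q z / (z - - 1) / triple_factor z = c"
      using c[of z] that False by (simp add: g_def g1_def U_def)
    ultimately show ?thesis by (auto simp: divide_simps mult_ac)
  qed (simp add: theta_minus_one)
  have "c \<noteq> 0"
  proof
    assume "c = 0"
    have "theta q z = 0" if z0: "z \<noteq> 0" for z
    proof -
      obtain k where k: "1 \<le> norm (z * q powi k)" "norm (z * q powi k) < norm q"
        using scale_to_annulus[OF z0] by blast
      moreover note inverse_norm_q
      ultimately have "theta q (z * q powi k) = 0" using eq[of "z * q powi k"] \<open>c = 0\<close> by auto
      then show ?thesis using theta_powi_eq_0_iff[OF that] by simp
    qed
    then show False by (rule theta_not_trivial)
  qed
  then show thesis using eq that by blast
qed

text \<open>Inside the annulus of the triple product only the factor z + 1 can vanish, and powers of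
  q bring every point there without changing whether theta vanishes.\<close>

lemma theta_nonzero:
  assumes "z \<noteq> 0" "\<And>k::int. z \<noteq> - (q powi k)"
  shows "theta q z \<noteq> 0"
proof -
  obtain k where k: "1 \<le> norm (z * q powi k)" "norm (z * q powi k) < norm q"
    using scale_to_annulus[OF assms(1)] by blast
  obtain c where c: "c \<noteq> 0"
    "\<And>z. 1 / norm q < norm z \<Longrightarrow> norm z < norm q \<Longrightarrow> theta q z = c * ((z - - 1) * triple_factor z)"
    using theta_triple_product by blast
  have k': "1 / norm q < norm (z * q powi k)" using k inverse_norm_q by simp
  have "z * q powi k \<noteq> - 1"
  proof
    assume "z * q powi k = - 1"
    then have "z = - (q powi (- k))"
      using q_nonzero by (simp add: power_int_minus field_simps)
    then show False using assms(2) by blast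
  qed
  then have "z * q powi k - - 1 \<noteq> 0" by (simp add: add_eq_0_iff2)
  then have "theta q (z * q powi k) \<noteq> 0"
    using c(2)[OF k' k(2)] c(1) triple_factor_nonzero[OF k' k(2)] by simp
  then show ?thesis using theta_powi_eq_0_iff[OF assms(1)] by simp
qed

text \<open>The sign is that of \<open>theta_div\<close>, whose factors are theta at - z /
  \<lambda>, so that u = 1 marks a point of the spiral. \<open>E\<close> is the rest of the triple
  product.\<close>

lemma theta_simple_zero:
  obtains E where "E holomorphic_on - {0}" "E 1 \<noteq> 0"
    "\<And>u. 1 / norm q < norm u \<Longrightarrow> norm u < norm q \<Longrightarrow> theta q (- u) = (u - 1) * E u"
proof -
  obtain c where c: "c \<noteq> 0"
    "\<And>z. 1 / norm q < norm z \<Longrightarrow> norm z < norm q \<Longrightarrow> theta q z = c * ((z - - 1) * triple_factor z)"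
    using theta_triple_product by blast
  show thesis
  proof
    show "(\<lambda>u. - c * triple_factor (- u)) holomorphic_on - {0}"
      by (intro holomorphic_intros holomorphic_on_compose_gen[OF _ triple_factor_holomorphic, unfolded o_def])
         auto
    show "- c * triple_factor (- 1) \<noteq> 0" using c q inverse_norm_q triple_factor_nonzero[of "- 1"] by simp
    fix u :: complex assume "1 / norm q < norm u" "norm u < norm q"
    then show "theta q (- u) = (u - 1) * (- c * triple_factor (- u))"
      using c(2)[of "- u"] by (simp add: algebra_simps)
  qed
qed

text \<open>Iteration of \<open>theta_q\<close> towards 0. The quadratic exponent of q makes theta
  large along z / q^k, which is what makes the polar coefficients small.\<close>

lemma theta_divide_power:
  assumes "z \<noteq> 0"
  shows "theta q (z / q ^ k) = theta q z * q ^ (k * (k - 1) div 2) / z ^ k"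
proof (induction k)
  case (Suc k)
  have "theta q (z / q ^ k) = z / q ^ k * theta q (z / q ^ Suc k)"
    using theta_q[of "z / q ^ Suc k"] assms q_nonzero by simp
  then have "theta q (z / q ^ Suc k) = theta q (z / q ^ k) * q ^ k / z"
    using assms q_nonzero by (simp add: field_simps)
  also have "\<dots> = theta q z * (q ^ (k * (k - 1) div 2) * q ^ k) / z ^ Suc k"
    unfolding Suc by (simp add: mult_ac)
  also have "q ^ (k * (k - 1) div 2) * q ^ k = q ^ (Suc k * (Suc k - 1) div 2)"
    unfolding power_add[symmetric] using triangular_Suc[of k] by simp
  finally show ?case .
qed simp

end

subsection \<open>Sequences of \<open>q\<close>-Gevrey growth\<close>

text \<open>The growth condition of \<open>qgevrey_over\<close> for an arbitrary sequence, with a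
  real weight \<open>e\<close> that may be negative. Geometric factors are free, so weights simply
  add under products.\<close>

definition q_bound :: "real \<Rightarrow> real \<Rightarrow> (nat \<Rightarrow> complex) \<Rightarrow> bool" where
  "q_bound p e c \<longleftrightarrow> (\<exists>C>0. \<exists>A>0. \<forall>\<^sub>F n in sequentially.
     norm (c n) \<le> C * A ^ n * p powr (e * real n ^ 2 / 2))"

lemma q_boundI:
  assumes "C > 0" "A > 0"
    "\<forall>\<^sub>F n in sequentially. norm (c n) \<le> C * A ^ n * p powr (e * real n ^ 2 / 2)"
  shows "q_bound p e c"
  using assms unfolding q_bound_def by blast

lemma q_bound_mult:
  assumes "q_bound p e c" "q_bound p e' c'"
  shows "q_bound p (e + e') (\<lambda>n. c n * c' n)"
proof -
  obtain C A where C: "C > 0" "A > 0"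
    and 1: "\<forall>\<^sub>F n in sequentially. norm (c n) \<le> C * A ^ n * p powr (e * real n ^ 2 / 2)"
    using assms(1) by (auto simp: q_bound_def)
  obtain C' A' where C': "C' > 0" "A' > 0"
    and 2: "\<forall>\<^sub>F n in sequentially. norm (c' n) \<le> C' * A' ^ n * p powr (e' * real n ^ 2 / 2)"
    using assms(2) by (auto simp: q_bound_def)
  have "\<forall>\<^sub>F n in sequentially.
      norm (c n * c' n) \<le> (C * C') * (A * A') ^ n * p powr ((e + e') * real n ^ 2 / 2)"
    using 1 2
  proof eventually_elim
    case (elim n)
    have "norm (c n * c' n) \<le> (C * A ^ n * p powr (e * real n ^ 2 / 2)) *
        (C' * A' ^ n * p powr (e' * real n ^ 2 / 2))"
      unfolding norm_mult using elim C C' by (intro mult_mono) auto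
    also have "\<dots> = (C * C') * (A * A') ^ n * (p powr (e * real n ^ 2 / 2) * p powr (e' * real n ^ 2 / 2))"
      by (simp add: power_mult_distrib mult_ac)
    also have "p powr (e * real n ^ 2 / 2) * p powr (e' * real n ^ 2 / 2) = p powr ((e + e') * real n ^ 2 / 2)"
      unfolding powr_add[symmetric] by (simp add: distrib_right add_divide_distrib)
    finally show ?case .
  qed
  then show ?thesis
    by (rule q_boundI[rotated 2]) (use C C' in auto)
qed

lemma q_bound_add:
  assumes "q_bound p e c" "q_bound p e c'"
  shows "q_bound p e (\<lambda>n. c n + c' n)"
proof -
  obtain C A where C: "C > 0" "A > 0"
    and 1: "\<forall>\<^sub>F n in sequentially. norm (c n) \<le> C * A ^ n * p powr (e * real n ^ 2 / 2)"
    using assms(1) by (auto simp: q_bound_def)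
  obtain C' A' where C': "C' > 0" "A' > 0"
    and 2: "\<forall>\<^sub>F n in sequentially. norm (c' n) \<le> C' * A' ^ n * p powr (e * real n ^ 2 / 2)"
    using assms(2) by (auto simp: q_bound_def)
  have "\<forall>\<^sub>F n in sequentially.
      norm (c n + c' n) \<le> (C + C') * (A + A') ^ n * p powr (e * real n ^ 2 / 2)"
    using 1 2
  proof eventually_elim
    case (elim n)
    have "norm (c n + c' n) \<le> C * A ^ n * p powr (e * real n ^ 2 / 2) + C' * A' ^ n * p powr (e * real n ^ 2 / 2)"
      using norm_triangle_ineq[of "c n" "c' n"] elim by simp
    also have "\<dots> \<le> C * (A + A') ^ n * p powr (e * real n ^ 2 / 2) + C' * (A + A') ^ n * p powr (e * real n ^ 2 / 2)"
      using C C' by (intro add_mono mult_right_mono mult_left_mono power_mono) auto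
    finally show ?case by (simp add: algebra_simps)
  qed
  then show ?thesis
    by (rule q_boundI[rotated 2]) (use C C' in auto)
qed

lemma q_bound_geometric:
  assumes "\<And>n. norm (c n) \<le> C * A ^ n" "p > 0"
  shows "q_bound p 0 c"
proof -
  \<comment> \<open>The shifts by 1 make both constants positive whatever the signs of
    \<open>C\<close> and \<open>A\<close>.\<close>
  have "norm (c n) \<le> (\<bar>C\<bar> + 1) * (\<bar>A\<bar> + 1) ^ n * p powr (0 * real n ^ 2 / 2)" for n
  proof -
    have "C * A ^ n \<le> \<bar>C * A ^ n\<bar>" by simp
    also have "\<dots> = \<bar>C\<bar> * \<bar>A\<bar> ^ n" by (simp add: abs_mult power_abs)
    also have "\<dots> \<le> (\<bar>C\<bar> + 1) * (\<bar>A\<bar> + 1) ^ n" by (intro mult_mono power_mono) auto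
    finally show ?thesis using assms(1)[of n] assms(2) by simp
  qed
  then show ?thesis
    by (intro q_boundI[of "\<bar>C\<bar> + 1" "\<bar>A\<bar> + 1"] always_eventually allI) auto
qed

lemma q_bound_sum:
  assumes "finite I" "\<And>i. i \<in> I \<Longrightarrow> q_bound p e (c i)"
  shows "q_bound p e (\<lambda>n. \<Sum>i\<in>I. c i n)"
  using assms
proof (induction rule: finite_induct)
  case empty
  show ?case by (intro q_boundI[of 1 1] always_eventually allI) auto
qed (auto intro: q_bound_add)

lemma q_bound_mono:
  assumes "q_bound p e c" "e \<le> e'" "p > 1"
  shows "q_bound p e' c"
proof -
  obtain C A where C: "C > 0" "A > 0"
    and 1: "\<forall>\<^sub>F n in sequentially. norm (c n) \<le> C * A ^ n * p powr (e * real n ^ 2 / 2)"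
    using assms(1) by (auto simp: q_bound_def)
  from 1 have "\<forall>\<^sub>F n in sequentially. norm (c n) \<le> C * A ^ n * p powr (e' * real n ^ 2 / 2)"
  proof eventually_elim
    case (elim n)
    have "p powr (e * real n ^ 2 / 2) \<le> p powr (e' * real n ^ 2 / 2)"
      using assms by (intro powr_mono divide_right_mono mult_right_mono) auto
    then have "C * A ^ n * p powr (e * real n ^ 2 / 2) \<le> C * A ^ n * p powr (e' * real n ^ 2 / 2)"
      using C by (intro mult_left_mono) auto
    then show ?case using elim by simp
  qed
  then show ?thesis by (rule q_boundI[OF C])
qed

text \<open>The finitely many exceptional terms are absorbed into \<open>C\<close>, since the weight
  never vanishes; \<open>A\<close> is kept.\<close>

lemma q_bound_everywhere:
  assumes "q_bound p e c" "p > 1"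
  obtains C A where "C > 0" "A > 0" "\<And>n. norm (c n) \<le> C * A ^ n * p powr (e * real n ^ 2 / 2)"
proof -
  obtain C A where C: "C > 0" "A > 0"
    and "\<forall>\<^sub>F n in sequentially. norm (c n) \<le> C * A ^ n * p powr (e * real n ^ 2 / 2)"
    using assms(1) by (auto simp: q_bound_def)
  then obtain N where N: "\<And>n. n \<ge> N \<Longrightarrow> norm (c n) \<le> C * A ^ n * p powr (e * real n ^ 2 / 2)"
    by (auto simp: eventually_at_top_linorder)
  define w where "w n = A ^ n * p powr (e * real n ^ 2 / 2)" for n
  have w: "w n > 0" for n using C assms(2) by (simp add: w_def)
  define C' where "C' = C + (\<Sum>n<N. norm (c n) / w n)"
  have S: "(\<Sum>n<N. norm (c n) / w n) \<ge> 0"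
    by (intro sum_nonneg divide_nonneg_pos w) auto
  have "norm (c n) \<le> C' * w n" for n
  proof (cases "n < N")
    case True
    have "norm (c n) / w n \<le> (\<Sum>n<N. norm (c n) / w n)"
      by (rule member_le_sum) (use True w in \<open>auto intro!: divide_nonneg_pos\<close>)
    then have "norm (c n) / w n \<le> C'" using C by (simp add: C'_def)
    then show ?thesis using w[of n] by (simp add: pos_divide_le_eq)
  next
    case False
    have "norm (c n) \<le> C * w n" using N[of n] False by (simp add: w_def mult_ac)
    also have "\<dots> \<le> C' * w n" using S w[of n] by (intro mult_right_mono) (auto simp: C'_def)
    finally show ?thesis .
  qed
  moreover have "C' > 0" using C S by (simp add: C'_def)
  ultimately show thesis using that[of C' A] C by (simp add: w_def mult_ac)
qed

text \<open>Completing the square: \<open>k x - s k\<^sup>2 / 2 \<le> x\<^sup>2 / (2 s)\<close>.\<close>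

lemma gaussian_sum_bound:
  assumes p: "p > (1::real)" and s: "s > 0" and C: "C > 0" "A > 0"
    and c: "\<And>k. norm (c k) \<le> C * A ^ k * p powr (- s * real k ^ 2 / 2)"
  obtains C' A' where "C' > 0" "A' > 0" "\<And>n. summable (\<lambda>k. norm (c k) * p ^ (k * n))"
    "\<And>n. (\<Sum>k. norm (c k) * p ^ (k * n)) \<le> C' * A' ^ n * p powr (real n ^ 2 / (2 * s))"
proof -
  define a where "a = log p A"
  have A: "A = p powr a" using p C by (simp add: a_def)
  \<comment> \<open>Writing \<open>A\<close> as \<open>p powr a\<close> makes \<open>A ^ k\<close> a
    shift of n by a. The additional 1 reserves a factor p^(-k), which makes the sum over k
    converge.\<close>
  define X where "X n = real n + a + 1" for n :: nat
  have term_le: "norm (c k) * p ^ (k * n) \<le> C * p powr (X n ^ 2 / (2 * s)) * (1 / p) ^ k" for k n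
  proof -
    have "0 \<le> (s * real k - X n) ^ 2 / (2 * s)" using s by simp
    also have "\<dots> = X n ^ 2 / (2 * s) - (X n * real k - s * real k ^ 2 / 2)"
      using s by (simp add: power2_eq_square field_simps)
    finally have le: "X n * real k - s * real k ^ 2 / 2 \<le> X n ^ 2 / (2 * s)" by simp
    have "norm (c k) * p ^ (k * n) \<le> (C * A ^ k * p powr (- s * real k ^ 2 / 2)) * p ^ (k * n)"
      using c p by (intro mult_right_mono) auto
    also have "\<dots> = C * (p powr (a * real k) * p powr (- s * real k ^ 2 / 2) * p powr (real k * real n))"
      using p by (simp add: A powr_powr powr_realpow[symmetric] mult_ac)
    also have "\<dots> = C * p powr ((X n * real k - s * real k ^ 2 / 2) - real k)"
      unfolding powr_add[symmetric] by (simp add: X_def algebra_simps)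
    also have "\<dots> \<le> C * p powr (X n ^ 2 / (2 * s) - real k)"
      using le p C by (intro mult_left_mono powr_mono) auto
    also have "\<dots> = C * p powr (X n ^ 2 / (2 * s)) * (1 / p) ^ k"
      using p by (simp add: powr_diff powr_realpow power_one_over)
    finally show ?thesis .
  qed
  have geo: "summable (\<lambda>k. (1 / p) ^ k)" using p by (intro summable_geometric) auto
  have bd: "summable (\<lambda>k. C * p powr (X n ^ 2 / (2 * s)) * (1 / p) ^ k)" for n
    by (intro summable_mult geo)
  have sm: "summable (\<lambda>k. norm (c k) * p ^ (k * n))" for n
    by (rule summable_comparison_test'[OF bd[of n], of 0]) (use term_le p in auto)
  define S where "S = (\<Sum>k. (1 / p) ^ k)"
  have "S \<ge> (1 / p) ^ 0"
    unfolding S_def using sum_le_suminf[OF geo, of "{0}"] p by simp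
  then have S: "S > 0" by simp
  \<comment> \<open>Both constants come from expanding (n + a + 1)^2 / (2 s): the cross term (a + 1)
    n / s is geometric in n, the constant term goes into \<open>C'\<close>.\<close>
  define A' where "A' = p powr ((a + 1) / s)"
  define C' where "C' = C * p powr ((a + 1) ^ 2 / (2 * s)) * S"
  have "(\<Sum>k. norm (c k) * p ^ (k * n)) \<le> C' * A' ^ n * p powr (real n ^ 2 / (2 * s))" for n
  proof -
    have "(\<Sum>k. norm (c k) * p ^ (k * n)) \<le> (\<Sum>k. C * p powr (X n ^ 2 / (2 * s)) * (1 / p) ^ k)"
      by (rule suminf_le[OF term_le sm bd])
    also have "\<dots> = C * p powr (X n ^ 2 / (2 * s)) * S"
      unfolding S_def by (rule suminf_mult[OF geo])
    also have "X n ^ 2 / (2 * s) = (a + 1) ^ 2 / (2 * s) + (a + 1) / s * real n + real n ^ 2 / (2 * s)"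
      using s by (simp add: X_def power2_eq_square field_simps)
    also have "p powr \<dots> = p powr ((a + 1) ^ 2 / (2 * s)) * A' ^ n * p powr (real n ^ 2 / (2 * s))"
      using p by (simp add: powr_add A'_def powr_realpow[symmetric] powr_powr)
    finally show ?thesis by (simp add: C'_def mult_ac)
  qed
  moreover have "C' > 0" "A' > 0" using C S p by (simp_all add: C'_def A'_def)
  ultimately show thesis using that sm by blast
qed

text \<open>With \<open>d\<close> the distance of \<open>z\<close> to the spiral of the pole, the factor \<open>1 / d ^ j\<close> is the source of the
  factor \<open>1 / \<epsilon>\<close> of the theorem.\<close>

lemma inverse_power_expansion:
  obtains b :: "nat \<Rightarrow> complex" and K where "K > 0" "\<And>l. norm (b l) \<le> K * 2 ^ l"
    "\<And>n w d. w \<noteq> 1 \<Longrightarrow> 0 < d \<Longrightarrow> d \<le> 1 \<Longrightarrow> d \<le> norm (w - 1) \<Longrightarrow>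
       norm (1 / (w - 1) ^ j - (\<Sum>l<n. b l * w ^ l)) \<le> K * 2 ^ n * norm w ^ n / d ^ j"
proof (induction j arbitrary: thesis)
  case 0
  let ?b = "\<lambda>l::nat. if l = 0 then 1 else 0 :: complex"
  have "(\<Sum>l<n. ?b l * w ^ l) = (if n = 0 then 0 else 1)" for n and w :: complex
    by (induction n) auto
  then show ?case
    by (intro 0[of 1 ?b]) auto
next
  case (Suc j)
  obtain b K where K: "K > 0" and b: "\<And>l. norm (b l) \<le> K * 2 ^ l"
    and R: "\<And>n w d. w \<noteq> 1 \<Longrightarrow> 0 < d \<Longrightarrow> d \<le> 1 \<Longrightarrow> d \<le> norm (w - 1) \<Longrightarrow>
       norm (1 / (w - 1) ^ j - (\<Sum>l<n. b l * w ^ l :: complex)) \<le> K * 2 ^ n * norm w ^ n / d ^ j"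
    using Suc.IH by blast
  \<comment> \<open>Dividing a power series by w - 1 replaces its coefficients by minus their
    partial sums.\<close>
  define B where "B n = (\<Sum>i<n. b i)" for n
  have B: "norm (B n) \<le> K * 2 ^ n" for n
  proof -
    have "norm (B n) \<le> K * (2 ^ n - 1)"
    proof (induction n)
      case (Suc n)
      have "norm (B (Suc n)) \<le> norm (B n) + norm (b n)"
        unfolding B_def sum.lessThan_Suc by (rule norm_triangle_ineq)
      then show ?case using Suc b[of n] by (simp add: algebra_simps)
    qed (simp add: B_def)
    then show ?thesis using K by (simp add: algebra_simps)
  qed
  \<comment> \<open>Dividing a truncated series leaves the boundary term \<open>B n * w ^ n\<close>.
    Together with the old remainder it accounts for the factor 2 in the new remainder bound.\<close>
  have tele: "(\<Sum>l<n. - B (Suc l) * w ^ l) * (w - 1) = (\<Sum>l<n. b l * w ^ l) - B n * w ^ n" for n w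
  proof (induction n)
    case (Suc n)
    have "B (Suc n) = B n + b n" by (simp add: B_def)
    then show ?case using Suc unfolding sum.lessThan_Suc by (simp add: algebra_simps)
  qed (simp add: B_def)
  show ?case
  proof (rule Suc.prems[of "2 * K" "\<lambda>l. - B (Suc l)"])
    show "2 * K > 0" using K by simp
    show "norm (- B (Suc l)) \<le> 2 * K * 2 ^ l" for l using B[of "Suc l"] by simp
    fix n :: nat and w :: complex and d :: real
    assume w: "w \<noteq> 1" "0 < d" "d \<le> 1" "d \<le> norm (w - 1)"
    let ?S = "\<Sum>l<n. - B (Suc l) * w ^ l" and ?R = "1 / (w - 1) ^ j - (\<Sum>l<n. b l * w ^ l)"
    have w1: "w - 1 \<noteq> 0" using w by simp
    have "?S = ((\<Sum>l<n. b l * w ^ l) - B n * w ^ n) / (w - 1)"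
      using tele[of w n] w1 by (metis nonzero_mult_div_cancel_right)
    moreover have "1 / (w - 1) ^ Suc j = 1 / (w - 1) ^ j / (w - 1)" by simp
    ultimately have "1 / (w - 1) ^ Suc j - ?S = (?R + B n * w ^ n) / (w - 1)"
      by (simp add: diff_divide_distrib add_divide_distrib)
    then have "norm (1 / (w - 1) ^ Suc j - ?S) = norm (?R + B n * w ^ n) / norm (w - 1)"
      by (simp add: norm_divide)
    also have "\<dots> \<le> (K * 2 ^ n * norm w ^ n / d ^ j + K * 2 ^ n * norm w ^ n / d ^ j) / d"
    proof (intro frac_le w(4) w(2))
      have "norm (B n * w ^ n) \<le> K * 2 ^ n * norm w ^ n"
        unfolding norm_mult norm_power using B by (intro mult_right_mono) auto
      \<comment> \<open>The boundary term carries no denominator; \<open>d \<le> 1\<close> allows it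
        to be given one.\<close>
      also have "\<dots> \<le> K * 2 ^ n * norm w ^ n / d ^ j"
        using K w power_le_one[of d j]
        by (simp add: pos_le_divide_eq mult_left_le)
      finally show "norm (?R + B n * w ^ n) \<le> K * 2 ^ n * norm w ^ n / d ^ j + K * 2 ^ n * norm w ^ n / d ^ j"
        using norm_triangle_ineq[of ?R "B n * w ^ n"] R[OF w, of n] by linarith
    qed (use K w in auto)
    also have "\<dots> = 2 * K * 2 ^ n * norm w ^ n / d ^ Suc j" by (simp add: mult_ac)
    finally show "norm (1 / (w - 1) ^ Suc j - ?S) \<le> 2 * K * 2 ^ n * norm w ^ n / d ^ Suc j" .
  qed
qed

subsection \<open>The distance to a divisor\<close>

lemma qspiral_self: "l \<in> qspiral q l"
  unfolding qspiral_def by (rule range_eqI[of _ _ 0]) simp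

lemma qspiral_nonzero: "q \<noteq> 0 \<Longrightarrow> l \<noteq> 0 \<Longrightarrow> \<xi> \<in> qspiral q l \<Longrightarrow> \<xi> \<noteq> 0"
  by (auto simp: qspiral_def)

lemma qspiral_eq:
  assumes "q \<noteq> 0" "\<xi> \<in> qspiral q l"
  shows "qspiral q \<xi> = qspiral q l"
proof -
  obtain k where k: "\<xi> = l * q powi k" using assms by (auto simp: qspiral_def)
  have "\<xi> * q powi n = l * q powi (k + n)" "l * q powi n = \<xi> * q powi (n - k)" for n
    using assms(1) by (simp_all add: k power_int_add power_int_diff)
  then show ?thesis unfolding qspiral_def by blast
qed

lemma qspiral_divide_power: "q \<noteq> 0 \<Longrightarrow> l / q ^ k \<in> qspiral q l"
  unfolding qspiral_def by (rule range_eqI[of _ _ "- int k"]) (simp add: power_int_minus field_simps)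

lemma divisor_spiral:
  assumes "is_divisor q \<Lambda>" "q \<noteq> 0" "\<sigma> \<in># \<Lambda>" "l \<in> \<sigma>"
  shows "l \<noteq> 0" "\<sigma> = qspiral q l"
proof -
  obtain l' where "l' \<noteq> 0" "\<sigma> = qspiral q l'" using assms by (auto simp: is_divisor_def)
  then show "l \<noteq> 0" "\<sigma> = qspiral q l"
    using assms qspiral_nonzero qspiral_eq by metis+
qed

lemma dq_spiral_le: "\<xi> \<in> \<sigma> \<Longrightarrow> dq_spiral z \<sigma> \<le> norm (1 - z / \<xi>)"
  unfolding dq_spiral_def by (rule cINF_lower) (auto intro!: bdd_belowI[of _ 0])

lemma dq_spiral_ge: "\<sigma> \<noteq> {} \<Longrightarrow> (\<And>\<xi>. \<xi> \<in> \<sigma> \<Longrightarrow> d \<le> norm (1 - z / \<xi>)) \<Longrightarrow> d \<le> dq_spiral z \<sigma>"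
  unfolding dq_spiral_def by (rule cINF_greatest) auto

lemma qspiral_nonempty: "qspiral q l \<noteq> {}"
  using qspiral_self by blast

lemma dq_spiral_nonneg: "0 \<le> dq_spiral z (qspiral q l)"
  by (rule dq_spiral_ge[OF qspiral_nonempty]) simp

text \<open>Points \<xi> of the spiral far from 0 make z / \<xi> as small as desired.\<close>

lemma dq_spiral_le_1:
  assumes "norm q > 1" "l \<noteq> 0"
  shows "dq_spiral z (qspiral q l) \<le> 1"
proof (rule field_le_epsilon)
  fix e :: real assume "e > 0"
  obtain n where n: "norm z / (norm l * e) < norm q ^ n"
    using real_arch_pow[OF assms(1)] by blast
  have "l * q powi int n \<in> qspiral q l" unfolding qspiral_def by (rule rangeI)
  from dq_spiral_le[OF this, of z]
  have "dq_spiral z (qspiral q l) \<le> norm (1 - z / (l * q ^ n))" by simp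
  also have "\<dots> \<le> 1 + norm z / (norm l * norm q ^ n)"
    using norm_triangle_ineq4[of 1 "z / (l * q ^ n)"] by (simp add: norm_divide norm_mult norm_power)
  also have "norm z / (norm l * norm q ^ n) \<le> e"
  proof -
    have "norm z < norm q ^ n * (norm l * e)"
      using n \<open>e > 0\<close> assms by (simp add: pos_divide_less_eq)
    moreover have "0 < norm l * norm q ^ n" by (intro mult_pos_pos zero_less_power) (use assms in auto)
    ultimately show ?thesis by (simp add: pos_divide_le_eq mult_ac)
  qed
  finally show "dq_spiral z (qspiral q l) \<le> 1 + e" by simp
qed

text \<open>The infimum runs over infinitely many points, but outside a finite range of exponents |z
  / \<xi>| is at most 1/2 or at least 2, which keeps the distance to 1 at least 1/2. Inside the
  range a finite minimum of positive numbers remains.\<close>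

lemma dq_spiral_pos:
  assumes q: "norm q > 1" and "l \<noteq> 0" "z \<noteq> 0" "z \<notin> qspiral q l"
  shows "0 < dq_spiral z (qspiral q l)"
proof -
  have q0: "q \<noteq> 0" using q by auto
  define w where "w = z / l"
  have w: "norm w > 0" using assms by (simp add: w_def)
  define f where "f k = norm (1 - w * q powi (- k))" for k
  obtain N1 where N1: "2 * norm w < norm q ^ N1" using real_arch_pow[OF q] by blast
  obtain N2 where N2: "2 / norm w < norm q ^ N2" using real_arch_pow[OF q] by blast
  let ?I = "{- int N2..int N1}"
  have fpos: "f k > 0" for k
  proof -
    have "z \<noteq> l * q powi k" using assms(4) by (auto simp: qspiral_def)
    then have "w * q powi (- k) \<noteq> 1"
      using assms(2) q0 by (auto simp: w_def power_int_minus field_simps)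
    then show ?thesis by (simp add: f_def)
  qed
  define m where "m = Min (f ` ?I)"
  have m: "m > 0" unfolding m_def using fpos by simp
  have "min m 1 / 2 \<le> f k" for k
  proof -
    have nq: "norm (w * q powi (- k)) = norm w * norm q powi (- k)"
      by (simp add: norm_mult norm_power_int)
    consider "k \<in> ?I" | "k > int N1" | "k < - int N2" by fastforce
    then show ?thesis
    proof cases
      case 1
      then have "m \<le> f k" unfolding m_def by (intro Min_le) auto
      then show ?thesis using m by (simp add: min_def)
    next
      case 2
      have "norm q powi (- k) \<le> norm q powi (- int N1)"
        using 2 q by (intro power_int_increasing) auto
      then have "norm w * norm q powi (- k) \<le> norm w * norm q powi (- int N1)"
        using w by (intro mult_left_mono) auto
      also have "\<dots> = norm w / norm q ^ N1" by (simp add: power_int_minus divide_inverse)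
      also have "\<dots> \<le> 1 / 2" using N1 q0 by (simp add: pos_divide_le_eq)
      finally have "norm (w * q powi (- k)) \<le> 1 / 2" by (simp only: nq)
      then have "1 / 2 \<le> f k"
        using norm_triangle_ineq2[of 1 "w * q powi (- k)"] by (simp add: f_def)
      then show ?thesis by (simp add: min_def)
    next
      case 3
      have "norm q powi int N2 \<le> norm q powi (- k)"
        using 3 q by (intro power_int_increasing) auto
      then have "norm w * norm q ^ N2 \<le> norm w * norm q powi (- k)"
        using w by (intro mult_left_mono) auto
      moreover have "2 < norm w * norm q ^ N2" using N2 w by (simp add: pos_divide_less_eq mult.commute)
      ultimately have "2 \<le> norm (w * q powi (- k))" unfolding nq by simp
      then have "1 \<le> f k"
        using norm_triangle_ineq2[of "w * q powi (- k)" 1] by (simp add: f_def norm_minus_commute)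
      then show ?thesis by (simp add: min_def)
    qed
  qed
  moreover have "norm (1 - z / (l * q powi k)) = f k" for k
    unfolding f_def w_def by (simp add: power_int_minus divide_inverse mult_ac)
  ultimately have "min m 1 / 2 \<le> dq_spiral z (qspiral q l)"
    by (intro dq_spiral_ge qspiral_nonempty) (auto simp: qspiral_def)
  then show ?thesis using m by (auto simp: min_def split: if_splits)
qed

lemma dq_spiral_divide_power:
  assumes "q \<noteq> 0" "l \<noteq> 0"
  shows "dq_spiral (z / q ^ n) (qspiral q l) = dq_spiral z (qspiral q l)"
proof -
  have "z / q ^ n / (l * q powi k) = z / (l * q powi (k + int n))" for k
    using assms by (simp add: power_int_add mult_ac)
  then have "(\<lambda>\<xi>. norm (1 - z / q ^ n / \<xi>)) ` qspiral q l
      = (\<lambda>k. norm (1 - z / (l * q powi k))) ` ((\<lambda>k. k + int n) ` UNIV)"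
    unfolding qspiral_def image_image by (simp only:)
  also have "range (\<lambda>k. k + int n) = UNIV" by (rule surjI[of _ "\<lambda>k. k - int n"]) simp
  also have "(\<lambda>k. norm (1 - z / (l * q powi k))) ` UNIV = (\<lambda>\<xi>. norm (1 - z / \<xi>)) ` qspiral q l"
    unfolding qspiral_def image_image ..
  finally show ?thesis unfolding dq_spiral_def by simp
qed

text \<open>Comparison with the real spiral gives a lower bound that is uniform on circles.\<close>

lemma dq_spiral_norm_le:
  "dq_spiral (of_real (norm z)) (qspiral (of_real (norm q)) (of_real (norm l))) \<le> dq_spiral z (qspiral q l)"
proof (rule dq_spiral_ge[OF qspiral_nonempty])
  fix \<xi> assume "\<xi> \<in> qspiral q l"
  then obtain k where k: "\<xi> = l * q powi k" by (auto simp: qspiral_def)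
  let ?\<xi> = "of_real (norm l) * of_real (norm q) powi k :: complex"
  have "dq_spiral (of_real (norm z)) (qspiral (of_real (norm q)) (of_real (norm l))) \<le>
      norm (1 - of_real (norm z) / ?\<xi>)"
    by (rule dq_spiral_le) (auto simp: qspiral_def)
  also have "1 - of_real (norm z) / ?\<xi> = of_real (1 - norm (z / \<xi>))"
    by (simp add: k norm_divide norm_mult norm_power_int)
  also have "norm (of_real (1 - norm (z / \<xi>)) :: complex) = \<bar>norm (1::complex) - norm (z / \<xi>)\<bar>"
    by (simp only: norm_of_real norm_one)
  also have "\<dots> \<le> norm (1 - z / \<xi>)" by (rule norm_triangle_ineq3)
  finally show "dq_spiral (of_real (norm z)) (qspiral (of_real (norm q)) (of_real (norm l)))
      \<le> norm (1 - z / \<xi>)" .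
qed

locale q_divisor =
  fixes q :: complex and \<Lambda> :: divisor
  assumes q: "norm q > 1" and div: "is_divisor q \<Lambda>"
begin

lemma q0: "q \<noteq> 0" using q by auto

lemma dq_spiral_bounds:
  assumes "\<sigma> \<in># \<Lambda>"
  shows "0 \<le> dq_spiral z \<sigma>" "dq_spiral z \<sigma> \<le> 1"
  using assms div dq_spiral_nonneg dq_spiral_le_1[OF q] unfolding is_divisor_def by metis+

text \<open>The factors of the other spirals are at most 1.\<close>

lemma dq_le_spiral_power:
  assumes "\<sigma> \<in># \<Lambda>"
  shows "dq z \<Lambda> \<le> dq_spiral z \<sigma> ^ count \<Lambda> \<sigma>"
proof -
  have "dq z \<Lambda> = dq_spiral z \<sigma> ^ count \<Lambda> \<sigma> * (\<Prod>\<tau>\<in>set_mset \<Lambda> - {\<sigma>}. dq_spiral z \<tau> ^ count \<Lambda> \<tau>)"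
    unfolding dq_def by (rule prod.remove) (use assms in auto)
  also have "\<dots> \<le> dq_spiral z \<sigma> ^ count \<Lambda> \<sigma> * 1"
    using dq_spiral_bounds assms by (intro mult_left_mono prod_le_1) (auto intro!: power_le_one)
  finally show ?thesis by simp
qed

lemma dq_le_1: "dq z \<Lambda> \<le> 1"
  unfolding dq_def using dq_spiral_bounds by (intro prod_le_1) (auto intro!: power_le_one)

lemma dq_ge_power:
  assumes "0 \<le> d" "\<And>\<sigma>. \<sigma> \<in># \<Lambda> \<Longrightarrow> d \<le> dq_spiral z \<sigma>"
  shows "d ^ size \<Lambda> \<le> dq z \<Lambda>"
proof -
  have "d ^ size \<Lambda> = (\<Prod>\<sigma>\<in>set_mset \<Lambda>. d ^ count \<Lambda> \<sigma>)"
    by (simp add: size_multiset_overloaded_eq power_sum)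
  also have "\<dots> \<le> dq z \<Lambda>"
    unfolding dq_def using assms by (intro prod_mono) (auto intro!: power_mono)
  finally show ?thesis .
qed

lemma dq_pos_iff:
  assumes "z \<noteq> 0"
  shows "dq z \<Lambda> > 0 \<longleftrightarrow> (\<forall>\<sigma>\<in>#\<Lambda>. z \<notin> \<sigma>)"
proof
  assume pos: "dq z \<Lambda> > 0"
  show "\<forall>\<sigma>\<in>#\<Lambda>. z \<notin> \<sigma>"
  proof (intro ballI notI)
    fix \<sigma> assume \<sigma>: "\<sigma> \<in># \<Lambda>" "z \<in> \<sigma>"
    then have "dq_spiral z \<sigma> = 0"
      using dq_spiral_le[of z \<sigma> z] dq_spiral_bounds(1)[of \<sigma> z] assms by simp
    moreover have "count \<Lambda> \<sigma> > 0" using \<sigma> by simp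
    ultimately have "dq_spiral z \<sigma> ^ count \<Lambda> \<sigma> = 0" by (simp only: zero_power)
    then show False using dq_le_spiral_power[OF \<sigma>(1), of z] pos by linarith
  qed
next
  assume "\<forall>\<sigma>\<in>#\<Lambda>. z \<notin> \<sigma>"
  then have "dq_spiral z \<sigma> > 0" if "\<sigma> \<in># \<Lambda>" for \<sigma>
    using that div dq_spiral_pos[OF q] assms unfolding is_divisor_def by metis
  then show "dq z \<Lambda> > 0" unfolding dq_def by (intro prod_pos) auto
qed

lemma countable_support_union: "countable (\<Union> (set_mset \<Lambda>))"
proof (rule countable_UN[of _ "\<lambda>x. x", simplified])
  fix \<sigma> assume "\<sigma> \<in> set_mset \<Lambda>"
  then obtain l where "\<sigma> = qspiral q l" using div by (auto simp: is_divisor_def)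
  then show "countable \<sigma>" by (simp add: qspiral_def)
qed (simp add: countable_finite)

text \<open>The spirals have only countably many moduli, so some t avoids them all. Comparison with
  real spirals makes the bound depend on |z| alone, and invariance under division by q makes it the
  same for all n.\<close>

lemma good_radius:
  assumes "r > 0"
  obtains t d where "0 < t" "t < r" "0 < d" "d \<le> 1"
    "\<And>z n \<sigma>. norm z = t / norm q ^ n \<Longrightarrow> \<sigma> \<in># \<Lambda> \<Longrightarrow> d \<le> dq_spiral z \<sigma>"
proof -
  have "countable (norm ` \<Union> (set_mset \<Lambda>))"
    using countable_support_union by (rule countable_image)
  moreover have "uncountable {0<..<r}" using assms by (simp add: uncountable_open_interval)
  ultimately have "\<not> {0<..<r} \<subseteq> norm ` \<Union> (set_mset \<Lambda>)" using countable_subset by blast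
  then obtain t where t: "0 < t" "t < r" "t \<notin> norm ` \<Union> (set_mset \<Lambda>)"
    unfolding subset_eq by (auto simp del: image_Union)
  have "\<exists>d>0. \<forall>z n. norm z = t / norm q ^ n \<longrightarrow> d \<le> dq_spiral z \<sigma>" if \<sigma>: "\<sigma> \<in># \<Lambda>" for \<sigma>
  proof -
    obtain l where l: "l \<noteq> 0" "\<sigma> = qspiral q l" using \<sigma> div by (auto simp: is_divisor_def)
    let ?d = "dq_spiral (of_real t) (qspiral (of_real (norm q)) (of_real (norm l)))"
    have "(of_real t :: complex) \<noteq> of_real (norm l) * of_real (norm q) powi k" for k
    proof
      assume "(of_real t :: complex) = of_real (norm l) * of_real (norm q) powi k"
      then have "(of_real t :: complex) = of_real (norm (l * q powi k))"
        by (simp add: norm_mult norm_power_int)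
      then have "t = norm (l * q powi k)" by (simp only: of_real_eq_iff)
      moreover have "l * q powi k \<in> \<sigma>" unfolding l(2) qspiral_def by (rule rangeI)
      then have "l * q powi k \<in> \<Union> (set_mset \<Lambda>)" using \<sigma> by blast
      ultimately show False using t(3) by blast
    qed
    then have "?d > 0" using q l t by (intro dq_spiral_pos) (auto simp: qspiral_def)
    moreover have "?d \<le> dq_spiral z \<sigma>" if "norm z = t / norm q ^ n" for z n
    proof -
      have "?d = dq_spiral (of_real t / of_real (norm q) ^ n) (qspiral (of_real (norm q)) (of_real (norm l)))"
        by (rule dq_spiral_divide_power[symmetric]) (use q0 l in auto)
      also have "of_real t / of_real (norm q) ^ n = (of_real (norm z) :: complex)"
        by (simp add: that)
      finally show ?thesis unfolding l(2) using dq_spiral_norm_le[of z q l] by simp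
    qed
    ultimately show ?thesis by blast
  qed
  then obtain D where D: "\<And>\<sigma>. \<sigma> \<in># \<Lambda> \<Longrightarrow> D \<sigma> > 0"
    "\<And>\<sigma> z n. \<sigma> \<in># \<Lambda> \<Longrightarrow> norm z = t / norm q ^ n \<Longrightarrow> D \<sigma> \<le> dq_spiral z \<sigma>" by metis
  define d where "d = Min (insert 1 (D ` set_mset \<Lambda>))"
  have "d > 0" "d \<le> 1" unfolding d_def using D by (auto simp: Min_gr_iff)
  moreover have "d \<le> D \<sigma>" if "\<sigma> \<in># \<Lambda>" for \<sigma>
    unfolding d_def using that by (intro Min_le) auto
  ultimately show thesis using that[of t d] t D by (metis order_trans)
qed

subsection \<open>Asymptotic expansions\<close>

text \<open>The estimate of the theorem with \<open>\<le>\<close> for \<open><\<close>, so that it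
  holds for the zero function and adds up directly. The parameter \<open>s\<close> stands for the
  degree of the first divisor of the partition.\<close>

definition q_asymp :: "real \<Rightarrow> real \<Rightarrow> (complex \<Rightarrow> complex) \<Rightarrow> (nat \<Rightarrow> complex) \<Rightarrow> bool" where
  "q_asymp s R f a \<longleftrightarrow> (\<exists>C>0. \<exists>A>0. \<forall>\<epsilon>>0. \<forall>z\<in>qsector \<Lambda> \<epsilon> R. \<forall>n.
     norm (f z - (\<Sum>l<n. a l * z ^ l)) \<le> C / \<epsilon> * A ^ n * norm q powr (real n ^ 2 / (2 * s)) * norm z ^ n)"

lemma q_asympI:
  assumes "C > 0" "A > 0" "\<And>\<epsilon> z n. \<epsilon> > 0 \<Longrightarrow> z \<in> qsector \<Lambda> \<epsilon> R \<Longrightarrow>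
     norm (f z - (\<Sum>l<n. a l * z ^ l)) \<le> C / \<epsilon> * A ^ n * norm q powr (real n ^ 2 / (2 * s)) * norm z ^ n"
  shows "q_asymp s R f a"
  using assms unfolding q_asymp_def by blast

lemma q_asymp_zero: "q_asymp s R (\<lambda>_. 0) (\<lambda>_. 0)"
  by (rule q_asympI[of 1 1]) auto

lemma q_asymp_add:
  assumes "q_asymp s R f a" "q_asymp s R g b"
  shows "q_asymp s R (\<lambda>z. f z + g z) (\<lambda>n. a n + b n)"
proof -
  obtain C A where C: "C > 0" "A > 0" and f: "\<And>\<epsilon> z n. \<epsilon> > 0 \<Longrightarrow> z \<in> qsector \<Lambda> \<epsilon> R \<Longrightarrow>
     norm (f z - (\<Sum>l<n. a l * z ^ l)) \<le> C / \<epsilon> * A ^ n * norm q powr (real n ^ 2 / (2 * s)) * norm z ^ n"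
    using assms(1) unfolding q_asymp_def by blast
  obtain D B where D: "D > 0" "B > 0" and g: "\<And>\<epsilon> z n. \<epsilon> > 0 \<Longrightarrow> z \<in> qsector \<Lambda> \<epsilon> R \<Longrightarrow>
     norm (g z - (\<Sum>l<n. b l * z ^ l)) \<le> D / \<epsilon> * B ^ n * norm q powr (real n ^ 2 / (2 * s)) * norm z ^ n"
    using assms(2) unfolding q_asymp_def by blast
  show ?thesis
  proof (rule q_asympI)
    show "C + D > 0" "A + B > 0" using C D by auto
    fix \<epsilon> :: real and z n assume z: "\<epsilon> > 0" "z \<in> qsector \<Lambda> \<epsilon> R"
    let ?w = "norm q powr (real n ^ 2 / (2 * s)) * norm z ^ n"
    have "f z + g z - (\<Sum>l<n. (a l + b l) * z ^ l) =
        (f z - (\<Sum>l<n. a l * z ^ l)) + (g z - (\<Sum>l<n. b l * z ^ l))"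
      by (simp add: distrib_right sum.distrib)
    then have "norm (f z + g z - (\<Sum>l<n. (a l + b l) * z ^ l)) \<le> C / \<epsilon> * A ^ n * ?w + D / \<epsilon> * B ^ n * ?w"
      using f[OF z, of n] g[OF z, of n] norm_triangle_mono by (simp only: mult.assoc)
    also have "\<dots> \<le> C / \<epsilon> * (A + B) ^ n * ?w + D / \<epsilon> * (A + B) ^ n * ?w"
      using C D z by (intro add_mono mult_right_mono mult_left_mono power_mono) auto
    also have "\<dots> = (C + D) / \<epsilon> * (A + B) ^ n * norm q powr (real n ^ 2 / (2 * s)) * norm z ^ n"
      by (simp only: add_divide_distrib distrib_right mult.assoc)
    finally show "norm (f z + g z - (\<Sum>l<n. (a l + b l) * z ^ l))
      \<le> (C + D) / \<epsilon> * (A + B) ^ n * norm q powr (real n ^ 2 / (2 * s)) * norm z ^ n" .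
  qed
qed

lemma q_asymp_sum:
  assumes "finite I" "\<And>i. i \<in> I \<Longrightarrow> \<exists>a. q_asymp s R (f i) a"
  shows "\<exists>a. q_asymp s R (\<lambda>z. \<Sum>i\<in>I. f i z) a"
  using assms
proof (induction rule: finite_induct)
  case empty
  show ?case using q_asymp_zero by auto
next
  case (insert i I)
  then obtain a b where "q_asymp s R (f i) a" "q_asymp s R (\<lambda>z. \<Sum>i\<in>I. f i z) b"
    by (metis insertCI)
  from q_asymp_add[OF this] show ?case using insert by auto
qed

text \<open>Cauchy's inequality on an intermediate radius t bounds the Taylor remainder
  geometrically. The other factors only weaken this: the power of |q| is at least 1, and so is 1 /
  \<epsilon>, because \<open>dq\<close> never exceeds 1.\<close>

lemma q_asymp_holomorphic:
  assumes g: "g holomorphic_on ball 0 r" and R: "0 < R" "R < r" and s: "s > 0"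
  shows "\<exists>a. q_asymp s R g a"
proof -
  define t where "t = (R + r) / 2"
  have t: "R < t" "t < r" "t > 0" using R by (auto simp: t_def)
  have sub: "cball 0 t \<subseteq> ball (0::complex) r" using t by auto
  have cont: "continuous_on (cball 0 t) g"
    using holomorphic_on_imp_continuous_on[OF g] sub by (rule continuous_on_subset)
  then have "bounded (g ` cball 0 t)"
    by (intro compact_imp_bounded compact_continuous_image) auto
  then obtain M where M: "M > 0" "\<And>z. z \<in> cball 0 t \<Longrightarrow> norm (g z) \<le> M"
    by (auto simp: bounded_pos)
  define a where "a n = (deriv ^^ n) g 0 / fact n" for n
  have a: "norm (a n) \<le> M / t ^ n" for n
  proof -
    have "norm ((deriv ^^ n) g 0) \<le> fact n * M / t ^ n"
      by (rule Cauchy_inequality[OF holomorphic_on_subset[OF g] cont t(3)]) (use sub t M in auto)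
    then show ?thesis by (simp add: a_def norm_divide divide_le_eq mult_ac)
  qed
  have sums: "(\<lambda>n. a n * z ^ n) sums g z" if "norm z < r" for z
    using holomorphic_power_series[OF g, of z] that by (simp add: a_def)
  have "q_asymp s R g a"
  proof (rule q_asympI)
    show "M / (1 - R / t) > 0" "1 / t > 0" using M t by auto
    fix \<epsilon> :: real and z n assume \<epsilon>: "\<epsilon> > 0" and z: "z \<in> qsector \<Lambda> \<epsilon> R"
    have zR: "norm z < R" and "\<epsilon> < 1" using z dq_le_1[of z] by (auto simp: qsector_def)
    let ?x = "norm z / t"
    have x: "0 \<le> ?x" "?x \<le> R / t" "R / t < 1"
      using zR t by (auto intro: divide_right_mono)
    have geo: "(\<lambda>k. M * ?x ^ n * ?x ^ k) sums (M * ?x ^ n * (1 / (1 - ?x)))"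
      using x by (intro sums_mult geometric_sums) auto
    have rem: "(\<lambda>k. a (k + n) * z ^ (k + n)) sums (g z - (\<Sum>l<n. a l * z ^ l))"
      by (rule sums_split_initial_segment[OF sums]) (use zR R in simp)
    have "norm (a (k + n) * z ^ (k + n)) \<le> M * ?x ^ n * ?x ^ k" for k
    proof -
      have "norm (a (k + n) * z ^ (k + n)) \<le> M / t ^ (k + n) * norm z ^ (k + n)"
        unfolding norm_mult norm_power using a by (intro mult_right_mono) auto
      then show ?thesis by (simp add: power_add power_divide mult_ac)
    qed
    then have "norm (g z - (\<Sum>l<n. a l * z ^ l)) \<le> M * ?x ^ n * (1 / (1 - ?x))"
      by (rule norm_sums_le[OF rem geo])
    also have "\<dots> \<le> M * ?x ^ n * (1 / (1 - R / t))"
      using x M by (intro mult_left_mono divide_left_mono) auto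
    also have "\<dots> = M / (1 - R / t) * (1 / t) ^ n * norm z ^ n"
      by (simp add: power_divide)
    also have "\<dots> \<le> M / (1 - R / t) / \<epsilon> * (1 / t) ^ n * (norm q powr (real n ^ 2 / (2 * s)) * norm z ^ n)"
    proof (intro mult_mono)
      show "M / (1 - R / t) \<le> M / (1 - R / t) / \<epsilon>"
        using M x \<epsilon> \<open>\<epsilon> < 1\<close> by (simp add: pos_le_divide_eq mult_left_le)
      have "norm q powr (real n ^ 2 / (2 * s)) \<ge> 1" using q s by (intro ge_one_powr_ge_zero) auto
      then show "norm z ^ n \<le> norm q powr (real n ^ 2 / (2 * s)) * norm z ^ n"
        using mult_right_mono[of 1 "norm q powr (real n ^ 2 / (2 * s))" "norm z ^ n"] by simp
    qed (use M x \<epsilon> t in auto)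
    finally show "norm (g z - (\<Sum>l<n. a l * z ^ l))
      \<le> M / (1 - R / t) / \<epsilon> * (1 / t) ^ n * norm q powr (real n ^ 2 / (2 * s)) * norm z ^ n"
      by (simp only: mult.assoc)
  qed
  then show ?thesis by blast
qed

lemma polar_series_summable:
  fixes c :: "nat \<Rightarrow> complex"
  assumes "summable (\<lambda>k. norm (c k))" "d > 0" "\<And>k. d \<le> norm (w k - 1)"
  shows "summable (\<lambda>k. norm (c k / (w k - 1) ^ j))"
    "norm (\<Sum>k. c k / (w k - 1) ^ j) \<le> (\<Sum>k. norm (c k)) / d ^ j"
proof -
  have le: "norm (c k / (w k - 1) ^ j) \<le> norm (c k) / d ^ j" for k
    unfolding norm_divide norm_power using assms
    by (intro divide_left_mono power_mono mult_pos_pos zero_less_power)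
       (use assms(2,3) in \<open>auto intro: less_le_trans simp del: zero_less_norm_iff\<close>)
  have sm: "summable (\<lambda>k. norm (c k) / d ^ j)" using assms(1) by (rule summable_divide)
  show 1: "summable (\<lambda>k. norm (c k / (w k - 1) ^ j))"
    by (rule summable_comparison_test'[OF sm, of 0]) (use le in auto)
  have "norm (\<Sum>k. c k / (w k - 1) ^ j) \<le> (\<Sum>k. norm (c k / (w k - 1) ^ j))"
    by (rule summable_norm[OF 1])
  also have "\<dots> \<le> (\<Sum>k. norm (c k) / d ^ j)" by (rule suminf_le[OF le 1 sm])
  also have "\<dots> = (\<Sum>k. norm (c k)) / d ^ j" using suminf_divide[OF assms(1)] by simp
  finally show "norm (\<Sum>k. c k / (w k - 1) ^ j) \<le> (\<Sum>k. norm (c k)) / d ^ j" .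
qed

text \<open>Each term is expanded by \<open>inverse_power_expansion\<close>. With w = z q^k / l one
  has |w|^n = |z|^n |q|^(k n) / |l|^n, so the sum of the remainders is controlled by the series of
  \<open>gaussian_sum_bound\<close>.\<close>

lemma q_asymp_polar_series:
  assumes \<sigma>: "\<sigma> \<in># \<Lambda>" "l \<in> \<sigma>" and j: "j \<le> count \<Lambda> \<sigma>" and s: "s > 0" and C: "C > 0" "A > 0"
    and c: "\<And>k. norm (c k) \<le> C * A ^ k * norm q powr (- s * real k ^ 2 / 2)"
  shows "\<exists>a. q_asymp s R (\<lambda>z. \<Sum>k. c k / (z / (l / q ^ k) - 1) ^ j) a"
proof -
  have l: "l \<noteq> 0" "\<sigma> = qspiral q l" using divisor_spiral[OF div q0 \<sigma>] by auto
  obtain D B where D: "D > 0" "B > 0" and sm: "\<And>n. summable (\<lambda>k. norm (c k) * norm q ^ (k * n))"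
    and le: "\<And>n. (\<Sum>k. norm (c k) * norm q ^ (k * n)) \<le> D * B ^ n * norm q powr (real n ^ 2 / (2 * s))"
    by (rule gaussian_sum_bound[OF q s C c]) blast
  obtain b K where K: "K > 0" and bb: "\<And>n. norm (b n) \<le> K * 2 ^ n"
    and b: "\<And>n w d. w \<noteq> 1 \<Longrightarrow> 0 < d \<Longrightarrow> d \<le> 1 \<Longrightarrow> d \<le> norm (w - 1) \<Longrightarrow>
       norm (1 / (w - 1) ^ j - (\<Sum>l<n. b l * w ^ l :: complex)) \<le> K * 2 ^ n * norm w ^ n / d ^ j"
    by (rule inverse_power_expansion[of j]) blast
  define a where "a n = (\<Sum>k. c k * b n * (q ^ k / l) ^ n)" for n
  have sa: "summable (\<lambda>k. c k * b n * (q ^ k / l) ^ n)" for n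
  proof -
    have "norm (c k * b n * (q ^ k / l) ^ n) = norm (b n) / norm l ^ n * (norm (c k) * norm q ^ (k * n))" for k
      by (simp add: norm_mult norm_power norm_divide power_divide power_mult)
    then have "summable (\<lambda>k. norm (c k * b n * (q ^ k / l) ^ n))"
      using summable_mult[OF sm[of n], of "norm (b n) / norm l ^ n"] by simp
    then show ?thesis by (rule summable_norm_cancel)
  qed
  have "q_asymp s R (\<lambda>z. \<Sum>k. c k / (z / (l / q ^ k) - 1) ^ j) a"
  proof (rule q_asympI)
    show "K * D > 0" "2 * B / norm l > 0" using K D l by auto
    fix \<epsilon> :: real and z n assume \<epsilon>: "\<epsilon> > 0" and z: "z \<in> qsector \<Lambda> \<epsilon> R"
    define d where "d = dq_spiral z \<sigma>"
    have d: "0 \<le> d" "d \<le> 1" using dq_spiral_bounds[OF \<sigma>(1)] by (auto simp: d_def)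
    have "\<epsilon> < d ^ count \<Lambda> \<sigma>"
      using z dq_le_spiral_power[OF \<sigma>(1), of z] by (auto simp: qsector_def d_def)
    also have "\<dots> \<le> d ^ j" using d j by (intro power_decreasing) auto
    finally have dj: "\<epsilon> < d ^ j" .
    have "d \<noteq> 0" using \<open>\<epsilon> < d ^ count \<Lambda> \<sigma>\<close> \<epsilon> \<sigma>(1) by (auto simp: zero_power)
    then have d0: "d > 0" using d by simp
    define w where "w k = z / (l / q ^ k)" for k
    have dw: "d \<le> norm (w k - 1)" for k
      using dq_spiral_le[OF qspiral_divide_power[OF q0, of l k], of z] l
      by (simp add: d_def w_def norm_minus_commute)
    have w1: "w k \<noteq> 1" for k using dw[of k] d0 by auto
    have s0: "summable (\<lambda>k. norm (c k))" using sm[of 0] by simp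
    have 1: "(\<lambda>k. c k / (w k - 1) ^ j) sums (\<Sum>k. c k / (w k - 1) ^ j)"
      by (intro summable_sums summable_norm_cancel[OF polar_series_summable(1)[OF s0 d0 dw]])
    have "(\<lambda>k. \<Sum>i<n. c k * b i * (q ^ k / l) ^ i * z ^ i) sums (\<Sum>i<n. a i * z ^ i)"
      unfolding a_def by (intro sums_sum sums_mult2 summable_sums sa)
    from sums_diff[OF 1 this]
    have "(\<lambda>k. c k / (w k - 1) ^ j - (\<Sum>i<n. c k * b i * (q ^ k / l) ^ i * z ^ i)) sums
        ((\<Sum>k. c k / (w k - 1) ^ j) - (\<Sum>i<n. a i * z ^ i))" .
    moreover have "c k / (w k - 1) ^ j - (\<Sum>i<n. c k * b i * (q ^ k / l) ^ i * z ^ i) =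
        c k * (1 / (w k - 1) ^ j - (\<Sum>i<n. b i * w k ^ i))" for k
      by (simp add: w_def right_diff_distrib sum_distrib_left power_mult_distrib power_divide mult_ac)
    ultimately have rem: "(\<lambda>k. c k * (1 / (w k - 1) ^ j - (\<Sum>i<n. b i * w k ^ i))) sums
        ((\<Sum>k. c k / (w k - 1) ^ j) - (\<Sum>i<n. a i * z ^ i))" by simp
    let ?Q = "K * 2 ^ n * norm z ^ n / norm l ^ n / \<epsilon>"
    have "norm (c k * (1 / (w k - 1) ^ j - (\<Sum>i<n. b i * w k ^ i))) \<le>
        ?Q * (norm (c k) * norm q ^ (k * n))" for k
    proof -
      have "norm (1 / (w k - 1) ^ j - (\<Sum>i<n. b i * w k ^ i)) \<le> K * 2 ^ n * norm (w k) ^ n / d ^ j"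
        by (rule b[OF w1 d0 d(2) dw])
      also have "\<dots> \<le> K * 2 ^ n * norm (w k) ^ n / \<epsilon>"
        using dj \<epsilon> K by (intro divide_left_mono) auto
      also have "norm (w k) ^ n = norm z ^ n * norm q ^ (k * n) / norm l ^ n"
        by (simp add: w_def norm_divide norm_mult norm_power power_divide power_mult_distrib power_mult)
      finally have "norm (c k) * norm (1 / (w k - 1) ^ j - (\<Sum>i<n. b i * w k ^ i)) \<le>
          norm (c k) * (K * 2 ^ n * (norm z ^ n * norm q ^ (k * n) / norm l ^ n) / \<epsilon>)"
        by (intro mult_left_mono) auto
      then show ?thesis by (simp add: norm_mult mult_ac)
    qed
    then have "norm ((\<Sum>k. c k / (w k - 1) ^ j) - (\<Sum>i<n. a i * z ^ i)) \<le>
        ?Q * (\<Sum>k. norm (c k) * norm q ^ (k * n))"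
      by (rule norm_sums_le[OF rem sums_mult[OF summable_sums[OF sm[of n]]]])
    also have "\<dots> \<le> ?Q * (D * B ^ n * norm q powr (real n ^ 2 / (2 * s)))"
      using le[of n] K \<epsilon> by (intro mult_left_mono) auto
    also have "\<dots> = K * D / \<epsilon> * (2 * B / norm l) ^ n * norm q powr (real n ^ 2 / (2 * s)) * norm z ^ n"
      by (simp add: power_divide power_mult_distrib mult_ac)
    finally show "norm ((\<Sum>k. c k / (z / (l / q ^ k) - 1) ^ j) - (\<Sum>i<n. a i * z ^ i)) \<le>
        K * D / \<epsilon> * (2 * B / norm l) ^ n * norm q powr (real n ^ 2 / (2 * s)) * norm z ^ n"
      unfolding w_def .
  qed
  then show ?thesis by blast
qed

text \<open>On a disc around z0 all but finitely many terms stay at distance at least 1 from their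
  poles, and their sum converges uniformly. A pole may coincide with z0 if its coefficient is 0;
  \<open>polar_series_split\<close> relies on this.\<close>

lemma polar_series_analytic:
  assumes c: "summable (\<lambda>k. norm (c k))" and l: "l \<noteq> 0" and z0: "z0 \<noteq> 0"
    and avoid: "\<And>k. c k \<noteq> 0 \<Longrightarrow> l / q ^ k \<noteq> z0"
  shows "(\<lambda>z. \<Sum>k. c k / (z / (l / q ^ k) - 1) ^ j) analytic_on {z0}"
    "\<forall>\<^sub>F z in nhds z0. summable (\<lambda>k. c k / (z / (l / q ^ k) - 1) ^ j)"
proof -
  \<comment> \<open>One factor 2 is lost because |z| may be half of |z0| on the disc; the other
    ensures |z q^k / l| \<ge> 2 for k \<ge> N, hence distance at least 1 from 1.\<close>
  obtain N where "4 * norm l / norm z0 < norm q ^ N" using real_arch_pow[OF q] by blast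
  then have N: "4 * norm l < norm z0 * norm q ^ N" using z0 by (simp add: pos_divide_less_eq mult.commute)
  let ?u = "\<lambda>k z. c k / (z / (l / q ^ k) - 1) ^ j"
  let ?B = "cball z0 (norm z0 / 2)"
  have far: "1 \<le> norm (z / (l / q ^ (k + N)) - 1)" if "z \<in> ?B" for z k
  proof -
    have "norm z0 \<le> norm z + norm (z0 - z)" using norm_triangle_ineq[of z "z0 - z"] by simp
    then have "norm z0 \<le> 2 * norm z" using that by (simp add: dist_norm)
    then have "norm z0 * norm q ^ N \<le> 2 * norm z * norm q ^ (k + N)"
      using q power_increasing[of N "k + N" "norm q"] by (intro mult_mono) auto
    then have "2 * norm l \<le> norm z * norm q ^ (k + N)" using N by simp
    moreover have "norm (z / (l / q ^ (k + N))) = norm z * norm q ^ (k + N) / norm l"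
      by (simp add: norm_divide norm_mult norm_power)
    ultimately have "2 \<le> norm (z / (l / q ^ (k + N)))" using l by (simp add: pos_le_divide_eq)
    then show ?thesis using norm_triangle_ineq2[of "z / (l / q ^ (k + N))" 1] by simp
  qed
  have bd: "norm (?u (k + N) z) \<le> norm (c (k + N))" if "z \<in> ?B" for z k
  proof -
    have "1 \<le> norm (z / (l / q ^ (k + N)) - 1) ^ j" using far[OF that] by (rule one_le_power)
    then have "norm (c (k + N)) / norm (z / (l / q ^ (k + N)) - 1) ^ j \<le> norm (c (k + N)) / 1"
      by (intro divide_left_mono) auto
    then show ?thesis by (simp only: norm_divide norm_power div_by_1)
  qed
  have cN: "summable (\<lambda>k. norm (c (k + N)))" using c by (rule summable_ignore_initial_segment)
  have ul: "uniform_limit ?B (\<lambda>n z. \<Sum>k<n. ?u (k + N) z) (\<lambda>z. \<Sum>k. ?u (k + N) z) sequentially"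
    by (rule Weierstrass_m_test[OF _ cN]) (use bd in auto)
  have hol: "(\<lambda>z. \<Sum>k<n. ?u (k + N) z) holomorphic_on ?B" for n
  proof (intro holomorphic_intros)
    fix k z assume z: "z \<in> ?B"
    have "z / (l / q ^ (k + N)) - 1 \<noteq> 0"
    proof
      assume "z / (l / q ^ (k + N)) - 1 = 0"
      then have "norm (z / (l / q ^ (k + N)) - 1) = 0" by (simp only: norm_zero)
      then show False using far[OF z, of k] by linarith
    qed
    then show "(z / (l / q ^ (k + N)) - 1) ^ j \<noteq> 0" by (rule power_not_zero)
  qed (use l q0 in auto)
  have "\<forall>\<^sub>F n in sequentially. continuous_on ?B (\<lambda>z. \<Sum>k<n. ?u (k + N) z) \<and>
      (\<lambda>z. \<Sum>k<n. ?u (k + N) z) holomorphic_on ball z0 (norm z0 / 2)"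
    by (intro always_eventually allI conjI holomorphic_on_imp_continuous_on hol
          holomorphic_on_subset[OF hol] ball_subset_cball)
  then have "(\<lambda>z. \<Sum>k. ?u (k + N) z) holomorphic_on ball z0 (norm z0 / 2)"
    by (rule holomorphic_uniform_limit[OF _ ul]) auto
  then have "(\<lambda>z. \<Sum>k. ?u (k + N) z) analytic_on ball z0 (norm z0 / 2)"
    by (simp add: analytic_on_open)
  then have tail: "(\<lambda>z. \<Sum>k. ?u (k + N) z) analytic_on {z0}"
    by (rule analytic_on_subset) (use z0 in auto)
  have u: "?u k analytic_on {z0}" for k
  proof (cases "c k = 0")
    case False
    then have "z0 / (l / q ^ k) \<noteq> 1" using avoid[of k] l q0 by (auto simp: field_simps)
    then show ?thesis by (intro analytic_intros) (use l q0 in auto)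
  qed simp
  have head: "(\<lambda>z. \<Sum>k<N. ?u k z) analytic_on {z0}" by (intro analytic_on_sum u)
  have ev: "\<forall>\<^sub>F z in nhds z0. z \<in> ball z0 (norm z0 / 2)"
    by (rule eventually_nhds_in_open) (use z0 in auto)
  have sm: "summable (\<lambda>k. ?u k z)" if "z \<in> ball z0 (norm z0 / 2)" for z
  proof -
    have "summable (\<lambda>k. norm (?u (k + N) z))"
      by (rule summable_comparison_test'[OF cN, of 0]) (use bd[of z] that in auto)
    then have "summable (\<lambda>k. ?u (k + N) z)" by (rule summable_norm_cancel)
    then show ?thesis by (subst (asm) summable_iff_shift)
  qed
  show "\<forall>\<^sub>F z in nhds z0. summable (\<lambda>k. ?u k z)"
    using ev by (rule eventually_mono) (rule sm)
  have "\<forall>\<^sub>F z in nhds z0. (\<Sum>k. ?u k z) = (\<Sum>k. ?u (k + N) z) + (\<Sum>k<N. ?u k z)"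
    using ev by (rule eventually_mono) (rule suminf_split_initial_segment[OF sm])
  then show "(\<lambda>z. \<Sum>k. ?u k z) analytic_on {z0}"
    using analytic_on_add[OF tail head] by (simp add: analytic_at_cong)
qed

end

subsection \<open>Principal parts\<close>

text \<open>\<open>H\<close> is the power series with coefficients shifted by n, which also makes
  sense at the centre, where no division is possible.\<close>

lemma taylor_divide:
  assumes G: "G holomorphic_on ball (x::complex) r"
  obtains H where "H holomorphic_on ball x r"
    "\<And>u. u \<in> ball x r \<Longrightarrow>
       G u = (\<Sum>i<n. (deriv ^^ i) G x / fact i * (u - x) ^ i) + (u - x) ^ n * H u"
proof -
  let ?g = "\<lambda>i. (deriv ^^ i) G x / fact i"
  have sums: "(\<lambda>i. ?g i * (u - x) ^ i) sums G u" if "u \<in> ball x r" for u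
    by (rule holomorphic_power_series[OF G that])
  define H where "H u = (\<Sum>i. ?g (i + n) * (u - x) ^ i)" for u
  have sm: "summable (\<lambda>i. ?g (i + n) * (u - x) ^ i)" if u: "u \<in> ball x r" for u
  proof (cases "u = x")
    case True
    then show ?thesis by (intro summable_finite[of "{0}"]) auto
  next
    case False
    have "summable (\<lambda>i. ?g (i + n) * (u - x) ^ (i + n))"
      using summable_ignore_initial_segment[OF sums_summable[OF sums[OF u]], of n] .
    from summable_mult2[OF this, of "inverse ((u - x) ^ n)"] False show ?thesis
      by (simp add: power_add field_simps)
  qed
  show thesis
  proof
    show "H holomorphic_on ball x r"
      unfolding H_def[abs_def]
      by (rule power_series_holomorphic[of _ _ "\<lambda>i. ?g (i + n)"]) (rule summable_sums[OF sm])
    fix u assume u: "u \<in> ball x r"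
    have "G u - (\<Sum>i<n. ?g i * (u - x) ^ i) = (\<Sum>i. ?g (i + n) * (u - x) ^ (i + n))"
      using sums_split_initial_segment[OF sums[OF u], of n] by (rule sums_unique)
    also have "\<dots> = (\<Sum>i. (u - x) ^ n * (?g (i + n) * (u - x) ^ i))"
      by (simp add: power_add mult_ac)
    also have "\<dots> = (u - x) ^ n * H u"
      unfolding H_def by (rule suminf_mult[OF sm[OF u]])
    finally show "G u = (\<Sum>i<n. ?g i * (u - x) ^ i) + (u - x) ^ n * H u" by (simp add: algebra_simps)
  qed
qed

locale q_divisor_reps = q_divisor +
  fixes \<rho> :: "complex set \<Rightarrow> complex"
  assumes reps: "\<And>\<sigma>. \<sigma> \<in># \<Lambda> \<Longrightarrow> \<rho> \<sigma> \<in> \<sigma>"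
begin

lemma rep: "\<sigma> \<in># \<Lambda> \<Longrightarrow> \<rho> \<sigma> \<noteq> 0" "\<sigma> \<in># \<Lambda> \<Longrightarrow> \<sigma> = qspiral q (\<rho> \<sigma>)"
  using divisor_spiral[OF div q0 _ reps] by auto

text \<open>Distinct spirals are disjoint, so at u = 1 only the theta factor of \<sigma> vanishes,
  simply and as often as \<sigma> occurs.\<close>

lemma theta_div_zero_order:
  assumes \<sigma>: "\<sigma> \<in># \<Lambda>"
  obtains E where "E holomorphic_on - {0}" "E 1 \<noteq> 0"
    "\<And>u. 1 / norm q < norm u \<Longrightarrow> norm u < norm q \<Longrightarrow>
       theta_div q \<rho> \<Lambda> (\<rho> \<sigma> * u) = (u - 1) ^ count \<Lambda> \<sigma> * E u"
proof -
  obtain E where E: "E holomorphic_on - {0}" "E 1 \<noteq> 0"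
    "\<And>u. 1 / norm q < norm u \<Longrightarrow> norm u < norm q \<Longrightarrow> theta q (- u) = (u - 1) * E u"
    using theta_simple_zero[OF q] by blast
  let ?P = "\<lambda>u. \<Prod>\<tau>\<in>set_mset \<Lambda> - {\<sigma>}. theta q (- (\<rho> \<sigma> * u) / \<rho> \<tau>) ^ count \<Lambda> \<tau>"
  show thesis
  proof
    have "(\<lambda>u. theta q (- (\<rho> \<sigma> * u) / \<rho> \<tau>)) holomorphic_on - {0}" if "\<tau> \<in> set_mset \<Lambda> - {\<sigma>}" for \<tau>
      by (rule holomorphic_on_compose_gen[OF _ theta_holomorphic[OF q], unfolded o_def])
         (use that rep \<sigma> in \<open>auto intro!: holomorphic_intros\<close>)
    then show "(\<lambda>u. E u ^ count \<Lambda> \<sigma> * ?P u) holomorphic_on - {0}"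
      using E(1) by (intro holomorphic_intros)
    have "theta q (- \<rho> \<sigma> / \<rho> \<tau>) \<noteq> 0" if \<tau>: "\<tau> \<in> set_mset \<Lambda> - {\<sigma>}" for \<tau>
    proof (rule theta_nonzero[OF q])
      have nz: "\<rho> \<sigma> \<noteq> 0" "\<rho> \<tau> \<noteq> 0" using \<tau> \<sigma> rep by auto
      then show "- \<rho> \<sigma> / \<rho> \<tau> \<noteq> 0" by simp
      fix k :: int
      show "- \<rho> \<sigma> / \<rho> \<tau> \<noteq> - (q powi k)"
      proof
        assume "- \<rho> \<sigma> / \<rho> \<tau> = - (q powi k)"
        then have "\<rho> \<sigma> = \<rho> \<tau> * q powi k" using nz by (simp add: field_simps)
        then have "\<rho> \<sigma> \<in> qspiral q (\<rho> \<tau>)" by (auto simp: qspiral_def)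
        then have "qspiral q (\<rho> \<sigma>) = qspiral q (\<rho> \<tau>)" by (rule qspiral_eq[OF q0])
        then show False using \<tau> \<sigma> rep by auto
      qed
    qed
    then have "?P 1 \<noteq> 0" by simp
    then show "E 1 ^ count \<Lambda> \<sigma> * ?P 1 \<noteq> 0" using E(2) by simp
    fix u :: complex assume u: "1 / norm q < norm u" "norm u < norm q"
    have "theta_div q \<rho> \<Lambda> (\<rho> \<sigma> * u) =
        theta q (- (\<rho> \<sigma> * u) / \<rho> \<sigma>) ^ count \<Lambda> \<sigma> * ?P u"
      unfolding theta_div_def by (rule prod.remove) (use \<sigma> in auto)
    also have "- (\<rho> \<sigma> * u) / \<rho> \<sigma> = - u" using rep \<sigma> by simp
    finally show "theta_div q \<rho> \<Lambda> (\<rho> \<sigma> * u) = (u - 1) ^ count \<Lambda> \<sigma> * (E u ^ count \<Lambda> \<sigma> * ?P u)"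
      unfolding E(3)[OF u] by (simp add: power_mult_distrib mult_ac)
  qed
qed

text \<open>The automorphy factor: dividing z by q divides \<open>theta_div\<close> by
  \<open>multiplier z\<close>.\<close>

definition multiplier :: "complex \<Rightarrow> complex" where
  "multiplier z = (\<Prod>\<sigma>\<in>set_mset \<Lambda>. (- z / \<rho> \<sigma>) ^ count \<Lambda> \<sigma>)"

lemma theta_div_divide_power:
  assumes "z \<noteq> 0"
  shows "theta_div q \<rho> \<Lambda> (z / q ^ k) =
    theta_div q \<rho> \<Lambda> z * q ^ (k * (k - 1) div 2 * size \<Lambda>) / multiplier z ^ k"
proof -
  let ?T = "k * (k - 1) div 2"
  have "theta q (- (z / q ^ k) / \<rho> \<sigma>) ^ count \<Lambda> \<sigma> =
      theta q (- z / \<rho> \<sigma>) ^ count \<Lambda> \<sigma> * q ^ (?T * count \<Lambda> \<sigma>) / ((- z / \<rho> \<sigma>) ^ count \<Lambda> \<sigma>) ^ k"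
    if "\<sigma> \<in># \<Lambda>" for \<sigma>
  proof -
    have "- (z / q ^ k) / \<rho> \<sigma> = (- z / \<rho> \<sigma>) / q ^ k" by simp
    moreover have "- z / \<rho> \<sigma> \<noteq> 0" using assms rep that by simp
    ultimately have "theta q (- (z / q ^ k) / \<rho> \<sigma>) = theta q (- z / \<rho> \<sigma>) * q ^ ?T / (- z / \<rho> \<sigma>) ^ k"
      using theta_divide_power[OF q] by metis
    then show ?thesis
      by (simp only: power_mult_distrib power_divide power_mult[symmetric] mult.commute[of k])
  qed
  then have "theta_div q \<rho> \<Lambda> (z / q ^ k) = (\<Prod>\<sigma>\<in>set_mset \<Lambda>.
      theta q (- z / \<rho> \<sigma>) ^ count \<Lambda> \<sigma> * q ^ (?T * count \<Lambda> \<sigma>) / ((- z / \<rho> \<sigma>) ^ count \<Lambda> \<sigma>) ^ k)"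
    unfolding theta_div_def by (intro prod.cong) auto
  also have "\<dots> = theta_div q \<rho> \<Lambda> z * (\<Prod>\<sigma>\<in>set_mset \<Lambda>. q ^ (?T * count \<Lambda> \<sigma>)) / multiplier z ^ k"
    by (simp only: prod.distrib prod_dividef prod_power_distrib theta_div_def multiplier_def)
  also have "(\<Prod>\<sigma>\<in>set_mset \<Lambda>. q ^ (?T * count \<Lambda> \<sigma>)) = q ^ (?T * size \<Lambda>)"
    by (simp add: size_multiset_overloaded_eq power_sum[symmetric] sum_distrib_left)
  finally show ?thesis .
qed

lemma multiplier_holomorphic: "multiplier holomorphic_on A"
  unfolding multiplier_def[abs_def] by (intro holomorphic_intros) (use rep in auto)

text \<open>The exponent k (k - 1) / 2 is k^2 / 2 - k / 2, and the linear part is the geometric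
  factor \<open>norm q powr (real d / 2)\<close>.\<close>

lemma q_bound_triangular: "q_bound (norm q) (- real d) (\<lambda>k. inverse (q ^ (k * (k - 1) div 2 * d)))"
proof (rule q_boundI[of 1 "norm q powr (real d / 2)"])
  have "norm (inverse (q ^ (k * (k - 1) div 2 * d))) =
      1 * (norm q powr (real d / 2)) ^ k * norm q powr (- real d * real k ^ 2 / 2)" for k
  proof -
    have tri: "real (k * (k - 1) div 2) = real k * (real k - 1) / 2"
      by (cases k) (auto simp: real_of_nat_div algebra_simps)
    have e: "real (k * (k - 1) div 2 * d) = (real k ^ 2 - real k) / 2 * real d"
      unfolding of_nat_mult tri by (simp add: power2_eq_square algebra_simps)
    have "norm (inverse (q ^ (k * (k - 1) div 2 * d))) = norm q powr (- real (k * (k - 1) div 2 * d))"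
    proof -
      have "norm q ^ (k * (k - 1) div 2 * d) = norm q powr real (k * (k - 1) div 2 * d)"
        by (rule powr_realpow[symmetric]) (use q0 in auto)
      then show ?thesis by (simp only: norm_inverse norm_power powr_minus)
    qed
    also have "\<dots> = norm q powr (real d / 2 * real k) * norm q powr (- real d * real k ^ 2 / 2)"
    proof -
      have "- real (k * (k - 1) div 2 * d) = real d / 2 * real k + - real d * real k ^ 2 / 2"
        unfolding e by (simp add: algebra_simps diff_divide_distrib)
      then show ?thesis by (simp only: powr_add)
    qed
    finally show ?thesis using q0 by (simp add: powr_realpow[symmetric] powr_powr)
  qed
  then show "\<forall>\<^sub>F k in sequentially. norm (inverse (q ^ (k * (k - 1) div 2 * d))) \<le>
      1 * (norm q powr (real d / 2)) ^ k * norm q powr (- real d * real k ^ 2 / 2)"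
    by simp
qed (use q0 in auto)

text \<open>In the coordinate u = z / (\<rho> \<sigma> / q^k) the quotient is
  \<open>Q k * G u / (u - 1) ^ \<nu>\<close> with G holomorphic at 1, so its polar coefficients are
  the Taylor coefficients of G of order below \<nu>. The index k enters G only through the rescaled
  F and a k-th power. The bound \<open>N\<close> keeps the rescaled disc inside the domain of
  F.\<close>

lemma principal_parts:
  assumes F: "F holomorphic_on ball 0 r - {0}" "r > 0" and \<sigma>: "\<sigma> \<in># \<Lambda>"
    and bound: "\<And>i. i < count \<Lambda> \<sigma> \<Longrightarrow>
      q_bound (norm q) (real (size \<Lambda>) - s) (\<lambda>k. (deriv ^^ i) F (\<rho> \<sigma> / q ^ k))"
  obtains c N where "\<And>i. i < count \<Lambda> \<sigma> \<Longrightarrow> q_bound (norm q) (- s) (c i)"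
    "\<And>k. k \<ge> N \<Longrightarrow> \<exists>E. E analytic_on {\<rho> \<sigma> / q ^ k} \<and> (\<forall>\<^sub>F z in at (\<rho> \<sigma> / q ^ k).
       F z / theta_div q \<rho> \<Lambda> z =
       (\<Sum>i<count \<Lambda> \<sigma>. c i k / (z / (\<rho> \<sigma> / q ^ k) - 1) ^ (count \<Lambda> \<sigma> - i)) + E z)"
proof -
  define l where "l = \<rho> \<sigma>"
  define \<nu> where "\<nu> = count \<Lambda> \<sigma>"
  have l: "l \<noteq> 0" using rep \<sigma> by (simp add: l_def)
  obtain E where E: "E holomorphic_on - {0}" "E 1 \<noteq> 0"
    and \<theta>: "\<And>u. 1 / norm q < norm u \<Longrightarrow> norm u < norm q \<Longrightarrow>
       theta_div q \<rho> \<Lambda> (l * u) = (u - 1) ^ \<nu> * E u"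
    unfolding l_def \<nu>_def by (rule theta_div_zero_order[OF \<sigma>]) blast
  have "open {u::complex. 1 / norm q < norm u \<and> norm u < norm q}"
    by (intro open_Collect_conj open_Collect_less continuous_intros)
  then have "\<forall>\<^sub>F u in nhds (1::complex). u \<in> {u. 1 / norm q < norm u \<and> norm u < norm q}"
    by (rule eventually_nhds_in_open) (use q inverse_norm_q[OF q] in auto)
  moreover have "\<forall>\<^sub>F u in nhds 1. E u \<noteq> 0"
  proof -
    have "isCont E 1"
      using holomorphic_on_imp_continuous_on[OF E(1)] by (simp add: continuous_on_eq_continuous_at open_Compl)
    then have "\<forall>\<^sub>F u in at 1. E u \<noteq> 0"
      unfolding isCont_def using E(2) by (rule tendsto_imp_eventually_ne)
    then show ?thesis using E(2) by (simp add: eventually_nhds_conv_at)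
  qed
  ultimately have "\<forall>\<^sub>F u in nhds 1. 1 / norm q < norm u \<and> norm u < norm q \<and> E u \<noteq> 0"
    by eventually_elim auto
  then obtain \<delta>0 where \<delta>0: "\<delta>0 > 0"
    "\<And>u. dist u 1 < \<delta>0 \<Longrightarrow> 1 / norm q < norm u \<and> norm u < norm q \<and> E u \<noteq> 0"
    by (auto simp: eventually_nhds_metric)
  \<comment> \<open>Halving makes room for a closed disc, whose compactness provides the bounds
    \<open>B\<close> and \<open>B'\<close>.\<close>
  define \<delta> where "\<delta> = \<delta>0 / 2"
  have \<delta>: "\<delta> > 0" using \<delta>0 by (simp add: \<delta>_def)
  have near: "1 / norm q < norm u" "norm u < norm q" "E u \<noteq> 0" "u \<noteq> 0" if "u \<in> cball 1 \<delta>" for u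
  proof -
    have "dist u 1 < \<delta>0" using that \<delta>0(1) by (simp add: \<delta>_def dist_commute)
    from \<delta>0(2)[OF this] show "1 / norm q < norm u" "norm u < norm q" "E u \<noteq> 0" by auto
    then show "u \<noteq> 0" by (auto simp: divide_less_0_iff)
  qed
  \<comment> \<open>What remains of 1 / theta_\<Lambda> at \<open>l * u / q ^ k\<close> without the
    zero at u = 1 and without the power of q, which becomes \<open>Q k\<close>.\<close>
  define h where "h k u = multiplier (l * u) ^ k / E u" for k u
  have mult_hol: "(\<lambda>u. multiplier (l * u)) holomorphic_on A" for A
    by (rule holomorphic_on_compose_gen[OF _ multiplier_holomorphic, unfolded o_def])
       (auto intro!: holomorphic_intros)
  have E_hol: "E holomorphic_on cball 1 \<delta>"
    by (rule holomorphic_on_subset[OF E(1)]) (use near(4) in blast)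
  have h_hol: "h k holomorphic_on cball 1 \<delta>" for k
    unfolding h_def[abs_def] by (intro holomorphic_intros mult_hol E_hol) (use near in auto)
  have "compact ((\<lambda>u. multiplier (l * u)) ` cball 1 \<delta>)"
    by (intro compact_continuous_image holomorphic_on_imp_continuous_on mult_hol) auto
  then obtain B where "\<forall>u\<in>cball 1 \<delta>. norm (multiplier (l * u)) \<le> B"
    by (auto simp: bounded_iff simp del: mem_cball dest!: compact_imp_bounded)
  then have B: "norm (multiplier (l * u)) \<le> B" if "u \<in> cball 1 \<delta>" for u
    using that by blast
  have "compact ((\<lambda>u. 1 / E u) ` cball 1 \<delta>)"
    by (intro compact_continuous_image holomorphic_on_imp_continuous_on holomorphic_intros E_hol)
       (use near in auto)
  then obtain B' where "\<forall>u\<in>cball 1 \<delta>. norm (1 / E u) \<le> B'"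
    by (auto simp: bounded_iff simp del: mem_cball dest!: compact_imp_bounded)
  then have B': "norm (1 / E u) \<le> B'" if "u \<in> cball 1 \<delta>" for u
    using that by blast
  have h_bound: "q_bound (norm q) 0 (\<lambda>k. (deriv ^^ i) (h k) 1)" for i
  proof (rule q_bound_geometric)
    fix k
    have "norm ((deriv ^^ i) (h k) 1) \<le> fact i * (B ^ k * B') / \<delta> ^ i"
    proof (rule Cauchy_inequality)
      show "h k holomorphic_on ball 1 \<delta>" by (rule holomorphic_on_subset[OF h_hol ball_subset_cball])
      show "continuous_on (cball 1 \<delta>) (h k)" by (rule holomorphic_on_imp_continuous_on[OF h_hol])
      fix u :: complex assume "norm (1 - u) = \<delta>"
      then have u: "u \<in> cball 1 \<delta>" by (simp add: dist_norm)
      have "0 \<le> B" using B[OF u] norm_ge_zero order_trans by blast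
      have "h k u = multiplier (l * u) ^ k * (1 / E u)" by (simp add: h_def)
      also have "norm \<dots> \<le> B ^ k * B'"
        unfolding norm_mult norm_power
        by (intro mult_mono power_mono B[OF u] B'[OF u]) (use \<open>0 \<le> B\<close> in auto)
      finally show "norm (h k u) \<le> B ^ k * B'" .
    qed (use \<delta> in auto)
    then show "norm ((deriv ^^ i) (h k) 1) \<le> (fact i * B' / \<delta> ^ i) * B ^ k" by (simp add: mult_ac)
  qed (use q0 in auto)
  obtain N where N: "norm l * (1 + \<delta>) / r < norm q ^ N" using real_arch_pow[OF q] by blast
  have inr: "l / q ^ k * u \<in> ball 0 r - {0}" if "k \<ge> N" "u \<in> cball 1 \<delta>" for k u
  proof -
    have "norm u \<le> 1 + norm (u - 1)" using norm_triangle_ineq[of 1 "u - 1"] by simp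
    also have "\<dots> \<le> 1 + \<delta>" using that by (simp add: dist_norm norm_minus_commute)
    finally have "norm l * norm u \<le> norm l * (1 + \<delta>)" by (rule mult_left_mono) auto
    also have "\<dots> < r * norm q ^ N" using N F(2) by (simp add: pos_divide_less_eq mult.commute)
    also have "\<dots> \<le> r * norm q ^ k" using that q F(2) by (intro mult_left_mono power_increasing) auto
    finally have "norm (l / q ^ k * u) < r"
      using q0 by (simp add: norm_mult norm_divide norm_power divide_less_eq)
    then show ?thesis using near(4)[OF that(2)] l q0 by simp
  qed
  define Q where "Q k = inverse (q ^ (k * (k - 1) div 2 * size \<Lambda>))" for k
  \<comment> \<open>The i-th Taylor coefficient at 1 of the product \<open>G\<close> defined below,
    written out by Leibniz' rule so that the bounds for F and \<open>h\<close> apply separately. It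
    belongs to the pole of order \<nu> - i.\<close>
  define c where "c i k = Q k * ((\<Sum>a=0..i. of_nat (i choose a) * ((l / q ^ k) ^ a * (deriv ^^ a) F (l / q ^ k)) *
    (deriv ^^ (i - a)) (h k) 1) / fact i)" for i k
  have c_bound: "q_bound (norm q) (- s) (c i)" if i: "i < \<nu>" for i
  proof -
    have const: "q_bound (norm q) 0 (\<lambda>k. x)" for x
      by (rule q_bound_geometric[of _ "norm x" 1]) (use q0 in auto)
    have pw: "q_bound (norm q) 0 (\<lambda>k. (l / q ^ k) ^ a)" for a
    proof (rule q_bound_geometric)
      show "norm ((l / q ^ k) ^ a) \<le> norm l ^ a * (inverse (norm q ^ a)) ^ k" for k
      proof -
        have "(norm q ^ k) ^ a = (norm q ^ a) ^ k" by (simp add: mult.commute flip: power_mult)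
        then show ?thesis by (simp add: divide_inverse norm_mult norm_inverse norm_power power_mult_distrib power_inverse)
      qed
    qed (use q0 in auto)
    have "q_bound (norm q) (0 + (0 + (real (size \<Lambda>) - s)) + 0)
        (\<lambda>k. of_nat (i choose a) * ((l / q ^ k) ^ a * (deriv ^^ a) F (l / q ^ k)) * (deriv ^^ (i - a)) (h k) 1)"
      if "a \<in> {0..i}" for a
      using that i by (intro q_bound_mult const pw h_bound bound[folded l_def]) (auto simp: \<nu>_def)
    then have "q_bound (norm q) (0 + (0 + (real (size \<Lambda>) - s)) + 0)
        (\<lambda>k. \<Sum>a=0..i. of_nat (i choose a) * ((l / q ^ k) ^ a * (deriv ^^ a) F (l / q ^ k)) *
          (deriv ^^ (i - a)) (h k) 1)"
      by (intro q_bound_sum) auto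
    \<comment> \<open>The weights add up: minus the degree of \<Lambda> from \<open>Q\<close>, that
      degree minus s from F, and 0 from everything else.\<close>
    from q_bound_mult[OF q_bound_triangular[of "size \<Lambda>"] q_bound_mult[OF this const[of "inverse (fact i)"]]]
    show ?thesis unfolding c_def Q_def divide_inverse[of _ "fact i"] by simp
  qed
  have expansion: "\<exists>E. E analytic_on {l / q ^ k} \<and> (\<forall>\<^sub>F z in at (l / q ^ k).
       F z / theta_div q \<rho> \<Lambda> z = (\<Sum>i<\<nu>. c i k / (z / (l / q ^ k) - 1) ^ (\<nu> - i)) + E z)"
    if k: "k \<ge> N" for k
  proof -
    define \<zeta> where "\<zeta> = l / q ^ k"
    have \<zeta>: "\<zeta> \<noteq> 0" using l q0 by (simp add: \<zeta>_def)
    have inball: "\<zeta> * u \<in> ball 0 r - {0}" if "u \<in> ball 1 \<delta>" for u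
    proof -
      have "u \<in> cball 1 \<delta>" using that by simp
      then show ?thesis unfolding \<zeta>_def by (rule inr[OF k])
    qed
    have Fk: "(\<lambda>u. F (\<zeta> * u)) holomorphic_on ball 1 \<delta>"
    proof (rule holomorphic_on_compose_gen[OF _ F(1), unfolded o_def])
      show "(\<lambda>u. \<zeta> * u) ` ball 1 \<delta> \<subseteq> ball 0 r - {0}"
        by (rule image_subsetI) (rule inball)
    qed (intro holomorphic_intros)
    have hk: "h k holomorphic_on ball 1 \<delta>" by (rule holomorphic_on_subset[OF h_hol ball_subset_cball])
    define G where "G u = F (\<zeta> * u) * h k u" for u
    have "G holomorphic_on ball 1 \<delta>" unfolding G_def[abs_def] by (intro holomorphic_intros Fk hk)
    then obtain H where H: "H holomorphic_on ball 1 \<delta>"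
      "\<And>u. u \<in> ball 1 \<delta> \<Longrightarrow>
       G u = (\<Sum>i<\<nu>. (deriv ^^ i) G 1 / fact i * (u - 1) ^ i) + (u - 1) ^ \<nu> * H u"
      by (rule taylor_divide[where n = \<nu>]) blast
    have dF: "(deriv ^^ a) (\<lambda>u. F (\<zeta> * u)) 1 = \<zeta> ^ a * (deriv ^^ a) F \<zeta>" for a
    proof -
      have "(deriv ^^ a) (\<lambda>u. F (\<zeta> * u)) 1 = \<zeta> ^ a * (deriv ^^ a) F (\<zeta> * 1)"
        by (rule higher_deriv_compose_linear[OF F(1) open_ball _ _ inball]) (use \<delta> in \<open>auto simp: open_Diff\<close>)
      then show ?thesis by simp
    qed
    have c: "c i k = Q k * ((deriv ^^ i) G 1 / fact i)" for i
      unfolding c_def G_def[abs_def] \<zeta>_def[symmetric]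
      by (subst higher_deriv_mult[OF Fk hk]) (use \<delta> dF in auto)
    have val: "F z / theta_div q \<rho> \<Lambda> z = (\<Sum>i<\<nu>. c i k / (z / \<zeta> - 1) ^ (\<nu> - i)) + Q k * H (z / \<zeta>)"
      if u: "z / \<zeta> \<in> ball 1 \<delta>" "z \<noteq> \<zeta>" for z
    proof -
      define u where "u = z / \<zeta>"
      have z: "z = \<zeta> * u" using \<zeta> by (simp add: u_def)
      have u1: "u - 1 \<noteq> 0" using u(2) \<zeta> by (auto simp: u_def field_simps)
      have ub: "u \<in> ball 1 \<delta>" "u \<in> cball 1 \<delta>" using u by (auto simp: u_def)
      note nr = near[OF ub(2)]
      have "z = l * u / q ^ k" by (simp add: z \<zeta>_def)
      then have "theta_div q \<rho> \<Lambda> z = (u - 1) ^ \<nu> * E u * q ^ (k * (k - 1) div 2 * size \<Lambda>) / multiplier (l * u) ^ k"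
        using theta_div_divide_power[of "l * u" k] l nr \<theta>[OF nr(1,2)] by simp
      then have "F z / theta_div q \<rho> \<Lambda> z = Q k * (G u / (u - 1) ^ \<nu>)"
        by (simp add: G_def h_def z Q_def divide_inverse mult_ac)
      also have "G u / (u - 1) ^ \<nu> = (\<Sum>i<\<nu>. (deriv ^^ i) G 1 / fact i * ((u - 1) ^ i / (u - 1) ^ \<nu>)) + H u"
        unfolding H(2)[OF ub(1)] using u1 by (simp add: add_divide_distrib sum_divide_distrib)
      also have "(\<Sum>i<\<nu>. (deriv ^^ i) G 1 / fact i * ((u - 1) ^ i / (u - 1) ^ \<nu>)) =
          (\<Sum>i<\<nu>. (deriv ^^ i) G 1 / fact i / (u - 1) ^ (\<nu> - i))"
      proof (rule sum.cong)
        fix i assume "i \<in> {..<\<nu>}"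
        then have "(u - 1) ^ \<nu> = (u - 1) ^ i * (u - 1) ^ (\<nu> - i)" by (simp flip: power_add)
        then show "(deriv ^^ i) G 1 / fact i * ((u - 1) ^ i / (u - 1) ^ \<nu>) =
            (deriv ^^ i) G 1 / fact i / (u - 1) ^ (\<nu> - i)" using u1 by simp
      qed simp
      finally show ?thesis
        unfolding c by (simp add: u_def distrib_left sum_distrib_left)
    qed
    have V: "open ((\<lambda>z. z / \<zeta>) -` ball 1 \<delta>)"
      by (intro open_vimage continuous_intros) (use \<zeta> in auto)
    have \<zeta>V: "\<zeta> \<in> (\<lambda>z. z / \<zeta>) -` ball 1 \<delta>" using \<zeta> \<delta> by simp
    have "(\<lambda>z. Q k * H (z / \<zeta>)) holomorphic_on ((\<lambda>z. z / \<zeta>) -` ball 1 \<delta>)"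
      by (intro holomorphic_intros holomorphic_on_compose_gen[OF _ H(1), unfolded o_def]) (use \<zeta> in auto)
    with V \<zeta>V have "(\<lambda>z. Q k * H (z / \<zeta>)) analytic_on {\<zeta>}"
      unfolding analytic_at by blast
    moreover have "\<forall>\<^sub>F z in at \<zeta>.
       F z / theta_div q \<rho> \<Lambda> z = (\<Sum>i<\<nu>. c i k / (z / \<zeta> - 1) ^ (\<nu> - i)) + Q k * H (z / \<zeta>)"
      using eventually_at_in_open[OF V \<zeta>V]
    proof (rule eventually_mono)
      fix z assume "z \<in> (\<lambda>z. z / \<zeta>) -` ball 1 \<delta> - {\<zeta>}"
      then show "F z / theta_div q \<rho> \<Lambda> z =
          (\<Sum>i<\<nu>. c i k / (z / \<zeta> - 1) ^ (\<nu> - i)) + Q k * H (z / \<zeta>)"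
        by (intro val) auto
    qed
    ultimately show ?thesis unfolding \<zeta>_def by blast
  qed
  show thesis
    using c_bound expansion by (rule that[folded \<nu>_def l_def])
qed

end

subsection \<open>Removing the principal parts\<close>

text \<open>Every point of modulus below t lies in an annulus bounded by two of the circles, so the
  maximum principle carries the bound to a punctured disc, and the singularity at 0 is
  removable.\<close>

lemma holomorphic_extend_circles:
  assumes g: "g holomorphic_on ball 0 r - {0}" and p: "p > 1" and t: "0 < t" "t < r"
    and M: "\<And>z n. norm z = t / p ^ n \<Longrightarrow> norm (g z) \<le> M"
  obtains h where "h holomorphic_on ball (0::complex) r" "\<And>z. z \<in> ball 0 r - {0} \<Longrightarrow> h z = g z"
proof -
  have bd: "norm (g z) \<le> M" if z: "z \<noteq> 0" "norm z < t" for z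
  proof -
    obtain n where n: "t / norm z < p ^ n" using real_arch_pow[OF p] by blast
    have "t < p ^ n * norm z" using n z by (simp add: pos_divide_less_eq)
    then have "t / p ^ n < norm z" using p by (simp add: pos_divide_less_eq mult.commute)
    define S where "S = {w::complex. t / p ^ n < norm w \<and> norm w < t}"
    define K where "K = {w::complex. t / p ^ n \<le> norm w \<and> norm w \<le> t}"
    have S: "open S"
      unfolding S_def by (intro open_Collect_conj open_Collect_less continuous_intros)
    have "closed K"
      unfolding K_def by (intro closed_Collect_conj closed_Collect_le continuous_intros)
    then have clK: "closure S \<subseteq> K" by (rule closure_minimal[rotated]) (auto simp: S_def K_def)
    have tn: "0 < t / p ^ n" using t p by simp
    have sub: "K \<subseteq> ball 0 r - {0}" using tn t by (auto simp: K_def)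
    show ?thesis
    proof (rule maximum_modulus_frontier[where f = g and \<xi> = z and S = S])
      show "g holomorphic_on interior S"
        by (rule holomorphic_on_subset[OF g]) (use interior_subset[of S] closure_subset[of S] clK sub in blast)
      show "continuous_on (closure S) g"
        using holomorphic_on_imp_continuous_on[OF g] clK sub by (blast intro: continuous_on_subset)
      show "bounded S" by (rule boundedI[of _ t]) (auto simp: S_def)
      show "z \<in> S" using \<open>t / p ^ n < norm z\<close> z by (simp add: S_def)
      fix w assume "w \<in> frontier S"
      then have "w \<in> K - S" using clK interior_open[OF S] by (auto simp: frontier_def)
      then have "norm w = t / p ^ n \<or> norm w = t / p ^ 0" by (auto simp: K_def S_def)
      then show "norm (g w) \<le> M" using M by blast
    qed
  qed
  have "\<forall>\<^sub>F z in at 0. norm (g z) \<le> M"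
    unfolding eventually_at using t(1) bd by (intro exI[of _ t]) auto
  moreover have "0 \<in> interior (ball (0::complex) r)" using t by simp
  ultimately obtain h where "h holomorphic_on ball 0 r" "\<forall>z\<in>ball 0 r - {0}. h z = g z"
    using holomorphic_on_extend_bounded[OF g] by blast
  then show thesis using that by blast
qed

text \<open>Points of the spiral other than z0 keep a distance from z0 proportional to their
  modulus. The ratio is 1 - 1 / |q| if z0 lies on the spiral, by comparing powers of q, and the
  positive \<open>dq_spiral\<close> otherwise.\<close>

lemma qspiral_isolated:
  assumes q: "norm q > 1" and l: "l \<noteq> 0" and z0: "z0 \<noteq> 0"
  shows "\<forall>\<^sub>F z in at z0. z \<notin> qspiral q l"
proof -
  have q0: "q \<noteq> 0" using q by auto
  obtain d where d: "d > 0" "\<And>z. z \<in> qspiral q l \<Longrightarrow> z \<noteq> z0 \<Longrightarrow> d * norm z \<le> norm (z - z0)"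
  proof (cases "z0 \<in> qspiral q l")
    case True
    have "(1 - 1 / norm q) * norm z \<le> norm (z - z0)" if "z \<in> qspiral q l" "z \<noteq> z0" for z
    proof -
      have "z0 \<in> qspiral q z" using True qspiral_eq[OF q0 that(1)] by simp
      then obtain k where k: "z0 = z * q powi k" by (auto simp: qspiral_def)
      have "k \<noteq> 0" using k that by auto
      have "1 - 1 / norm q \<le> \<bar>norm q powi k - 1\<bar>"
      proof (cases "k > 0")
        case True
        then have "norm q powi 1 \<le> norm q powi k" using q by (intro power_int_increasing) auto
        moreover have "1 - 1 / norm q \<le> norm q - 1"
        proof -
          have "0 \<le> (norm q - 1) ^ 2 / norm q" by simp
          then show ?thesis using q0 by (simp add: power2_eq_square field_simps)
        qed
        ultimately show ?thesis by simp
      next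
        case False
        then have "norm q powi k \<le> norm q powi (- 1)"
          using q \<open>k \<noteq> 0\<close> by (intro power_int_increasing) auto
        then show ?thesis by (simp add: power_int_minus divide_inverse)
      qed
      also have "\<dots> \<le> norm (q powi k - 1)"
        using norm_triangle_ineq3[of "q powi k" 1] by (simp add: norm_power_int)
      finally have "norm z * (1 - 1 / norm q) \<le> norm z * norm (q powi k - 1)"
        by (rule mult_left_mono) auto
      also have "\<dots> = norm (z0 - z)" unfolding norm_mult[symmetric] k by (simp add: algebra_simps)
      finally show ?thesis by (simp add: norm_minus_commute mult.commute)
    qed
    moreover have "1 - 1 / norm q > 0" using q q0 by simp
    ultimately show thesis using that by blast
  next
    case False
    have "dq_spiral z0 (qspiral q l) * norm z \<le> norm (z - z0)" if "z \<in> qspiral q l" for z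
    proof -
      have "z \<noteq> 0" using qspiral_nonzero[OF q0 l that] .
      have "dq_spiral z0 (qspiral q l) * norm z \<le> norm (1 - z0 / z) * norm z"
        using dq_spiral_le[OF that] by (rule mult_right_mono) auto
      also have "\<dots> = norm (z - z0)"
        unfolding norm_mult[symmetric] using \<open>z \<noteq> 0\<close> by (simp add: left_diff_distrib)
      finally show ?thesis .
    qed
    then show thesis using that dq_spiral_pos[OF q l z0 False] by blast
  qed
  define e where "e = min (norm z0 / 2) (d * norm z0 / 2)"
  have "z \<notin> qspiral q l" if "z \<noteq> z0" "dist z z0 < e" for z
  proof
    assume "z \<in> qspiral q l"
    have "norm z0 \<le> norm z + norm (z0 - z)" using norm_triangle_ineq[of z "z0 - z"] by simp
    then have "norm z0 / 2 \<le> norm z" using that by (simp add: e_def dist_norm norm_minus_commute)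
    then have "d * (norm z0 / 2) \<le> d * norm z" using d(1) by (intro mult_left_mono) auto
    then show False using d(2)[OF \<open>z \<in> qspiral q l\<close> that(1)] that(2) by (simp add: e_def dist_norm)
  qed
  moreover have "e > 0" using d z0 by (simp add: e_def)
  ultimately show ?thesis unfolding eventually_at by blast
qed

context q_divisor
begin

lemma dq_pos_eventually:
  assumes "z0 \<noteq> 0"
  shows "\<forall>\<^sub>F z in at z0. z \<noteq> 0 \<and> dq z \<Lambda> > 0"
proof -
  have "\<forall>\<^sub>F z in at z0. z \<notin> \<sigma>" if \<sigma>: "\<sigma> \<in> set_mset \<Lambda>" for \<sigma>
  proof -
    obtain l where "l \<noteq> 0" "\<sigma> = qspiral q l" using \<sigma> div by (auto simp: is_divisor_def)
    then show ?thesis using qspiral_isolated[OF q _ assms] by simp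
  qed
  then have "\<forall>\<^sub>F z in at z0. \<forall>\<sigma>\<in>set_mset \<Lambda>. z \<notin> \<sigma>"
    by (intro eventually_ball_finite) auto
  moreover have "\<forall>\<^sub>F z in at z0. z \<noteq> 0"
    using assms by (intro eventually_neq_at_within)
  ultimately show ?thesis
    by eventually_elim (use dq_pos_iff in auto)
qed

text \<open>Setting the coefficient of one pole to 0 makes \<open>polar_series_analytic\<close>
  applicable at that very pole, since the remaining poles differ from it.\<close>

lemma polar_series_split:
  assumes c: "summable (\<lambda>k. norm (c k))" and l: "l \<noteq> 0"
  obtains E where "E analytic_on {l / q ^ m}"
    "\<forall>\<^sub>F z in nhds (l / q ^ m). (\<Sum>k. c k / (z / (l / q ^ k) - 1) ^ j)
        = c m / (z / (l / q ^ m) - 1) ^ j + E z"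
proof -
  let ?c = "c(m := 0)"
  let ?u = "\<lambda>z k. ?c k / (z / (l / q ^ k) - 1) ^ j"
  have sm: "summable (\<lambda>k. norm (?c k))"
    by (rule summable_comparison_test'[OF c, of 0]) auto
  have inj: "l / q ^ k \<noteq> l / q ^ m" if "?c k \<noteq> 0" for k
  proof
    assume "l / q ^ k = l / q ^ m"
    then have "q ^ k = q ^ m" using l q0 by simp
    then have "norm q ^ k = norm q ^ m" by (simp only: norm_power[symmetric])
    then have "k = m" using power_inject_exp[OF q] by simp
    then show False using that by simp
  qed
  have nz: "l / q ^ m \<noteq> 0" using l q0 by simp
  note an = polar_series_analytic[OF sm l nz inj, of j]
  have "\<forall>\<^sub>F z in nhds (l / q ^ m). (\<Sum>k. c k / (z / (l / q ^ k) - 1) ^ j)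
        = c m / (z / (l / q ^ m) - 1) ^ j + (\<Sum>k. ?u z k)"
    using an(2)
  proof (rule eventually_mono)
    fix z assume s: "summable (?u z)"
    have "(\<lambda>k. if k = m then c m / (z / (l / q ^ m) - 1) ^ j else 0) sums (c m / (z / (l / q ^ m) - 1) ^ j)"
      by (rule sums_single)
    from sums_add[OF this summable_sums[OF s]]
    have "(\<lambda>k. (if k = m then c m / (z / (l / q ^ m) - 1) ^ j else 0) + ?u z k)
        sums (c m / (z / (l / q ^ m) - 1) ^ j + (\<Sum>k. ?u z k))" .
    moreover have "(\<lambda>k. (if k = m then c m / (z / (l / q ^ m) - 1) ^ j else 0) + ?u z k)
        = (\<lambda>k. c k / (z / (l / q ^ k) - 1) ^ j)" by auto
    ultimately show "(\<Sum>k. c k / (z / (l / q ^ k) - 1) ^ j)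
        = c m / (z / (l / q ^ m) - 1) ^ j + (\<Sum>k. ?u z k)" by (simp add: sums_iff)
  qed
  then show thesis using that an(1) by blast
qed

section \<open>Growth and uniqueness of the coefficients of an expansion\<close>

lemma q_asymp_cong:
  assumes "q_asymp s R f a" "\<And>z. z \<noteq> 0 \<Longrightarrow> norm z < R \<Longrightarrow> dq z \<Lambda> > 0 \<Longrightarrow> f z = g z"
  shows "q_asymp s R g a"
proof -
  have eq: "f z = g z" if "\<epsilon> > 0" "z \<in> qsector \<Lambda> \<epsilon> R" for \<epsilon> z
    using that assms(2) by (auto simp: qsector_def)
  obtain C A where "C > 0" "A > 0" and f: "\<And>\<epsilon> z n. \<epsilon> > 0 \<Longrightarrow> z \<in> qsector \<Lambda> \<epsilon> R \<Longrightarrow>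
     norm (f z - (\<Sum>l<n. a l * z ^ l)) \<le> C / \<epsilon> * A ^ n * norm q powr (real n ^ 2 / (2 * s)) * norm z ^ n"
    using assms(1) unfolding q_asymp_def by blast
  show ?thesis
  proof (rule q_asympI[OF \<open>C > 0\<close> \<open>A > 0\<close>])
    fix \<epsilon> :: real and z n assume z: "\<epsilon> > 0" "z \<in> qsector \<Lambda> \<epsilon> R"
    show "norm (g z - (\<Sum>l<n. a l * z ^ l)) \<le> C / \<epsilon> * A ^ n * norm q powr (real n ^ 2 / (2 * s)) * norm z ^ n"
      using f[OF z] unfolding eq[OF z] .
  qed
qed

lemma q_asymp_mono:
  assumes "q_asymp s R f a" "R' \<le> R"
  shows "q_asymp s R' f a"
proof -
  have "z \<in> qsector \<Lambda> \<epsilon> R" if "z \<in> qsector \<Lambda> \<epsilon> R'" for \<epsilon> z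
    using that assms(2) by (auto simp: qsector_def)
  then show ?thesis using assms(1) unfolding q_asymp_def by blast
qed

text \<open>Test points tending to 0 with a fixed \<epsilon>, so that the constant C / \<epsilon>
  does not deteriorate along the sequence. Half of the lower bound for \<open>dq\<close> makes the
  sector condition strict.\<close>

lemma sector_sequence:
  assumes "R > 0"
  obtains z0 \<epsilon> where "z0 \<noteq> 0" "\<epsilon> > 0" "\<And>n. z0 / q ^ n \<in> qsector \<Lambda> \<epsilon> R"
proof -
  obtain t d where t: "0 < t" "t < R" "0 < d"
    "\<And>z n \<sigma>. norm z = t / norm q ^ n \<Longrightarrow> \<sigma> \<in># \<Lambda> \<Longrightarrow> d \<le> dq_spiral z \<sigma>"
    using good_radius[OF assms] by metis
  have "of_real t / q ^ n \<in> qsector \<Lambda> (d ^ size \<Lambda> / 2) R" for n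
  proof -
    have n: "norm (of_real t / q ^ n) = t / norm q ^ n" using t by (simp add: norm_divide norm_power)
    then have "d ^ size \<Lambda> \<le> dq (of_real t / q ^ n) \<Lambda>" using t by (intro dq_ge_power) auto
    moreover have "d ^ size \<Lambda> > 0" using t by simp
    ultimately have "d ^ size \<Lambda> / 2 < dq (of_real t / q ^ n) \<Lambda>" by linarith
    moreover have "t / norm q ^ n \<le> t / 1" by (intro divide_left_mono one_le_power mult_pos_pos zero_less_power) (use t q q0 in auto)
    ultimately show ?thesis unfolding qsector_def using t q0 n by auto
  qed
  then show thesis using that[of "of_real t" "d ^ size \<Lambda> / 2"] t by simp
qed

text \<open>The term a_n z^n is the difference of two consecutive remainders at one fixed point z,
  and |z|^n cancels. The constants reflect (n + 1)^2 / (2 s) = n^2 / (2 s) + n / s + 1 / (2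
  s).\<close>

lemma q_asymp_coeff_bound:
  assumes "q_asymp s R f a" "R > 0" "s > 0"
  shows "\<exists>A>0. (\<lambda>n. norm (a n)) \<in> O(\<lambda>n. A ^ n * norm q powr (1 / s * real n ^ 2 / 2))"
proof -
  let ?p = "norm q"
  obtain C A where C: "C > 0" "A > 0" and f: "\<And>\<epsilon> z n. \<epsilon> > 0 \<Longrightarrow> z \<in> qsector \<Lambda> \<epsilon> R \<Longrightarrow>
     norm (f z - (\<Sum>l<n. a l * z ^ l)) \<le> C / \<epsilon> * A ^ n * norm q powr (real n ^ 2 / (2 * s)) * norm z ^ n"
    using assms(1) unfolding q_asymp_def by blast
  obtain z \<epsilon> where "z \<noteq> 0" "\<epsilon> > 0" and z: "\<And>n. z / q ^ n \<in> qsector \<Lambda> \<epsilon> R"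
    using sector_sequence[OF assms(2)] by blast
  have z0: "z \<in> qsector \<Lambda> \<epsilon> R" using z[of 0] by simp
  define D where "D = C / \<epsilon> * (1 + A * norm z * ?p powr (1 / (2 * s)))"
  define B where "B = A * ?p powr (1 / s)"
  have pos: "?p powr (1 / s) \<ge> 1" using q assms by (intro ge_one_powr_ge_zero) auto
  have "norm (a n) \<le> D * (B ^ n * ?p powr (1 / s * real n ^ 2 / 2))" for n
  proof -
    let ?w = "?p powr (real n ^ 2 / (2 * s))"
    define X where "X = C / \<epsilon> * A ^ n * ?w"
    define P where "P = (?p powr (1 / s)) ^ n"
    define Y where "Y = A * norm z * ?p powr (1 / (2 * s))"
    have w: "?p powr (real (Suc n) ^ 2 / (2 * s)) = ?w * (?p powr (1 / s)) ^ n * ?p powr (1 / (2 * s))"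
    proof -
      have "real (Suc n) ^ 2 / (2 * s) = real n ^ 2 / (2 * s) + 1 / s * real n + 1 / (2 * s)"
        using assms(3) by (simp add: power2_eq_square add_divide_distrib algebra_simps)
      moreover have "(?p powr (1 / s)) ^ n = ?p powr (1 / s * real n)"
        using q0 by (simp add: powr_realpow[symmetric] powr_powr)
      ultimately show ?thesis by (simp only: powr_add)
    qed
    have "a n * z ^ n = (f z - (\<Sum>l<n. a l * z ^ l)) - (f z - (\<Sum>l<Suc n. a l * z ^ l))" by simp
    then have "norm (a n) * norm z ^ n \<le>
        norm (f z - (\<Sum>l<n. a l * z ^ l)) + norm (f z - (\<Sum>l<Suc n. a l * z ^ l))"
      unfolding norm_mult[symmetric] norm_power[symmetric] by (simp only: norm_triangle_ineq4)
    also have "\<dots> \<le> C / \<epsilon> * A ^ n * ?w * norm z ^ n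
        + C / \<epsilon> * A ^ Suc n * (?w * (?p powr (1 / s)) ^ n * ?p powr (1 / (2 * s))) * norm z ^ Suc n"
      using f[OF \<open>\<epsilon> > 0\<close> z0, of n] f[OF \<open>\<epsilon> > 0\<close> z0, of "Suc n"] unfolding w by (rule add_mono)
    also have "\<dots> = X * norm z ^ n + X * P * Y * norm z ^ n"
      unfolding X_def P_def Y_def power_Suc by (simp only: mult_ac)
    also have "\<dots> \<le> X * P * norm z ^ n + X * P * Y * norm z ^ n"
    proof -
      have "X * 1 \<le> X * P"
        using C \<open>\<epsilon> > 0\<close> pos unfolding P_def by (intro mult_left_mono one_le_power) (auto simp: X_def)
      then show ?thesis by (intro add_right_mono mult_right_mono) auto
    qed
    also have "\<dots> = X * P * (1 + Y) * norm z ^ n" by (simp only: distrib_left distrib_right mult_1_right)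
    also have "X * P * (1 + Y) = D * (B ^ n * ?w)"
      unfolding X_def P_def D_def B_def Y_def power_mult_distrib by (simp only: mult_ac)
    finally have "norm (a n) \<le> D * (B ^ n * ?w)" using \<open>z \<noteq> 0\<close> by simp
    moreover have "1 / s * real n ^ 2 / 2 = real n ^ 2 / (2 * s)" by simp
    ultimately show ?thesis by (simp only:)
  qed
  then have "(\<lambda>n. norm (a n)) \<in> O(\<lambda>n. B ^ n * ?p powr (1 / s * real n ^ 2 / 2))"
    using C q0 by (intro bigoI[of _ D] always_eventually) (auto simp: B_def abs_mult)
  moreover have "B > 0" using C q0 by (simp add: B_def)
  ultimately show ?thesis by blast
qed

text \<open>Once the lower coefficients agree, the remainders of order n + 1 differ by (a_n - b_n)
  z^n. This is O(|z|^(n + 1)) along the test points, which forces equality.\<close>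

lemma q_asymp_unique:
  assumes "q_asymp s R f a" "q_asymp s R f b" "R > 0"
  shows "a n = b n"
proof (induction n rule: less_induct)
  case (less n)
  obtain C A where C: "C > 0" "A > 0" and f: "\<And>\<epsilon> z n. \<epsilon> > 0 \<Longrightarrow> z \<in> qsector \<Lambda> \<epsilon> R \<Longrightarrow>
     norm (f z - (\<Sum>l<n. a l * z ^ l)) \<le> C / \<epsilon> * A ^ n * norm q powr (real n ^ 2 / (2 * s)) * norm z ^ n"
    using assms(1) unfolding q_asymp_def by blast
  obtain D B where D: "D > 0" "B > 0" and g: "\<And>\<epsilon> z n. \<epsilon> > 0 \<Longrightarrow> z \<in> qsector \<Lambda> \<epsilon> R \<Longrightarrow>
     norm (f z - (\<Sum>l<n. b l * z ^ l)) \<le> D / \<epsilon> * B ^ n * norm q powr (real n ^ 2 / (2 * s)) * norm z ^ n"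
    using assms(2) unfolding q_asymp_def by blast
  obtain z0 \<epsilon> where z0: "z0 \<noteq> 0" "\<epsilon> > 0" and z: "\<And>n. z0 / q ^ n \<in> qsector \<Lambda> \<epsilon> R"
    using sector_sequence[OF assms(3)] by blast
  define K where "K = C / \<epsilon> * A ^ Suc n * norm q powr (real (Suc n) ^ 2 / (2 * s)) +
    D / \<epsilon> * B ^ Suc n * norm q powr (real (Suc n) ^ 2 / (2 * s))"
  have "norm (a n - b n) \<le> K * norm (z0 / q ^ k)" for k
  proof -
    let ?z = "z0 / q ^ k"
    have nz: "?z \<noteq> 0" using z0 q0 by simp
    have "(\<Sum>l<Suc n. a l * ?z ^ l) - (\<Sum>l<Suc n. b l * ?z ^ l) = (a n - b n) * ?z ^ n"
      using less by (simp add: left_diff_distrib)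
    moreover have "(x - v) - (x - u) = u - v" for u v x :: complex by simp
    ultimately have "(a n - b n) * ?z ^ n = (f ?z - (\<Sum>l<Suc n. b l * ?z ^ l)) - (f ?z - (\<Sum>l<Suc n. a l * ?z ^ l))"
      by (simp only:)
    then have "norm (a n - b n) * norm ?z ^ n \<le>
        norm (f ?z - (\<Sum>l<Suc n. b l * ?z ^ l)) + norm (f ?z - (\<Sum>l<Suc n. a l * ?z ^ l))"
      unfolding norm_mult[symmetric] norm_power[symmetric] by (simp only: norm_triangle_ineq4)
    also have "\<dots> \<le> K * norm ?z ^ Suc n"
      using f[OF z0(2) z[of k], of "Suc n"] g[OF z0(2) z[of k], of "Suc n"]
      unfolding K_def distrib_right by linarith
    also have "\<dots> = (K * norm ?z) * norm ?z ^ n" by simp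
    finally show ?thesis using nz by (simp only: mult_le_cancel_right) (use nz in auto)
  qed
  moreover have "(\<lambda>k. K * norm (z0 / q ^ k)) \<longlonglongrightarrow> K * 0"
  proof (intro tendsto_mult tendsto_const)
    have "(\<lambda>k. z0 * inverse q ^ k) \<longlonglongrightarrow> z0 * 0"
      by (intro tendsto_mult tendsto_const inverse_power_null[OF q])
    then show "(\<lambda>k. norm (z0 / q ^ k)) \<longlonglongrightarrow> 0"
      by (simp add: divide_inverse power_inverse tendsto_norm_zero)
  qed
  ultimately have "norm (a n - b n) \<le> K * 0"
    by (intro tendsto_lowerbound[where F = sequentially]) auto
  then show ?case by simp
qed

end

section \<open>Existence of the expansion\<close>

lemma remove_sings_analytic:
  assumes E: "E analytic_on {z0}" and ev: "\<forall>\<^sub>F z in at z0. g z = E z"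
  shows "remove_sings g analytic_on {z0}"
proof -
  obtain S where S: "open S" "z0 \<in> S" "\<And>z. z \<in> S \<Longrightarrow> z \<noteq> z0 \<Longrightarrow> g z = E z"
    using ev by (auto simp: eventually_at_topological)
  have eq: "remove_sings g z = remove_sings E z" if z: "z \<in> S" for z
  proof (rule remove_sings_cong)
    have "\<forall>\<^sub>F w in at z. w \<in> S - {z0}"
    proof (cases "z = z0")
      case True
      then show ?thesis using eventually_at_in_open[OF S(1,2)] by simp
    next
      case False
      then show ?thesis using S(1) z by (intro eventually_at_in_open') auto
    qed
    then show "\<forall>\<^sub>F w in at z. g w = E w" by (rule eventually_mono) (use S(3) in auto)
  qed simp
  have "\<forall>\<^sub>F z in nhds z0. remove_sings g z = remove_sings E z"
    using eventually_nhds_in_open[OF S(1,2)] by (rule eventually_mono) (rule eq)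
  then show ?thesis
    using remove_sings_analytic_on[OF E] by (simp add: analytic_at_cong)
qed

context q_divisor_reps
begin

text \<open>Near 0, f is the sum of a function \<open>h\<close> holomorphic at 0 and the finite sum
  \<open>T\<close> of polar series, and each of these has an expansion already.\<close>

lemma asymptotic_expansion:
  assumes R0: "R0 > 0" and f_an: "f analytic_on qsector \<Lambda> 0 R0"
    and f_bd: "\<And>\<epsilon> r. \<epsilon> > 0 \<Longrightarrow> 0 < r \<Longrightarrow> r < R0 \<Longrightarrow> bounded (f ` qsector \<Lambda> \<epsilon> r)"
    and F: "F holomorphic_on ball 0 r1 - {0}" "r1 > 0"
    and fF: "R1 > 0" "\<And>z. z \<in> qsector \<Lambda> 0 R1 \<Longrightarrow> f z = F z / theta_div q \<rho> \<Lambda> z"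
    and bound: "\<And>\<sigma> i. \<sigma> \<in># \<Lambda> \<Longrightarrow> i < count \<Lambda> \<sigma> \<Longrightarrow>
      q_bound (norm q) (real (size \<Lambda>) - s) (\<lambda>k. (deriv ^^ i) F (\<rho> \<sigma> / q ^ k))"
    and s: "s > 0"
  shows "\<exists>a. \<exists>R>0. q_asymp s R f a"
proof -
  define PP where "PP \<sigma> c N \<longleftrightarrow> (\<forall>i<count \<Lambda> \<sigma>. q_bound (norm q) (- s) (c i)) \<and>
    (\<forall>k\<ge>N. \<exists>E. E analytic_on {\<rho> \<sigma> / q ^ k} \<and> (\<forall>\<^sub>F z in at (\<rho> \<sigma> / q ^ k).
       F z / theta_div q \<rho> \<Lambda> z =
       (\<Sum>i<count \<Lambda> \<sigma>. c i k / (z / (\<rho> \<sigma> / q ^ k) - 1) ^ (count \<Lambda> \<sigma> - i)) + E z))"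
    for \<sigma> and c :: "nat \<Rightarrow> nat \<Rightarrow> complex" and N :: nat
  have "\<exists>c N. PP \<sigma> c N" if \<sigma>: "\<sigma> \<in># \<Lambda>" for \<sigma>
    by (rule principal_parts[OF F \<sigma> bound[OF \<sigma>]]) (auto simp: PP_def)
  then obtain c N where cN: "\<And>\<sigma>. \<sigma> \<in># \<Lambda> \<Longrightarrow> PP \<sigma> (c \<sigma>) (N \<sigma>)" by metis
  \<comment> \<open>\<open>principal_parts\<close> says nothing about the poles with k <
    \<open>N \<sigma>\<close>; they are left out of the series, and \<open>r0\<close> below is small
    enough to exclude them from the disc.\<close>
  define c' where "c' \<sigma> i k = (if k < N \<sigma> then 0 else c \<sigma> i k)" for \<sigma> i k
  have c': "\<exists>C>0. \<exists>A>0. \<forall>k. norm (c' \<sigma> i k) \<le> C * A ^ k * norm q powr (- s * real k ^ 2 / 2)"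
    if \<sigma>: "\<sigma> \<in># \<Lambda>" "i < count \<Lambda> \<sigma>" for \<sigma> i
  proof -
    have "q_bound (norm q) (- s) (c \<sigma> i)" using cN[OF \<sigma>(1)] \<sigma>(2) by (simp add: PP_def)
    then obtain C A where C: "C > 0" "A > 0"
      and le: "\<And>k. norm (c \<sigma> i k) \<le> C * A ^ k * norm q powr (- s * real k ^ 2 / 2)"
      using q by (rule q_bound_everywhere) blast
    have "norm (c' \<sigma> i k) \<le> C * A ^ k * norm q powr (- s * real k ^ 2 / 2)" for k
      using le[of k] C by (simp add: c'_def)
    then show ?thesis using C by blast
  qed
  have c'_sum: "summable (\<lambda>k. norm (c' \<sigma> i k))" if \<sigma>: "\<sigma> \<in># \<Lambda>" "i < count \<Lambda> \<sigma>" for \<sigma> i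
  proof -
    obtain C A where C: "C > 0" "A > 0"
      "\<And>k. norm (c' \<sigma> i k) \<le> C * A ^ k * norm q powr (- s * real k ^ 2 / 2)"
      using c'[OF \<sigma>] by blast
    have "summable (\<lambda>k. norm (c' \<sigma> i k) * norm q ^ (k * 0))"
      by (rule gaussian_sum_bound[OF q s C]) blast
    then show ?thesis by simp
  qed
  define r0 where "r0 = Min (insert (min R0 (min R1 r1)) ((\<lambda>\<sigma>. norm (\<rho> \<sigma>) / norm q ^ N \<sigma>) ` set_mset \<Lambda>))"
  have "r0 > 0"
    unfolding r0_def using R0 F fF q0 rep(1) by (subst Min_gr_iff) auto
  have "r0 \<le> min R0 (min R1 r1)" unfolding r0_def by (rule Min_le) auto
  then have r0: "r0 \<le> R0" "r0 \<le> R1" "r0 \<le> r1" by auto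
  have r0N: "r0 \<le> norm (\<rho> \<sigma>) / norm q ^ N \<sigma>" if "\<sigma> \<in># \<Lambda>" for \<sigma>
    unfolding r0_def by (rule Min_le) (use that in auto)
  have pole: "\<exists>k\<ge>N \<sigma>. z = \<rho> \<sigma> / q ^ k" if \<sigma>: "\<sigma> \<in># \<Lambda>" "z \<in> \<sigma>" "norm z < r0" for \<sigma> z
  proof -
    have "z \<in> qspiral q (\<rho> \<sigma>)" using \<sigma> rep(2) by metis
    then obtain n where n: "z = \<rho> \<sigma> * q powi n" by (auto simp: qspiral_def)
    have "norm (\<rho> \<sigma>) * norm q powi n < norm (\<rho> \<sigma>) / norm q ^ N \<sigma>"
      using r0N[OF \<sigma>(1)] \<sigma>(3) by (simp add: n norm_mult norm_power_int)
    also have "\<dots> = norm (\<rho> \<sigma>) * norm q powi (- int (N \<sigma>))"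
      by (simp add: power_int_minus divide_inverse)
    finally have "norm q powi n < norm q powi (- int (N \<sigma>))"
      using rep(1)[OF \<sigma>(1)] by simp
    then have "\<not> - int (N \<sigma>) \<le> n"
      using q power_int_increasing[of "- int (N \<sigma>)" n "norm q"] by auto
    then have "nat (- n) \<ge> N \<sigma>" "n = - int (nat (- n))" by auto
    then have "z = \<rho> \<sigma> / q ^ nat (- n)"
      unfolding n by (metis divide_inverse power_int_minus power_int_of_nat)
    then show ?thesis using \<open>nat (- n) \<ge> N \<sigma>\<close> by blast
  qed
  define S where "S \<sigma> i z = (\<Sum>k. c' \<sigma> i k / (z / (\<rho> \<sigma> / q ^ k) - 1) ^ (count \<Lambda> \<sigma> - i))" for \<sigma> i z
  define T where "T z = (\<Sum>\<sigma>\<in>set_mset \<Lambda>. \<Sum>i<count \<Lambda> \<sigma>. S \<sigma> i z)" for z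
  have on_spiral: "\<rho> \<sigma> / q ^ k \<in> \<sigma>" if "\<sigma> \<in># \<Lambda>" for \<sigma> k
    using qspiral_divide_power[OF q0, of "\<rho> \<sigma>" k] rep(2)[OF that] by simp
  have S_an: "S \<sigma> i analytic_on {z0}" if "\<sigma> \<in># \<Lambda>" "i < count \<Lambda> \<sigma>" "z0 \<noteq> 0" "z0 \<notin> \<sigma>" for \<sigma> i z0
    unfolding S_def[abs_def]
    by (rule polar_series_analytic(1)[OF c'_sum[OF that(1,2)] rep(1)[OF that(1)] that(3)])
       (use on_spiral[OF that(1)] that(4) in auto)
  have f_an': "f analytic_on {z0}" if "z0 \<noteq> 0" "norm z0 < r0" "dq z0 \<Lambda> > 0" for z0
    by (rule analytic_on_subset[OF f_an]) (use that r0 in \<open>auto simp: qsector_def\<close>)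
  have g_off: "(\<lambda>z. f z - T z) analytic_on {z0}" if z0: "z0 \<noteq> 0" "norm z0 < r0" "dq z0 \<Lambda> > 0" for z0
  proof -
    have "z0 \<notin> \<sigma>" if "\<sigma> \<in># \<Lambda>" for \<sigma> using dq_pos_iff[OF z0(1)] z0(3) that by blast
    then show ?thesis
      unfolding T_def using z0 by (intro analytic_on_diff analytic_on_sum f_an' S_an) auto
  qed
  \<comment> \<open>On a spiral, the principal part of f is exactly that of the series of this
    spiral, and the series of all other spirals are analytic there.\<close>
  have local: "\<exists>E. E analytic_on {z0} \<and> (\<forall>\<^sub>F z in at z0. f z - T z = E z)"
    if z0: "z0 \<noteq> 0" "norm z0 < r0" for z0
  proof (cases "dq z0 \<Lambda> > 0")
    case True
    then show ?thesis using g_off[OF z0] by (intro exI[of _ "\<lambda>z. f z - T z"]) simp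
  next
    case False
    then obtain \<sigma> where \<sigma>: "\<sigma> \<in># \<Lambda>" "z0 \<in> \<sigma>" using dq_pos_iff[OF z0(1)] by blast
    let ?\<nu> = "count \<Lambda> \<sigma>"
    obtain k where k: "k \<ge> N \<sigma>" "z0 = \<rho> \<sigma> / q ^ k" using pole[OF \<sigma> z0(2)] by blast
    obtain E where E: "E analytic_on {z0}" "\<forall>\<^sub>F z in at z0. F z / theta_div q \<rho> \<Lambda> z =
        (\<Sum>i<?\<nu>. c \<sigma> i k / (z / z0 - 1) ^ (?\<nu> - i)) + E z"
      using cN[OF \<sigma>(1)] k unfolding PP_def by blast
    have "\<forall>i\<in>{..<?\<nu>}. \<exists>H. H analytic_on {z0} \<and>
        (\<forall>\<^sub>F z in nhds z0. S \<sigma> i z = c \<sigma> i k / (z / z0 - 1) ^ (?\<nu> - i) + H z)"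
    proof
      fix i assume "i \<in> {..<?\<nu>}"
      then have i: "i < ?\<nu>" by simp
      have eq: "c' \<sigma> i k = c \<sigma> i k" using k(1) by (simp add: c'_def)
      obtain H where "H analytic_on {\<rho> \<sigma> / q ^ k}"
        "\<forall>\<^sub>F z in nhds (\<rho> \<sigma> / q ^ k). S \<sigma> i z = c' \<sigma> i k / (z / (\<rho> \<sigma> / q ^ k) - 1) ^ (?\<nu> - i) + H z"
        unfolding S_def by (rule polar_series_split[OF c'_sum[OF \<sigma>(1) i] rep(1)[OF \<sigma>(1)]])
      then show "\<exists>H. H analytic_on {z0} \<and>
          (\<forall>\<^sub>F z in nhds z0. S \<sigma> i z = c \<sigma> i k / (z / z0 - 1) ^ (?\<nu> - i) + H z)"
        unfolding k(2)[symmetric] eq by blast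
    qed
    from bchoice[OF this] obtain H where H: "\<And>i. i < ?\<nu> \<Longrightarrow> H i analytic_on {z0}"
      "\<And>i. i < ?\<nu> \<Longrightarrow> \<forall>\<^sub>F z in nhds z0. S \<sigma> i z = c \<sigma> i k / (z / z0 - 1) ^ (?\<nu> - i) + H i z"
      by auto
    let ?W = "\<lambda>z. \<Sum>\<tau>\<in>set_mset \<Lambda> - {\<sigma>}. \<Sum>i<count \<Lambda> \<tau>. S \<tau> i z"
    have "z0 \<notin> \<tau>" if "\<tau> \<in># \<Lambda>" "\<tau> \<noteq> \<sigma>" for \<tau>
      using divisor_spiral(2)[OF div q0 \<sigma>] divisor_spiral(2)[OF div q0 that(1)] that(2) by blast
    then have "(\<lambda>z. E z - ((\<Sum>i<?\<nu>. H i z) + ?W z)) analytic_on {z0}"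
      using z0 by (intro analytic_on_diff analytic_on_add analytic_on_sum E(1) H(1) S_an) auto
    moreover have "\<forall>\<^sub>F z in at z0. f z - T z = E z - ((\<Sum>i<?\<nu>. H i z) + ?W z)"
    proof -
      have "\<forall>\<^sub>F z in nhds z0. \<forall>i\<in>{..<?\<nu>}. S \<sigma> i z = c \<sigma> i k / (z / z0 - 1) ^ (?\<nu> - i) + H i z"
        by (intro eventually_ball_finite) (use H(2) in auto)
      then have "\<forall>\<^sub>F z in at z0. \<forall>i\<in>{..<?\<nu>}. S \<sigma> i z = c \<sigma> i k / (z / z0 - 1) ^ (?\<nu> - i) + H i z"
        by (simp add: eventually_nhds_conv_at)
      moreover have "\<forall>\<^sub>F z in at z0. z \<in> ball 0 r0"
        using eventually_nhds_in_open[of "ball 0 r0" z0] z0 by (simp add: eventually_nhds_conv_at)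
      ultimately show ?thesis
        using E(2) dq_pos_eventually[OF z0(1)]
      proof eventually_elim
        case (elim z)
        have "T z = (\<Sum>i<?\<nu>. S \<sigma> i z) + ?W z"
          unfolding T_def by (rule sum.remove) (use \<sigma> in auto)
        also have "(\<Sum>i<?\<nu>. S \<sigma> i z) = (\<Sum>i<?\<nu>. c \<sigma> i k / (z / z0 - 1) ^ (?\<nu> - i)) + (\<Sum>i<?\<nu>. H i z)"
          using elim(1) by (simp add: sum.distrib)
        finally have "T z = (\<Sum>i<?\<nu>. c \<sigma> i k / (z / z0 - 1) ^ (?\<nu> - i)) + (\<Sum>i<?\<nu>. H i z) + ?W z" .
        moreover have "f z = F z / theta_div q \<rho> \<Lambda> z"
          by (rule fF(2)) (use elim r0 in \<open>auto simp: qsector_def\<close>)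
        ultimately show ?case unfolding elim(3) by simp
      qed
    qed
    ultimately show ?thesis by blast
  qed
  \<comment> \<open>On the spirals f is a total function with arbitrary values;
    \<open>remove_sings\<close> replaces them by limits and changes nothing off the spirals.\<close>
  define g where "g = remove_sings (\<lambda>z. f z - T z)"
  have "g analytic_on {z0}" if "z0 \<in> ball 0 r0 - {0}" for z0
    using local[of z0] that unfolding g_def by (auto intro: remove_sings_analytic)
  then have "g analytic_on (ball 0 r0 - {0})" using analytic_on_analytic_at by blast
  then have g_hol: "g holomorphic_on ball 0 r0 - {0}" by (rule analytic_imp_holomorphic)
  have g_eq: "g z = f z - T z" if "z \<noteq> 0" "norm z < r0" "dq z \<Lambda> > 0" for z
    unfolding g_def using g_off[OF that] by simp
  obtain t d where t: "0 < t" "t < r0" "0 < d" "d \<le> 1"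
    and circ: "\<And>z n \<sigma>. norm z = t / norm q ^ n \<Longrightarrow> \<sigma> \<in># \<Lambda> \<Longrightarrow> d \<le> dq_spiral z \<sigma>"
    by (rule good_radius[OF \<open>r0 > 0\<close>]) blast
  \<comment> \<open>The radius lies strictly between t and r0 \<le> R0, so the sector can hold the
    circle of radius t while the bound on f still applies; half of the lower bound for
    \<open>dq\<close> meets its strict inequality.\<close>
  have "bounded (f ` qsector \<Lambda> (d ^ size \<Lambda> / 2) ((t + r0) / 2))"
    using t r0 by (intro f_bd) auto
  then obtain M where M: "\<And>z. z \<in> qsector \<Lambda> (d ^ size \<Lambda> / 2) ((t + r0) / 2) \<Longrightarrow> norm (f z) \<le> M"
    by (auto simp: bounded_iff)
  define M' where "M' = M + (\<Sum>\<sigma>\<in>set_mset \<Lambda>. \<Sum>i<count \<Lambda> \<sigma>. (\<Sum>k. norm (c' \<sigma> i k)) / d ^ (count \<Lambda> \<sigma> - i))"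
  have g_bd: "norm (g z) \<le> M'" if z: "norm z = t / norm q ^ n" for z n
  proof -
    have "t / norm q ^ n > 0" using t q0 by simp
    then have "norm z > 0" using z by linarith
    then have z0: "z \<noteq> 0" by simp
    have "t / norm q ^ n \<le> t / 1"
      by (intro divide_left_mono one_le_power mult_pos_pos zero_less_power) (use t q q0 in auto)
    then have zt: "norm z \<le> t" using z by simp
    have "d ^ size \<Lambda> \<le> dq z \<Lambda>" using t circ[OF z] by (intro dq_ge_power) auto
    moreover have "d ^ size \<Lambda> > 0" using t by simp
    ultimately have dz: "d ^ size \<Lambda> / 2 < dq z \<Lambda>" "0 < dq z \<Lambda>" by linarith+
    have "norm (f z) \<le> M" by (rule M) (use z0 zt t dz in \<open>auto simp: qsector_def\<close>)
    moreover have "norm (T z) \<le> (\<Sum>\<sigma>\<in>set_mset \<Lambda>. \<Sum>i<count \<Lambda> \<sigma>. (\<Sum>k. norm (c' \<sigma> i k)) / d ^ (count \<Lambda> \<sigma> - i))"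
      unfolding T_def
    proof (intro sum_norm_le)
      fix \<sigma> i assume \<sigma>: "\<sigma> \<in> set_mset \<Lambda>" and i: "i \<in> {..<count \<Lambda> \<sigma>}"
      have "d \<le> norm (z / (\<rho> \<sigma> / q ^ k) - 1)" for k
        using order_trans[OF circ[OF z \<sigma>] dq_spiral_le[OF on_spiral[OF \<sigma>]]]
        by (simp add: norm_minus_commute)
      then show "norm (S \<sigma> i z) \<le> (\<Sum>k. norm (c' \<sigma> i k)) / d ^ (count \<Lambda> \<sigma> - i)"
        unfolding S_def using \<sigma> i t by (intro polar_series_summable(2) c'_sum) auto
    qed
    moreover have "norm (g z) \<le> norm (f z) + norm (T z)"
      using g_eq[of z] z0 zt t dz norm_triangle_ineq4[of "f z" "T z"] by simp
    ultimately show ?thesis unfolding M'_def by linarith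
  qed
  obtain h where h: "h holomorphic_on ball 0 r0" "\<And>z. z \<in> ball 0 r0 - {0} \<Longrightarrow> h z = g z"
    by (rule holomorphic_extend_circles[OF g_hol q t(1,2)]) (erule g_bd, rule that)
  have "\<exists>a. q_asymp s (r0 / 2) h a"
    using h(1) \<open>r0 > 0\<close> s by (intro q_asymp_holomorphic) auto
  then obtain a where a: "q_asymp s (r0 / 2) h a" by blast
  have "\<exists>b. q_asymp s (r0 / 2) T b"
    unfolding T_def[abs_def]
  proof (intro q_asymp_sum finite_set_mset finite_lessThan)
    fix \<sigma> i assume \<sigma>: "\<sigma> \<in> set_mset \<Lambda>" and i: "i \<in> {..<count \<Lambda> \<sigma>}"
    then obtain C A where C: "C > 0" "A > 0"
      "\<And>k. norm (c' \<sigma> i k) \<le> C * A ^ k * norm q powr (- s * real k ^ 2 / 2)"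
      using c'[of \<sigma> i] by auto
    show "\<exists>b. q_asymp s (r0 / 2) (S \<sigma> i) b"
      unfolding S_def[abs_def]
      by (rule q_asymp_polar_series[OF \<sigma> reps[OF \<sigma>] _ s C]) simp
  qed
  then obtain b where b: "q_asymp s (r0 / 2) T b" by blast
  have "q_asymp s (r0 / 2) f (\<lambda>n. a n + b n)"
    by (rule q_asymp_cong[OF q_asymp_add[OF a b]]) (use h(2) g_eq \<open>r0 > 0\<close> in auto)
  then show ?thesis using \<open>r0 > 0\<close> by (metis half_gt_zero)
qed

text \<open>Replacing C by C + 1 makes the bound strict: 0 is not in a sector, so the factor |z|^n
  never vanishes.\<close>

lemma q_asymp_iff_strict:
  "q_asymp s R f a \<longleftrightarrow> (\<exists>C>0. \<exists>A>0. \<forall>\<epsilon>>0. \<forall>z\<in>qsector \<Lambda> \<epsilon> R. \<forall>n::nat.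
     norm (f z - (\<Sum>l<n. a l * z ^ l)) < C / \<epsilon> * A ^ n * norm q powr (real n ^ 2 / (2 * s)) * norm z ^ n)"
    (is "_ \<longleftrightarrow> ?strict")
proof
  assume "q_asymp s R f a"
  then obtain C A where C: "C > 0" "A > 0" and f: "\<And>\<epsilon> z n. \<epsilon> > 0 \<Longrightarrow> z \<in> qsector \<Lambda> \<epsilon> R \<Longrightarrow>
     norm (f z - (\<Sum>l<n. a l * z ^ l)) \<le> C / \<epsilon> * A ^ n * norm q powr (real n ^ 2 / (2 * s)) * norm z ^ n"
    unfolding q_asymp_def by blast
  have "norm (f z - (\<Sum>l<n. a l * z ^ l)) <
      (C + 1) / \<epsilon> * A ^ n * norm q powr (real n ^ 2 / (2 * s)) * norm z ^ n"
    if z: "\<epsilon> > 0" "z \<in> qsector \<Lambda> \<epsilon> R" for \<epsilon> z n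
  proof -
    have "z \<noteq> 0" using z by (simp add: qsector_def)
    then have "C / \<epsilon> * A ^ n * norm q powr (real n ^ 2 / (2 * s)) * norm z ^ n <
        (C + 1) / \<epsilon> * A ^ n * norm q powr (real n ^ 2 / (2 * s)) * norm z ^ n"
      using C z(1) q0 by (intro mult_strict_right_mono divide_strict_right_mono) auto
    then show ?thesis using f[OF z, of n] by linarith
  qed
  moreover have "C + 1 > 0" using C by simp
  ultimately show ?strict using C(2) by blast
next
  assume ?strict
  then obtain C A where C: "C > 0" "A > 0" and f: "\<And>\<epsilon> z n. \<epsilon> > 0 \<Longrightarrow> z \<in> qsector \<Lambda> \<epsilon> R \<Longrightarrow>
     norm (f z - (\<Sum>l<n. a l * z ^ l)) < C / \<epsilon> * A ^ n * norm q powr (real n ^ 2 / (2 * s)) * norm z ^ n"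
    by blast
  show "q_asymp s R f a"
    by (rule q_asympI[OF C]) (rule less_imp_le[OF f])
qed

end

section \<open>From the levels of the partition to the theorem\<close>

lemma size_sum_mset:
  fixes P :: "'i \<Rightarrow> 'a multiset"
  shows "size (\<Sum>i\<in>I. P i) = (\<Sum>i\<in>I. size (P i))"
  by (induction I rule: infinite_finite_induct) auto

lemma ordered_partition_divisor:
  assumes "ordered_partition q \<Lambda> m P"
  shows "is_divisor q \<Lambda>"
  unfolding is_divisor_def
proof
  fix \<sigma> assume "\<sigma> \<in># \<Lambda>"
  then have "count (\<Sum>i=1..m. P i) \<sigma> \<noteq> 0" using assms by (simp add: ordered_partition_def)
  then have "(\<Sum>i=1..m. count (P i) \<sigma>) \<noteq> 0" unfolding count_sum .
  then obtain i where "i \<in> {1..m}" "count (P i) \<sigma> \<noteq> 0" by (meson sum.not_neutral_contains_not_neutral)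
  then show "\<exists>l. l \<noteq> 0 \<and> \<sigma> = qspiral q l"
    using assms unfolding ordered_partition_def is_divisor_def by (metis count_eq_zero_iff)
qed

text \<open>Each derivative order below the multiplicity is controlled by exactly one level of the
  partition, and the weakest of these bounds is the one of the first level.\<close>

lemma qE_derivative_bound:
  assumes q: "norm q > 1" and P: "ordered_partition q \<Lambda> m P" and F: "F \<in> qE q \<rho> \<Lambda> m P"
    and \<sigma>: "\<sigma> \<in># \<Lambda>" and j: "j < count \<Lambda> \<sigma>"
  shows "q_bound (norm q) (real (size \<Lambda>) - real (size (P 1))) (\<lambda>k. (deriv ^^ j) F (\<rho> \<sigma> / q ^ k))"
proof -
  have m: "1 \<le> m" and \<Lambda>: "\<Lambda> = (\<Sum>i=1..m. P i)" using P by (auto simp: ordered_partition_def)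
  define c where "c i = count (part_from m P i) \<sigma>" for i
  \<comment> \<open>A discrete intermediate value argument: \<open>c\<close> is the multiplicity of
    \<sigma> in \<Lambda>, hence above j, at index 1, and 0 at index m + 1, where the sum is
    empty.\<close>
  have "\<exists>i\<in>{1..m}. j < c i \<and> c (i + 1) \<le> j"
  proof (rule ccontr)
    assume no: "\<not> (\<exists>i\<in>{1..m}. j < c i \<and> c (i + 1) \<le> j)"
    have "j < c (Suc i)" if "i \<le> m" for i
      using that
    proof (induction i)
      case 0
      then show ?case using j by (simp add: c_def part_from_def \<Lambda>)
    next
      case (Suc i)
      then have "j < c (Suc i)" "Suc i \<in> {1..m}" by auto
      then show ?case using no by force
    qed
    then have "j < c (Suc m)" by blast
    then show False by (simp add: c_def part_from_def)
  qed
  then obtain i where i: "i \<in> {1..m}" "j < c i" "c (i + 1) \<le> j" by blast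
  have "\<sigma> \<in># part_from m P i" using i(2) by (simp add: c_def flip: count_greater_zero_iff)
  then have "\<exists>C>0. \<exists>A>0. \<forall>\<^sub>F n in sequentially. norm ((deriv ^^ j) F (\<rho> \<sigma> * q powi (- int n)))
      \<le> C * A ^ n * norm q powr (real (size (part_from m P (i + 1))) * real n ^ 2 / 2)"
    using F i unfolding qE_def qgevrey_over_def c_def by blast
  moreover have "\<rho> \<sigma> * q powi (- int n) = \<rho> \<sigma> / q ^ n" for n
    by (simp add: power_int_minus divide_inverse)
  ultimately have level: "q_bound (norm q) (real (size (part_from m P (i + 1)))) (\<lambda>n. (deriv ^^ j) F (\<rho> \<sigma> / q ^ n))"
    unfolding q_bound_def by simp
  \<comment> \<open>Since i \<ge> 1, the tail from i + 1 on never contains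
    \<open>P 1\<close>.\<close>
  have "size (part_from m P (i + 1)) + size (P 1) \<le> size \<Lambda>"
  proof -
    have "size (part_from m P (i + 1)) = (\<Sum>k=i+1..m. size (P k))"
      unfolding part_from_def by (rule size_sum_mset)
    also have "\<dots> \<le> (\<Sum>k=Suc 1..m. size (P k))" using i by (intro sum_mono2) auto
    finally show ?thesis
      unfolding \<Lambda> size_sum_mset using m by (simp add: sum.atLeast_Suc_atMost)
  qed
  then have "real (size (part_from m P (i + 1))) \<le> real (size \<Lambda>) - real (size (P 1))" by linarith
  then show ?thesis by (rule q_bound_mono[OF level _ q])
qed

theorem theorem5p4p7:
  fixes q :: complex and \<Lambda> :: divisor and m :: nat and P :: "nat \<Rightarrow> divisor"
    and \<rho> :: "complex set \<Rightarrow> complex" and f :: "complex \<Rightarrow> complex"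
  assumes "norm q > 1"
    and "ordered_partition q \<Lambda> m P"
    and "\<forall>\<sigma> \<in># \<Lambda>. \<rho> \<sigma> \<in> \<sigma>"
    and "f \<in> qO q \<rho> \<Lambda> m P"
  shows "\<exists>!a. a \<in> qgevrey_fps q (1 / real (size (P 1))) \<and>
           (\<forall>\<^sub>F R in at_right (0::real). \<exists>C>0. \<exists>A>0. \<forall>\<epsilon>>0. \<forall>z \<in> qsector \<Lambda> \<epsilon> R. \<forall>n::nat.
              norm (f z - (\<Sum>l<n. fps_nth a l * z ^ l))
                < C / \<epsilon> * A ^ n * norm q powr (real n ^ 2 / (2 * real (size (P 1)))) * norm z ^ n)"
proof -
  interpret q_divisor_reps q \<Lambda> \<rho>
    using assms ordered_partition_divisor by unfold_locales auto
  define s where "s = real (size (P 1))"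
  have "1 \<le> size (P 1)" using assms(2) by (auto simp: ordered_partition_def)
  then have s: "s > 0" by (simp add: s_def)
  obtain F R1 where F: "F \<in> qE q \<rho> \<Lambda> m P" and "R1 > 0"
    and fF: "\<And>z. z \<in> qsector \<Lambda> 0 R1 \<Longrightarrow> f z = F z / theta_div q \<rho> \<Lambda> z"
    using assms(4) unfolding qO_def by blast
  obtain R0 where R0: "R0 > 0" "f analytic_on qsector \<Lambda> 0 R0"
    "\<And>\<epsilon> r. \<epsilon> > 0 \<Longrightarrow> 0 < r \<Longrightarrow> r < R0 \<Longrightarrow> bounded (f ` qsector \<Lambda> \<epsilon> r)"
    using assms(4) unfolding qO_def qB_def by blast
  obtain r1 where r1: "r1 > 0" "F analytic_on ball 0 r1 - {0}"
    using F unfolding qE_def analytic_punctured_def by blast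
  have F_hol: "F holomorphic_on ball 0 r1 - {0}" using r1(2) by (rule analytic_imp_holomorphic)
  have bound: "q_bound (norm q) (real (size \<Lambda>) - s) (\<lambda>k. (deriv ^^ i) F (\<rho> \<sigma> / q ^ k))"
    if "\<sigma> \<in># \<Lambda>" "i < count \<Lambda> \<sigma>" for \<sigma> i
    unfolding s_def by (rule qE_derivative_bound[OF assms(1,2) F that])
  obtain a R where R: "R > 0" and a: "q_asymp s R f a"
    using asymptotic_expansion[OF R0 F_hol r1(1) \<open>R1 > 0\<close> fF bound s] by blast
  show ?thesis
    unfolding s_def[symmetric] q_asymp_iff_strict[symmetric]
  proof (rule ex1I)
    have nth: "fps_nth (Abs_fps a) = a" by (rule ext) simp
    show "Abs_fps a \<in> qgevrey_fps q (1 / s) \<and>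
        (\<forall>\<^sub>F R' in at_right 0. q_asymp s R' f (fps_nth (Abs_fps a)))"
      unfolding qgevrey_fps_def mem_Collect_eq nth
    proof
      show "\<exists>A>0. (\<lambda>n. norm (a n)) \<in> O(\<lambda>n. A ^ n * norm q powr (1 / s * real n ^ 2 / 2))"
        by (rule q_asymp_coeff_bound[OF a R s])
      show "\<forall>\<^sub>F R' in at_right 0. q_asymp s R' f a"
        using eventually_at_right_real[OF R] by (rule eventually_mono) (rule q_asymp_mono[OF a], simp)
    qed
  next
    fix b assume "b \<in> qgevrey_fps q (1 / s) \<and> (\<forall>\<^sub>F R' in at_right 0. q_asymp s R' f (fps_nth b))"
    then have "\<forall>\<^sub>F R' in at_right 0. q_asymp s R' f (fps_nth b)" ..
    \<comment> \<open>The two series must be compared on one radius: any small R' for which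
      \<open>b\<close> is valid serves, because \<open>a\<close> is valid for every radius below
      \<open>R\<close>.\<close>
    from eventually_happens'[OF trivial_limit_at_right_real eventually_conj[OF eventually_at_right_real[OF R] this]]
    obtain R' where R': "0 < R'" "R' < R" "q_asymp s R' f (fps_nth b)" by auto
    have "q_asymp s R' f a" by (rule q_asymp_mono[OF a]) (use R' in simp)
    then have "fps_nth b n = a n" for n using q_asymp_unique[OF R'(3) _ R'(1)] by blast
    then show "b = Abs_fps a" by (simp add: fps_eq_iff)
  qed
qed

end
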